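(* Let $f=(f_1,f_2)\in\mathbb{R}[x_1,x_2]^2$ with $d_j=\deg f_j$ satisfy the genericity conditions listed in the context, let $S=\{r\in\mathbb{R}^2: f(r)\ne0\text{ and } r\text{ is a singular point of }C_r\}$, and let $\#\mathrm{cells}$ be the number of cells of $f$, i.e. of connected components of $\mathbb{R}^2\setminus\overline{B}$, where $\overline{B}$ is the extended boundary. If $d_1>d_2$, then $$\#\mathrm{cells}\ \le\ (\#S)^2 d_1(d_1-d_2)+\#S\,(2d_1d_2-1)+d_2^2+1,$$ and, if $f$ is infinity complete (as defined in the context), then $$\#\mathrm{cells}\ \le\ \#S\,(d_1^2+d_1d_2-1)+d_2^2+1\ \le\ (d_1+d_2)(d_1^3+d_1^2d_2-2d_1^2+d_1d_2^2-2d_1d_2+2).$$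
   Context: For polynomials, $V_{\mathbb{R}}(\cdot)$ and $V_{\mathbb{C}}(\cdot)$ denote the common zero sets in $\mathbb{R}^2$ and $\mathbb{C}^2$. Let $f=(f_1,f_2)\in\mathbb{R}[x_1,x_2]^2$, regarded as a column vector, with $d_j=\deg f_j>0$, $d_1\ge d_2$, $d_1\ge 2$. Newton homotopy curves: for $r\in\mathbb{R}^2\setminus V_{\mathbb{R}}(f)$, $C_r=\{x\in\mathbb{R}^2:\exists t\in\mathbb{R},\ f(x)=t f(r)\}$. For $r\in\mathbb{C}^2\setminus V_{\mathbb{C}}(f)$, $C_r^{\mathbb{C}}=\{x\in\mathbb{C}^2:\exists t\in\mathbb{C},\ f(x)=t f(r)\}$. These are the real, respectively complex, zero sets of the polynomial $h(x,r)=\det[\,f(x)\ \ f(r)\,]=f_1(x)f_2(r)-f_2(x)f_1(r)$ in $x$. A point of the curve is singular if the gradient of $h(x,r)$ with respect to $x$ vanishes there. "Smooth at infinity" means that the closure of the complex curve in the complex projective plane is nonsingular at all its points on the line at infinity. Genericity conditions on $f$: (1) each $V_{\mathbb{C}}(f_j)$ is a smooth curve of degree $d_j$; (2) $f_j^*=0$ has $d_j$ nonsingular solutions in complex projective space $\mathbb{P}^1$, where $f_j^*$ is the homogeneous part of $f_j$ of highest degree $d_j$; (3) $V_{\mathbb{C}}(f_1,f_2)$ is a complete intersection with $d_1d_2$ nonsingular solutions in $\mathbb{C}^2$; (4) for every $r\in\mathbb{C}^2\setminus V_{\mathbb{C}}(f)$: (a) $C_r^{\mathbb{C}}$ is a curve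 of degree $d_1$ whenever $f_2(r)\ne0$; (b) $C_r^{\mathbb{C}}$ is smooth at infinity except possibly when $f_2(r)=0$ and $d_1>d_2$; (c) $C_r^{\mathbb{C}}$ has at most one singularity, and that singularity, if it exists, is an ordinary double point. Cells: for $r\in\mathbb{R}^2\setminus V_{\mathbb{R}}(f)$, the start component $\zeta_r$ is the connected component of $C_r$ (Euclidean topology) containing $r$. For $\upsilon\subset V_{\mathbb{R}}(f)$, the class of $\upsilon$ is $Cl_\upsilon=\{r\in\mathbb{R}^2\setminus V_{\mathbb{R}}(f): V_{\mathbb{R}}(f)\cap\zeta_r=\upsilon\}$. The boundary is $B=\bigcup_{\upsilon\subset V_{\mathbb{R}}(f)}\partial Cl_\upsilon\setminus V_{\mathbb{R}}(f)$, where $\partial$ is the topological boundary in $\mathbb{R}^2$. The extended boundary $\overline{B}$ is the real Zariski closure of $B$, i.e. the intersection of all real algebraic subsets of $\mathbb{R}^2$ containing $B$. The cells are the connected components of $\mathbb{R}^2\setminus\overline{B}$. Infinity completeness: under the genericity conditions $S$ is finite and $f_2(r)\neq 0$ for all $r\in S$. Put $p(x)=\prod_{r\in S}\bigl(f_1(x)-\tfrac{f_1(r)}{f_2(r)}f_2(x)\bigr)$, $p_2=p\cdot f_2$, $e=\lceil(\deg p+1)/2\rceil$, and, for $c\in\mathbb{R}^2$, $q(x)=1+(x_1-c_1)^2+(x_2-c_2)^2$. The system $f$ is called infinity complete if there exists $c\in\mathbb{R}^2$ such that the system of two polynomial equations $(\partial_x p_2)\,q-e\,(\partial_x q)\,p_2=0$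 (where $\partial_x$ is the gradient in $x=(x_1,x_2)$) has only finitely many solutions and its scheme at infinity (the part, supported on the line at infinity of the complex projective plane, of the scheme defined by the homogenized system) has degree $\#S(\#S-1)d_1(d_1-d_2)$. *)

theory Defs
  imports "HOL-Analysis.Analysis" "HOL-Computational_Algebra.Computational_Algebra"
begin

section \<open>Polynomials in two and three variables\<close>

text \<open>
  Polynomials in \<open>x\<^sub>1, x\<^sub>2\<close> are elements of \<open>'a poly poly\<close>; the inner variable is \<open>x\<^sub>1\<close> and
  the outer one is \<open>x\<^sub>2\<close>, so the coefficient of \<open>x\<^sub>1^i * x\<^sub>2^j\<close> in \<open>p\<close> is \<open>coeff (coeff p j) i\<close>.
  In \<open>'a poly poly poly\<close> the outermost variable is the homogenizing one, \<open>x\<^sub>3\<close>.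
\<close>

definition eval2 :: "'a::comm_ring_1 poly poly \<Rightarrow> 'a^2 \<Rightarrow> 'a" where
  "eval2 p x = poly (poly p [:x $ 2:]) (x $ 1)"

definition eval3 :: "'a::comm_ring_1 poly poly poly \<Rightarrow> 'a^3 \<Rightarrow> 'a" where
  "eval3 p x = poly (poly (poly p [:[:x $ 3:]:]) [:x $ 2:]) (x $ 1)"

abbreviation const2 :: "'a::zero \<Rightarrow> 'a poly poly" where
  "const2 a \<equiv> [:[:a:]:]"

definition X1 :: "'a::comm_ring_1 poly poly" where "X1 = [:[:0, 1:]:]"
definition X2 :: "'a::comm_ring_1 poly poly" where "X2 = [:0, 1:]"

definition tdeg :: "'a::zero poly poly \<Rightarrow> nat" where
  "tdeg p = Max (insert 0 {i + j |i j. coeff (coeff p j) i \<noteq> 0})"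

lemma finite_tdeg_set: "finite {i + j |i j. coeff (coeff p j) i \<noteq> 0}"
proof -
  define N where "N = Max (insert 0 ((\<lambda>j. degree (coeff p j)) ` {..degree p}))"
  have "i + j \<le> N + degree p" if "coeff (coeff p j) i \<noteq> 0" for i j
  proof -
    have j: "j \<le> degree p" using that by (metis coeff_0 le_degree)
    have "degree (coeff p j) \<le> N" unfolding N_def using j by (intro Max_ge) auto
    then show ?thesis using le_degree[OF that] j by linarith
  qed
  then have "{i + j |i j. coeff (coeff p j) i \<noteq> 0} \<subseteq> {..N + degree p}" by auto
  then show ?thesis by (rule finite_subset) simp
qed

definition hom_part :: "nat \<Rightarrow> 'a::comm_ring_1 poly poly \<Rightarrow> 'a poly poly" where
  "hom_part n p = (\<Sum>j\<le>n. monom (monom (coeff (coeff p j) (n - j)) (n - j)) j)"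

definition leading_form :: "'a::comm_ring_1 poly poly \<Rightarrow> 'a poly poly" where
  "leading_form p = hom_part (tdeg p) p"

definition homogenize :: "'a::comm_ring_1 poly poly \<Rightarrow> 'a poly poly poly" where
  "homogenize p = (\<Sum>k\<le>tdeg p. monom (hom_part (tdeg p - k) p) k)"

definition is_form3 :: "nat \<Rightarrow> 'a::zero poly poly poly \<Rightarrow> bool" where
  "is_form3 n p \<longleftrightarrow> (\<forall>i j k. coeff (coeff (coeff p k) j) i \<noteq> 0 \<longrightarrow> i + j + k = n)"

definition pd :: "2 \<Rightarrow> 'a::idom poly poly \<Rightarrow> 'a poly poly" where
  "pd j p = (if j = 1 then map_poly pderiv p else pderiv p)"

definition pd3 :: "3 \<Rightarrow> 'a::idom poly poly poly \<Rightarrow> 'a poly poly poly" where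
  "pd3 j p = (if j = 1 then map_poly (map_poly pderiv) p
              else if j = 2 then map_poly pderiv p else pderiv p)"

definition gradient2 :: "'a::idom poly poly \<Rightarrow> 'a^2 \<Rightarrow> 'a^2" where
  "gradient2 p x = (\<chi> j. eval2 (pd j p) x)"

definition gradient3 :: "'a::idom poly poly poly \<Rightarrow> 'a^3 \<Rightarrow> 'a^3" where
  "gradient3 p x = (\<chi> j. eval3 (pd3 j p) x)"

definition zeros :: "'a::comm_ring_1 poly poly \<Rightarrow> ('a^2) set" where
  "zeros p = {x. eval2 p x = 0}"

definition singular_points :: "'a::idom poly poly \<Rightarrow> ('a^2) set" where
  "singular_points p = {x \<in> zeros p. gradient2 p x = 0}"

definition complexify :: "real poly poly \<Rightarrow> complex poly poly" where
  "complexify p = map_poly (map_poly complex_of_real) p"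

definition complexify_sys :: "real poly poly ^ 2 \<Rightarrow> complex poly poly ^ 2" where
  "complexify_sys f = (\<chi> j. complexify (f $ j))"

definition eval_sys :: "('a::comm_ring_1 poly poly) ^ 2 \<Rightarrow> 'a^2 \<Rightarrow> 'a^2" where
  "eval_sys f x = (\<chi> j. eval2 (f $ j) x)"

definition common_zeros :: "('a::comm_ring_1 poly poly) ^ 2 \<Rightarrow> ('a^2) set" where
  "common_zeros f = {x. eval_sys f x = 0}"

text \<open>Points of projective space are the classes of nonzero vectors under this relation.\<close>

definition proj_rel :: "(('a::field ^ 'n) \<times> ('a ^ 'n)) set" where
  "proj_rel = {(u, v). u \<noteq> 0 \<and> v \<noteq> 0 \<and> (\<exists>c. v = c *s u)}"


section \<open>Newton homotopy curves\<close>

definition newton_curve :: "('a::idom poly poly) ^ 2 \<Rightarrow> 'a^2 \<Rightarrow> ('a^2) set" where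
  "newton_curve f r = {x. \<exists>t. eval_sys f x = t *s eval_sys f r}"

definition newton_poly :: "('a::idom poly poly) ^ 2 \<Rightarrow> 'a^2 \<Rightarrow> 'a poly poly" where
  "newton_poly f r = f $ 1 * const2 (eval2 (f $ 2) r) - f $ 2 * const2 (eval2 (f $ 1) r)"

lemma newton_curve_eq_zeros:
  fixes f :: "('a::field poly poly) ^ 2"
  assumes "r \<notin> common_zeros f"
  shows "newton_curve f r = zeros (newton_poly f r)"
proof -
  have 1: "eval2 (newton_poly f r) x =
      eval2 (f $ 1) x * eval2 (f $ 2) r - eval2 (f $ 2) x * eval2 (f $ 1) r" for x
    by (simp add: newton_poly_def eval2_def)
  have 2: "(\<exists>t. a = t * c \<and> b = t * d) \<longleftrightarrow> a * d - b * c = 0"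
    if "c \<noteq> 0 \<or> d \<noteq> 0" for a b c d :: 'a
  proof
    assume "a * d - b * c = 0"
    then show "\<exists>t. a = t * c \<and> b = t * d"
      using that by (intro exI[of _ "if c \<noteq> 0 then a / c else b / d"]) (auto simp: field_simps)
  qed auto
  show ?thesis
    using assms 2[of "eval2 (f $ 1) r" "eval2 (f $ 2) r"]
    by (auto simp: newton_curve_def zeros_def 1 common_zeros_def eval_sys_def vec_eq_iff forall_2)
qed


section \<open>Genericity conditions\<close>

text \<open>The degree of a plane curve, as a point set, is the least degree of a polynomial defining it.\<close>

definition curve_of_degree :: "(complex^2) set \<Rightarrow> nat \<Rightarrow> bool" where
  "curve_of_degree X d \<longleftrightarrow>
     0 < d \<and> (\<exists>p. X = zeros p \<and> tdeg p = d) \<and> (\<forall>p. X = zeros p \<longrightarrow> d \<le> tdeg p)"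

text \<open>The closure of \<open>zeros p\<close> in the projective plane is the zero set of \<open>homogenize p\<close>.\<close>

definition smooth_at_infinity :: "complex poly poly \<Rightarrow> bool" where
  "smooth_at_infinity p \<longleftrightarrow>
     (\<forall>v. v \<noteq> 0 \<and> v $ 3 = 0 \<and> eval3 (homogenize p) v = 0 \<longrightarrow> gradient3 (homogenize p) v \<noteq> 0)"

text \<open>
  A singular point is an ordinary double point if the quadratic part of the Taylor expansion there
  splits into two linear forms with distinct zero lines (the tangents).
\<close>

definition ordinary_double_point :: "complex poly poly \<Rightarrow> complex^2 \<Rightarrow> bool" where
  "ordinary_double_point p x \<longleftrightarrow> x \<in> singular_points p \<and>
     (\<exists>a b c d. a * d - b * c \<noteq> 0 \<and>
        (\<forall>u v. (eval2 (pd 1 (pd 1 p)) x * u^2 + 2 * eval2 (pd 1 (pd 2 p)) x * u * v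
                 + eval2 (pd 2 (pd 2 p)) x * v^2) / 2
               = (a * u + b * v) * (c * u + d * v)))"

definition generic1 :: "real poly poly ^ 2 \<Rightarrow> bool" where
  "generic1 f \<longleftrightarrow> (\<forall>j. curve_of_degree (zeros (complexify (f $ j))) (tdeg (f $ j))
                     \<and> singular_points (complexify (f $ j)) = {})"

definition generic2 :: "real poly poly ^ 2 \<Rightarrow> bool" where
  "generic2 f \<longleftrightarrow> (\<forall>j. let g = complexify (leading_form (f $ j)) in
      card ({v. v \<noteq> 0 \<and> eval2 g v = 0} // proj_rel) = tdeg (f $ j)
      \<and> (\<forall>v. v \<noteq> 0 \<and> eval2 g v = 0 \<longrightarrow> gradient2 g v \<noteq> 0))"

text \<open>In the plane, two equations form a complete intersection when they have finitely many zeros.\<close>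

definition generic3 :: "real poly poly ^ 2 \<Rightarrow> bool" where
  "generic3 f \<longleftrightarrow> (let F = complexify_sys f in
      finite (common_zeros F) \<and> card (common_zeros F) = tdeg (f $ 1) * tdeg (f $ 2)
      \<and> (\<forall>x \<in> common_zeros F. det (\<chi> i. gradient2 (F $ i) x) \<noteq> 0))"

definition generic4 :: "real poly poly ^ 2 \<Rightarrow> bool" where
  "generic4 f \<longleftrightarrow> (let F = complexify_sys f in \<forall>r. r \<notin> common_zeros F \<longrightarrow>
      (eval2 (F $ 2) r \<noteq> 0 \<longrightarrow> curve_of_degree (newton_curve F r) (tdeg (f $ 1)))
      \<and> (\<not> (eval2 (F $ 2) r = 0 \<and> tdeg (f $ 1) > tdeg (f $ 2))
            \<longrightarrow> smooth_at_infinity (newton_poly F r))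
      \<and> (\<forall>x \<in> singular_points (newton_poly F r). \<forall>y \<in> singular_points (newton_poly F r). x = y)
      \<and> (\<forall>x \<in> singular_points (newton_poly F r). ordinary_double_point (newton_poly F r) x))"

definition generic :: "real poly poly ^ 2 \<Rightarrow> bool" where
  "generic f \<longleftrightarrow> generic1 f \<and> generic2 f \<and> generic3 f \<and> generic4 f"


section \<open>Cells\<close>

definition sing_set :: "real poly poly ^ 2 \<Rightarrow> (real^2) set" where
  "sing_set f = {r. eval_sys f r \<noteq> 0 \<and> r \<in> singular_points (newton_poly f r)}"

definition start_component :: "real poly poly ^ 2 \<Rightarrow> real^2 \<Rightarrow> (real^2) set" where
  "start_component f r = connected_component_set (newton_curve f r) r"

definition root_class :: "real poly poly ^ 2 \<Rightarrow> (real^2) set \<Rightarrow> (real^2) set" where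
  "root_class f U = {r. r \<notin> common_zeros f \<and> common_zeros f \<inter> start_component f r = U}"

definition cell_boundary :: "real poly poly ^ 2 \<Rightarrow> (real^2) set" where
  "cell_boundary f = (\<Union>U \<in> Pow (common_zeros f). frontier (root_class f U)) - common_zeros f"

definition algebraic_set :: "(real^2) set \<Rightarrow> bool" where
  "algebraic_set X \<longleftrightarrow> (\<exists>P. X = {x. \<forall>p \<in> P. eval2 p x = 0})"

definition zariski_closure :: "(real^2) set \<Rightarrow> (real^2) set" where
  "zariski_closure Y = \<Inter> {X. algebraic_set X \<and> Y \<subseteq> X}"

definition cells :: "real poly poly ^ 2 \<Rightarrow> (real^2) set set" where
  "cells f = components (UNIV - zariski_closure (cell_boundary f))"


section \<open>Infinity completeness\<close>

text \<open>
  For forms \<open>F\<close>, \<open>G\<close> and a point \<open>K\<close> of the projective plane (a class of \<^const>\<open>proj_rel\<close>), the stalk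
  at \<open>K\<close> of the structure sheaf of the scheme \<open>F = G = 0\<close> is \<open>local_ring K\<close> modulo
  \<open>local_ideal F G K\<close>, both consisting of quotients of forms of equal degree.
\<close>

definition local_ring :: "(complex^3) set \<Rightarrow> complex poly poly poly fract set" where
  "local_ring K = {to_fract A / to_fract B |A B n.
     is_form3 n A \<and> is_form3 n B \<and> (\<forall>v \<in> K. eval3 B v \<noteq> 0)}"

definition local_ideal ::
  "complex poly poly poly \<Rightarrow> complex poly poly poly \<Rightarrow> (complex^3) set
     \<Rightarrow> complex poly poly poly fract set" where
  "local_ideal F G K = {to_fract A / to_fract B |A B n U V. A = U * F + V * G
     \<and> is_form3 n A \<and> is_form3 n B \<and> (\<forall>v \<in> K. eval3 B v \<noteq> 0)}"

text \<open>\<open>R\<close> modulo \<open>I\<close> has a basis over the complex numbers consisting of \<open>n\<close> elements.\<close>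

definition has_quotient_dim ::
  "complex poly poly poly fract set \<Rightarrow> complex poly poly poly fract set \<Rightarrow> nat \<Rightarrow> bool" where
  "has_quotient_dim R I n \<longleftrightarrow> (\<exists>b :: nat \<Rightarrow> complex poly poly poly fract. (\<forall>i<n. b i \<in> R) \<and>
     (\<forall>g \<in> R. \<exists>!c :: nat \<Rightarrow> complex. (\<forall>i\<ge>n. c i = 0)
        \<and> g - (\<Sum>i<n. to_fract [:[:[:c i:]:]:] * b i) \<in> I))"

definition points_at_infinity ::
  "complex poly poly poly \<Rightarrow> complex poly poly poly \<Rightarrow> (complex^3) set set" where
  "points_at_infinity F G =
     {v. v \<noteq> 0 \<and> v $ 3 = 0 \<and> eval3 F v = 0 \<and> eval3 G v = 0} // proj_rel"

text \<open>The degree of a zero-dimensional scheme is the sum of the dimensions of its stalks.\<close>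

definition degree_at_infinity ::
  "complex poly poly poly \<Rightarrow> complex poly poly poly \<Rightarrow> nat \<Rightarrow> bool" where
  "degree_at_infinity F G N \<longleftrightarrow> finite (points_at_infinity F G) \<and>
     (\<exists>m. (\<forall>K \<in> points_at_infinity F G. has_quotient_dim (local_ring K) (local_ideal F G K) (m K))
        \<and> N = (\<Sum>K \<in> points_at_infinity F G. m K))"

definition p_poly :: "real poly poly ^ 2 \<Rightarrow> real poly poly" where
  "p_poly f = (\<Prod>r \<in> sing_set f. f $ 1 - const2 (eval2 (f $ 1) r / eval2 (f $ 2) r) * f $ 2)"

definition p2_poly :: "real poly poly ^ 2 \<Rightarrow> real poly poly" where
  "p2_poly f = p_poly f * f $ 2"

definition e_num :: "real poly poly ^ 2 \<Rightarrow> nat" where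
  "e_num f = nat \<lceil>(real (tdeg (p_poly f)) + 1) / 2\<rceil>"

definition q_poly :: "real^2 \<Rightarrow> real poly poly" where
  "q_poly c = 1 + (X1 - const2 (c $ 1))^2 + (X2 - const2 (c $ 2))^2"

definition routing_system :: "real poly poly ^ 2 \<Rightarrow> real^2 \<Rightarrow> real poly poly ^ 2" where
  "routing_system f c = (\<chi> j. pd j (p2_poly f) * q_poly c
                               - of_nat (e_num f) * pd j (q_poly c) * p2_poly f)"

definition infinity_complete :: "real poly poly ^ 2 \<Rightarrow> bool" where
  "infinity_complete f \<longleftrightarrow> (\<exists>c. let G = complexify_sys (routing_system f c) in
      finite (common_zeros G)
      \<and> degree_at_infinity (homogenize (G $ 1)) (homogenize (G $ 2))
          (card (sing_set f) * (card (sing_set f) - 1)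
             * tdeg (f $ 1) * (tdeg (f $ 1) - tdeg (f $ 2))))"

end

theory Submission
  imports Defs "HOL-Computational_Algebra.Field_as_Ring"
begin

text \<open>
  Put \<open>F\<^sub>r = f\<^sub>1 f\<^sub>2(r) - f\<^sub>2 f\<^sub>1(r)\<close>. If \<open>b\<close> lies on none of the curves \<open>f\<^sub>2 = 0\<close> and \<open>F\<^sub>r = 0\<close>, \<open>r \<in> S\<close>, then
  \<open>C\<^sub>b\<close> is smooth and transversal at infinity; near such a curve the components vary continuously,
  also at infinity, and the roots on the start component are locally constant. Hence \<open>B\<close> lies on the
  product of these curves, and each cell contains a component of the complement of that product.

  These components are counted by sweeping a generic line. A line of the initial position meets at
  most \<open>s d\<^sub>1 + d\<^sub>2 + 1\<close> of them, and a new one starts at a point where the line meets the product to some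
  order \<open>m > 1\<close>; each such point starts at most \<open>m - 1\<close> components. At a root of \<open>f\<close> the order is
  \<open>s + 1\<close>. Elsewhere Bezout's bound for a curve \<open>F\<close> and its derivative along the line applies: it
  allows \<open>d\<^sub>2(d\<^sub>2 - 1)\<close> for \<open>f\<^sub>2\<close> and \<open>d\<^sub>1(d\<^sub>1 - 1) - 1\<close> for each \<open>F\<^sub>r\<close>, whose double point uses up two
  intersections. The sum is the second bound, and the first one is larger by
  \<open>s(s - 1)d\<^sub>1(d\<^sub>1 - d\<^sub>2)\<close>. Finally \<open>s + d\<^sub>1 d\<^sub>2 \<le> (d\<^sub>1 + d\<^sub>2 - 1)\<^sup>2\<close>, because the zeros of
  \<open>f\<^sub>2 \<nabla>f\<^sub>1 - f\<^sub>1 \<nabla>f\<^sub>2\<close> in \<open>C\<^sup>2\<close> are nondegenerate and contain \<open>S\<close> and the \<open>d\<^sub>1 d\<^sub>2\<close> roots of \<open>f\<close>.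
\<close>

text \<open>The sweep treats tangencies of any order, double points and base points alike. Near a
  contact of order m the m-th derivative along the line stays nonzero, so by Rolle a slightly higher
  line has at most m zeros there, and a newly born component must cross that line in one of the m -
  1 gaps between them. The numbers m - 1 must be summed with multiplicity. In place of local
  intersection numbers, linear functionals are exhibited that vanish on the ideal of F and its
  derivative and are triangular against test polynomials; a dimension count bounds their number.
  This count runs over the reals and needs coprimality, which comes from the complex singularities:
  a square factor would produce two of them. The obstacle to local constancy of the roots is
  infinity, where two components could merge. Since d_2 < d_1, the curves through points with f_2
  nonzero share their asymptotic directions, and these are simple zeros of the leading form of f_1,
  so each direction carries one end. Finiteness of S and of the set of cells is obtained by bounding
  every finite subset.\<close>

no_notation fps_nth (infixl "$" 75)

lemma map_poly_additive:
  assumes "f 0 = 0" "\<And>x y. f (x + y) = f x + f y"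
  shows "map_poly f (p + q) = map_poly f p + map_poly f q"
  by (rule poly_eqI) (simp add: coeff_map_poly assms)

lemma map_poly_multiplicative:
  assumes f: "f 0 = 0" "\<And>x y. f (x + y) = f x + f y" "\<And>x y. f (x * y) = f x * f y"
  shows "map_poly f (p * q) = map_poly f p * map_poly f q"
proof (rule poly_eqI)
  have sum: "f (sum g A) = (\<Sum>i\<in>A. f (g i))" for g and A :: "nat set"
    by (induction A rule: infinite_finite_induct) (auto simp: f)
  show "coeff (map_poly f (p * q)) n = coeff (map_poly f p * map_poly f q) n" for n
    by (simp add: coeff_map_poly coeff_mult f sum)
qed

subsection \<open>Evaluation and partial derivatives\<close>

lemma eval2_simps [simp]:
  "eval2 0 x = 0" "eval2 1 x = 1"
  "eval2 (p + q) x = eval2 p x + eval2 q x"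
  "eval2 (p - q) x = eval2 p x - eval2 q x"
  "eval2 (- p) x = - eval2 p x"
  "eval2 (p * q) x = eval2 p x * eval2 q x"
  "eval2 (p ^ n) x = eval2 p x ^ n"
  "eval2 (const2 a) x = a"
  "eval2 X1 x = x $ 1" "eval2 X2 x = x $ 2"
  by (simp_all add: eval2_def poly_power X1_def X2_def)

lemma eval2_prod: "eval2 (prod g A) x = (\<Prod>i\<in>A. eval2 (g i) x)"
  by (induction A rule: infinite_finite_induct) auto

lemma eval2_sum: "eval2 (sum g A) x = (\<Sum>i\<in>A. eval2 (g i) x)"
  by (induction A rule: infinite_finite_induct) auto

lemma eval2_pCons: "eval2 (pCons a p) x = poly a (x $ 1) + x $ 2 * eval2 p x"
  by (simp add: eval2_def)

lemma pd_add: "pd j (p + q) = pd j p + pd j q"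
  by (simp add: pd_def map_poly_additive pderiv_add)

lemma pd_minus: "pd j (- p) = - pd j p"
  by (rule poly_eqI) (simp add: pd_def coeff_map_poly pderiv_minus)

lemma pd_diff: "pd j (p - q) = pd j p - pd j q"
  using pd_add[of j p "- q"] by (simp add: pd_minus)

lemma pd_const [simp]: "pd j (const2 a) = 0" "pd j 0 = 0"
  by (auto simp: pd_def map_poly_pCons)

lemma pderiv_sum': "pderiv (sum g A) = (\<Sum>i\<in>A. pderiv (g i))"
  by (induction A rule: infinite_finite_induct) (auto simp: pderiv_add)

lemma pd_mult: "pd j (p * q) = p * pd j q + q * pd j (p :: 'a::idom poly poly)"
proof (cases "j = 1")
  case True
  have "map_poly pderiv (p * q) = p * map_poly pderiv q + q * map_poly pderiv p"
  proof (rule poly_eqI)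
    fix n
    have "coeff (map_poly pderiv (p * q)) n
        = (\<Sum>i\<le>n. coeff p i * pderiv (coeff q (n - i)) + coeff q (n - i) * pderiv (coeff p i))"
      by (simp add: coeff_map_poly coeff_mult pderiv_sum' pderiv_mult)
    also have "\<dots> = (\<Sum>i\<le>n. coeff p i * pderiv (coeff q (n - i)))
        + (\<Sum>i\<le>n. pderiv (coeff p i) * coeff q (n - i))"
      by (simp add: sum.distrib mult.commute)
    also have "\<dots> = coeff (p * map_poly pderiv q + q * map_poly pderiv p) n"
      by (simp add: coeff_map_poly coeff_mult mult.commute[of q])
    finally show "coeff (map_poly pderiv (p * q)) n
        = coeff (p * map_poly pderiv q + q * map_poly pderiv p) n" .
  qed
  then show ?thesis by (simp add: pd_def True)
qed (simp add: pd_def pderiv_mult)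

lemma pd_pCons:
  "pd 1 (pCons a p) = pCons (pderiv a) (pd 1 p)"
  "pd 2 (pCons a p) = p + pCons 0 (pd 2 p)"
  by (simp_all add: pd_def map_poly_pCons pderiv_pCons)

lemma poly_pd1: "poly (pd 1 p) [:b:] = pderiv (poly p [:b:])"
  by (induction p) (simp_all add: pd_pCons pderiv_add pderiv_smult)

lemma eval2_has_derivative:
  fixes p :: "real poly poly"
  shows "(eval2 p has_derivative (\<lambda>h. eval2 (pd 1 p) x * h $ 1 + eval2 (pd 2 p) x * h $ 2)) (at x)"
proof (induction p)
  case 0
  then show ?case by (simp add: eval2_def[abs_def])
next
  case (pCons a p)
  have a: "((\<lambda>x. poly a (x $ 1)) has_derivative (\<lambda>h. h $ 1 * poly (pderiv a) (x $ 1))) (at x)"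
    by (rule DERIV_compose_FDERIV[OF poly_DERIV])
      (rule bounded_linear.has_derivative[OF bounded_linear_vec_nth has_derivative_ident])
  have "((\<lambda>x. poly a (x $ 1) + x $ 2 * eval2 p x) has_derivative
     (\<lambda>h. h $ 1 * poly (pderiv a) (x $ 1) + (x $ 2 * (eval2 (pd 1 p) x * h $ 1 + eval2 (pd 2 p) x * h $ 2)
         + h $ 2 * eval2 p x))) (at x)"
    by (intro has_derivative_add a has_derivative_mult pCons(2)
        bounded_linear.has_derivative[OF bounded_linear_vec_nth has_derivative_ident])
  moreover have "h $ 1 * poly (pderiv a) (x $ 1)
      + (x $ 2 * (eval2 (pd 1 p) x * h $ 1 + eval2 (pd 2 p) x * h $ 2) + h $ 2 * eval2 p x)
      = eval2 (pd 1 (pCons a p)) x * h $ 1 + eval2 (pd 2 (pCons a p)) x * h $ 2" for h :: "real^2"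
    unfolding pd_pCons eval2_simps(3) eval2_pCons by (simp add: ring_distribs)
  ultimately show ?case
    by (simp only: ext[of "eval2 (pCons a p)", OF eval2_pCons])
qed

lemma continuous_on_eval2 [continuous_intros]:
  fixes p :: "real poly poly"
  assumes "continuous_on S g"
  shows "continuous_on S (\<lambda>x. eval2 p (g x))"
proof -
  have "continuous_on UNIV (eval2 p)"
    by (intro continuous_at_imp_continuous_on ballI has_derivative_continuous[OF eval2_has_derivative])
  then show ?thesis
    by (rule continuous_on_compose2[OF _ assms subset_UNIV])
qed

lemma open_eval2_nonzero: "open {x. eval2 (p :: real poly poly) x \<noteq> 0}"
  using open_Collect_neq[of "eval2 p" "\<lambda>_. 0"] continuous_on_eval2[of UNIV "\<lambda>x. x" p]
  by (auto simp: continuous_on_id)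

subsection \<open>Total degree\<close>

lemma tdeg_leI:
  assumes "\<And>i j. coeff (coeff p j) i \<noteq> 0 \<Longrightarrow> i + j \<le> n"
  shows "tdeg p \<le> n"
  unfolding tdeg_def using finite_tdeg_set[of p] assms by (subst Max_le_iff) auto

lemma tdeg_geI: "coeff (coeff p j) i \<noteq> 0 \<Longrightarrow> i + j \<le> tdeg p"
  unfolding tdeg_def using finite_tdeg_set[of p] by (intro Max_ge) auto

lemma tdeg_0 [simp]: "tdeg 0 = 0"
  using tdeg_leI[of 0 0] by simp

text \<open>Restriction to the line \<open>x\<^sub>2 = c x\<^sub>1\<close> through the origin, with \<open>x\<^sub>1\<close> as outer and \<open>c\<close> as inner
  variable; it turns the total degree into an ordinary degree.\<close>

definition radial :: "'a::comm_ring_1 poly poly \<Rightarrow> 'a poly poly" where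
  "radial p = poly (map_poly (map_poly (\<lambda>a. [:a:])) p) [:0, [:0, 1:]:]"

lemma radial_0 [simp]: "radial 0 = 0"
  by (simp add: radial_def)

lemma radial_pCons: "radial (pCons a p) = map_poly (\<lambda>a. [:a:]) a + [:0, [:0, 1:]:] * radial p"
  by (simp add: radial_def map_poly_pCons)

lemma coeff_radial:
  "coeff (coeff (radial p) k) j = (if j \<le> k then coeff (coeff p j) (k - j) else 0)"
proof (induction p arbitrary: k j)
  case 0
  show ?case by simp
next
  case (pCons a p)
  then show ?case
    by (cases k; cases j) (auto simp: radial_pCons coeff_map_poly coeff_pCons split: nat.splits)
qed

lemma radial_add: "radial (p + q) = radial p + radial q"
  by (rule poly_eqI, rule poly_eqI) (simp add: coeff_radial)

lemma radial_mult: "radial (p * q) = radial p * radial q"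
proof -
  have "map_poly (map_poly (\<lambda>a. [:a:])) (p * q)
      = map_poly (map_poly (\<lambda>a. [:a:])) p * map_poly (map_poly (\<lambda>a. [:a:])) q"
    by (intro map_poly_multiplicative map_poly_additive) (auto simp: map_poly_additive)
  then show ?thesis by (simp add: radial_def)
qed

lemma radial_eq_0_iff: "radial p = 0 \<longleftrightarrow> p = 0"
proof
  assume "radial p = 0"
  then have "coeff (coeff p j) i = 0" for i j
    using coeff_radial[of p "i + j" j] by simp
  then show "p = 0" by (intro poly_eqI) simp
qed simp

lemma degree_radial: "degree (radial p) = tdeg p"
proof (rule antisym)
  have "coeff (coeff (radial p) k) j = 0" if "k > tdeg p" for k j
    using that tdeg_geI[of p j "k - j"] by (cases "j \<le> k") (auto simp: coeff_radial)
  then show "degree (radial p) \<le> tdeg p"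
    by (intro degree_le) (auto intro: poly_eqI)
next
  show "tdeg p \<le> degree (radial p)"
  proof (rule tdeg_leI)
    fix i j assume "coeff (coeff p j) i \<noteq> 0"
    then have "coeff (coeff (radial p) (i + j)) j \<noteq> 0" by (simp add: coeff_radial)
    then show "i + j \<le> degree (radial p)" by (metis coeff_0 le_degree)
  qed
qed

lemma tdeg_mult:
  fixes p q :: "'a::idom poly poly"
  assumes "p \<noteq> 0" "q \<noteq> 0"
  shows "tdeg (p * q) = tdeg p + tdeg q"
  using assms by (simp flip: degree_radial add: radial_mult degree_mult_eq radial_eq_0_iff)

lemma tdeg_mult_le: "tdeg (p * q :: 'a::comm_ring_1 poly poly) \<le> tdeg p + tdeg q"
  by (simp flip: degree_radial add: radial_mult degree_mult_le)

lemma tdeg_add_le: "tdeg (p :: 'a::comm_ring_1 poly poly) \<le> n \<Longrightarrow> tdeg q \<le> n \<Longrightarrow> tdeg (p + q) \<le> n"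
  by (simp flip: degree_radial add: radial_add degree_add_le)

lemma tdeg_minus [simp]: "tdeg (- p) = tdeg (p :: 'a::comm_ring_1 poly poly)"
  by (simp add: tdeg_def)

lemma tdeg_diff_le: "tdeg (p :: 'a::comm_ring_1 poly poly) \<le> n \<Longrightarrow> tdeg q \<le> n \<Longrightarrow> tdeg (p - q) \<le> n"
  using tdeg_add_le[of p n "- q"] by simp

lemma tdeg_const2 [simp]: "tdeg (const2 a) = 0"
proof -
  have "tdeg (const2 a) \<le> 0"
    by (rule tdeg_leI) (auto simp: coeff_pCons split: nat.splits)
  then show ?thesis by simp
qed

lemma tdeg_pd_le: "tdeg (pd j p) \<le> tdeg p - 1"
proof (rule tdeg_leI)
  fix i k assume nz: "coeff (coeff (pd j p) k) i \<noteq> 0"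
  show "i + k \<le> tdeg p - 1"
  proof (cases "j = 1")
    case True
    with nz have "coeff (coeff p k) (Suc i) \<noteq> 0"
      by (auto simp: pd_def coeff_map_poly coeff_pderiv)
    from tdeg_geI[OF this] show ?thesis by simp
  next
    case False
    then have "coeff (coeff p (Suc k)) i \<noteq> 0"
      using nz by (auto simp: pd_def coeff_pderiv simp flip: of_nat_Suc) (simp add: of_nat_poly)
    from tdeg_geI[OF this] show ?thesis by simp
  qed
qed

subsection \<open>Complexification\<close>

lemma coeff_complexify: "coeff (coeff (complexify p) j) i = complex_of_real (coeff (coeff p j) i)"
  by (simp add: complexify_def coeff_map_poly)

lemma complexify_eqI:
  "(\<And>i j. coeff (coeff q j) i = complex_of_real (coeff (coeff p j) i)) \<Longrightarrow> complexify p = q"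
  by (intro poly_eqI) (simp add: coeff_complexify)

lemma complexify_add: "complexify (p + q) = complexify p + complexify q"
  by (rule complexify_eqI) (simp add: coeff_complexify)

lemma complexify_diff: "complexify (p - q) = complexify p - complexify q"
  by (rule complexify_eqI) (simp add: coeff_complexify)

lemma complexify_mult: "complexify (p * q) = complexify p * complexify q"
  unfolding complexify_def
  by (intro map_poly_multiplicative map_poly_additive) (auto simp: map_poly_additive)

lemma complexify_const [simp]: "complexify (const2 a) = const2 (complex_of_real a)"
  by (rule complexify_eqI) (auto simp: coeff_pCons split: nat.splits)

lemma coeff_of_nat_mult: "coeff (of_nat n * q) i = of_nat n * coeff (q :: 'a::comm_ring_1 poly) i"
  by (simp add: of_nat_poly)

lemma complexify_pd: "complexify (pd j p) = pd j (complexify p)"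
proof (rule complexify_eqI)
  show "coeff (coeff (pd j (complexify p)) k) i = complex_of_real (coeff (coeff (pd j p) k) i)" for i k
    by (auto simp: pd_def coeff_map_poly coeff_pderiv coeff_complexify coeff_of_nat_mult simp del: of_nat_Suc)
qed

lemma tdeg_complexify [simp]: "tdeg (complexify p) = tdeg p"
  by (simp add: tdeg_def coeff_complexify)

definition cvec :: "real^2 \<Rightarrow> complex^2" where
  "cvec x = (\<chi> j. complex_of_real (x $ j))"

lemma cvec_nth [simp]: "cvec x $ j = complex_of_real (x $ j)"
  by (simp add: cvec_def)

lemma cvec_inject [simp]: "cvec x = cvec y \<longleftrightarrow> x = y"
  by (simp add: vec_eq_iff)

lemma eval2_complexify: "eval2 (complexify p) (cvec x) = complex_of_real (eval2 p x)"
proof (induction p)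
  case 0
  then show ?case by (simp add: complexify_def)
next
  case (pCons a p)
  have "poly (map_poly complex_of_real a) (complex_of_real t) = complex_of_real (poly a t)" for t
    by (induction a) (auto simp: map_poly_pCons)
  then show ?case using pCons
    by (simp add: complexify_def map_poly_pCons eval2_pCons)
qed

lemma gradient2_complexify: "gradient2 (complexify p) (cvec x) = cvec (gradient2 p x)"
  by (simp add: vec_eq_iff gradient2_def complexify_pd[symmetric] eval2_complexify)

subsection \<open>A Bezout bound\<close>

text \<open>Exponents of the monomials of total degree at most \<open>D\<close>. Their number is
  used doubled, to avoid division.\<close>

definition triangle :: "nat \<Rightarrow> (nat \<times> nat) set" where
  "triangle D = {(i, j). i + j \<le> D}"

lemma finite_triangle [simp]: "finite (triangle D)"
  by (rule finite_subset[of _ "{..D} \<times> {..D}"]) (auto simp: triangle_def)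

lemma card_triangle: "2 * card (triangle D) = (D + 1) * (D + 2)"
proof (induction D)
  case 0
  have "triangle 0 = {(0, 0)}" by (auto simp: triangle_def)
  then show ?case by simp
next
  case (Suc D)
  have eq: "triangle (Suc D) = triangle D \<union> (\<lambda>i. (i, Suc D - i)) ` {..Suc D}"
    by (auto simp: triangle_def image_iff)
  have "card (triangle (Suc D)) = card (triangle D) + card ((\<lambda>i. (i, Suc D - i)) ` {..Suc D})"
    unfolding eq by (rule card_Un_disjoint) (simp_all, auto simp: triangle_def)
  also have "card ((\<lambda>i. (i, Suc D - i)) ` {..Suc D}) = Suc (Suc D)"
    by (subst card_image) (auto simp: inj_on_def)
  finally show ?case using Suc by simp
qed

definition monomial2 :: "nat \<times> nat \<Rightarrow> 'a::comm_ring_1 poly poly" where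
  "monomial2 a = monom (monom 1 (fst a)) (snd a)"

lemma coeff_sum_monomial2:
  fixes c :: "nat \<times> nat \<Rightarrow> 'a::comm_ring_1"
  assumes "finite A"
  shows "coeff (coeff (\<Sum>a\<in>A. smult [:c a:] (monomial2 a)) j) i = (if (i, j) \<in> A then c (i, j) else 0)"
proof -
  have "coeff (coeff (\<Sum>a\<in>A. smult [:c a:] (monomial2 a)) j) i
      = (\<Sum>a\<in>A. if a = (i, j) then c a else 0)"
    by (auto simp: coeff_sum monomial2_def intro!: sum.cong)
  then show ?thesis using assms by (simp add: sum.delta')
qed

lemma monomial2_expansion:
  assumes "tdeg p \<le> D"
  shows "p = (\<Sum>a\<in>triangle D. smult [:coeff (coeff p (snd a)) (fst a):] (monomial2 a))"
proof (rule poly_eqI, rule poly_eqI)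
  fix i j
  have "i + j > D \<Longrightarrow> coeff (coeff p j) i = 0"
    using tdeg_geI[of p j i] assms by fastforce
  then show "coeff (coeff p j) i
      = coeff (coeff (\<Sum>a\<in>triangle D. smult [:coeff (coeff p (snd a)) (fst a):] (monomial2 a)) j) i"
    by (subst coeff_sum_monomial2) (simp_all, auto simp: triangle_def not_le)
qed

interpretation poly2: vector_space "\<lambda>c p :: 'a::field poly poly. smult [:c:] p"
  by unfold_locales (auto intro!: poly_eqI simp: smult_add_left smult_add_right algebra_simps)

lemma card_independent_le_triangle:
  fixes v :: "'i \<Rightarrow> 'a::field poly poly"
  assumes fin: "finite J" and deg: "\<And>j. j \<in> J \<Longrightarrow> tdeg (v j) \<le> D"
    and ind: "\<And>c. (\<Sum>j\<in>J. smult [:c j:] (v j)) = 0 \<Longrightarrow> (\<forall>j\<in>J. c j = 0)"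
  shows "card J \<le> card (triangle D)"
proof -
  \<comment> \<open>Independence is assumed for the indexed family; two equal members would satisfy
    a relation with coefficients 1 and - 1.\<close>
  have inj: "inj_on v J"
  proof (rule inj_onI, rule ccontr)
    fix a b assume ab: "a \<in> J" "b \<in> J" "v a = v b" "a \<noteq> b"
    define c where "c j = (if j = a then 1 else if j = b then - 1 else (0::'a))" for j
    have "(\<Sum>j\<in>J. smult [:c j:] (v j)) = (\<Sum>j\<in>{a, b}. smult [:c j:] (v j))"
      by (rule sum.mono_neutral_right) (use ab fin in \<open>auto simp: c_def\<close>)
    also have "\<dots> = 0" using ab by (auto simp: c_def smult_minus_left simp flip: minus_pCons)
    finally show False using ind[of c] ab by (auto simp: c_def)
  qed
  have "poly2.independent (v ` J)"
  proof (rule poly2.independent_if_scalars_zero)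
    fix f x assume s: "(\<Sum>x\<in>v ` J. smult [:f x:] x) = 0" and x: "x \<in> v ` J"
    have "(\<Sum>j\<in>J. smult [:f (v j):] (v j)) = 0"
      using s by (simp add: sum.reindex[OF inj])
    from ind[OF this] x show "f x = 0" by auto
  qed (use fin in auto)
  moreover have "v ` J \<subseteq> poly2.span (monomial2 ` triangle D)"
  proof safe
    fix j assume "j \<in> J"
    have "(\<Sum>a\<in>triangle D. smult [:coeff (coeff (v j) (snd a)) (fst a):] (monomial2 a))
        \<in> poly2.span (monomial2 ` triangle D)"
      by (intro poly2.span_sum poly2.span_scale poly2.span_base) auto
    then show "v j \<in> poly2.span (monomial2 ` triangle D)"
      using monomial2_expansion[OF deg[OF \<open>j \<in> J\<close>]] by simp
  qed
  ultimately have "card (v ` J) \<le> card (monomial2 ` triangle D :: 'a poly poly set)"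
    by (intro conjunct2[OF poly2.independent_span_bound]) auto
  also have "\<dots> \<le> card (triangle D)" by (rule card_image_le) simp
  finally show ?thesis by (simp add: card_image[OF inj])
qed

text \<open>Here \<open>x\<^sub>1\<^bsup>m-b\<^esup> x\<^sub>2\<^bsup>b\<^esup>\<close> with \<open>m = tdeg F\<close> is the leading monomial of \<open>F\<close> for the graded order
  that breaks ties by the exponent of \<open>x\<^sub>2\<close>.\<close>

lemma leading_monomial_dvd:
  fixes F :: "'a::idom poly poly"
  assumes "F \<noteq> 0"
  obtains b where "b \<le> tdeg F"
    "\<And>q. q \<noteq> 0 \<Longrightarrow> \<exists>i j. i \<ge> tdeg F - b \<and> j \<ge> b \<and> coeff (coeff (q * F) j) i \<noteq> 0"
proof -
  \<comment> \<open>The largest exponent of x_2 among the terms of top degree of \<open>q\<close>.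
    Being the degree of a leading coefficient, it is additive on products.\<close>
  define b where "b q = degree (lead_coeff (radial q))" for q :: "'a poly poly"
  have nz: "coeff (coeff (radial q) (tdeg q)) (b q) \<noteq> 0" if "q \<noteq> 0" for q
    using that unfolding b_def degree_radial[symmetric] by (simp add: radial_eq_0_iff)
  have le: "b q \<le> tdeg q" if "q \<noteq> 0" for q
    using nz[OF that] by (auto simp: coeff_radial split: if_splits)
  show ?thesis
  proof (rule that[of "b F"])
    show "b F \<le> tdeg F" using le assms by blast
    fix q :: "'a poly poly" assume q: "q \<noteq> 0"
    have qF: "q * F \<noteq> 0" using q assms by simp
    have b: "b (q * F) = b q + b F"
      using q assms by (simp only: b_def radial_mult lead_coeff_mult) (simp add: degree_mult_eq radial_eq_0_iff)
    have "coeff (coeff (q * F) (b (q * F))) (tdeg (q * F) - b (q * F)) \<noteq> 0"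
      using nz[OF qF] le[OF qF] by (simp add: coeff_radial)
    moreover have "tdeg (q * F) = tdeg q + tdeg F" using q assms by (rule tdeg_mult)
    ultimately show "\<exists>i j. i \<ge> tdeg F - b F \<and> j \<ge> b F \<and> coeff (coeff (q * F) j) i \<noteq> 0"
      using b le[OF q] le[OF assms]
      by (intro exI[of _ "tdeg (q * F) - b (q * F)"] exI[of _ "b (q * F)"]) auto
  qed
qed

text \<open>
  Dimension count in degree \<open>D\<close>: the multiples of \<open>F\<close>, the multiples \<open>q G\<close> with \<open>q\<close> reduced modulo the
  leading monomial of \<open>F\<close>, and the test polynomials \<open>g i\<close> are linearly independent.
\<close>

lemma bezout_functionals:
  fixes F G :: "'a::field_gcd poly poly" and lam :: "'i \<Rightarrow> 'a poly poly \<Rightarrow> 'a" and rk :: "'i \<Rightarrow> nat"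
  assumes F: "F \<noteq> 0" and G: "G \<noteq> 0" and cop: "coprime F G" and I: "finite I"
    and add: "\<And>i p q. i \<in> I \<Longrightarrow> lam i (p + q) = lam i p + lam i q"
    and scale: "\<And>i c p. i \<in> I \<Longrightarrow> lam i (smult [:c:] p) = c * lam i p"
    and kill: "\<And>i p. i \<in> I \<Longrightarrow> lam i (p * F) = 0" "\<And>i p. i \<in> I \<Longrightarrow> lam i (p * G) = 0"
    and nz: "\<And>i. i \<in> I \<Longrightarrow> lam i (g i) \<noteq> 0"
    and triang: "\<And>i j. i \<in> I \<Longrightarrow> j \<in> I \<Longrightarrow> i \<noteq> j \<Longrightarrow> rk j \<le> rk i \<Longrightarrow> lam j (g i) = 0"
  shows "card I \<le> tdeg F * tdeg G"
proof -
  define m n where "m = tdeg F" and "n = tdeg G"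
  obtain b where b: "b \<le> m"
    "\<And>q. q \<noteq> 0 \<Longrightarrow> \<exists>i j. i \<ge> m - b \<and> j \<ge> b \<and> coeff (coeff (q * F) j) i \<noteq> 0"
    using leading_monomial_dvd[OF F] unfolding m_def by blast
  \<comment> \<open>Serves as a common bound for the degrees of the test polynomials; the count
    takes place in degree \<open>E + m + n\<close>.\<close>
  define E where "E = (\<Sum>i\<in>I. tdeg (g i))"
  have gE: "tdeg (g i) \<le> E" if "i \<in> I" for i
    unfolding E_def using I that by (intro member_le_sum) auto
  define shift :: "nat \<times> nat \<Rightarrow> nat \<times> nat" where "shift = (\<lambda>(i, j). (i + (m - b), j + b))"
  \<comment> \<open>The exponents that the leading monomial of \<open>F\<close> does not divide:
    those left over when a smaller triangle is translated into the large one.\<close>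
  define B where "B = triangle (E + m) - shift ` triangle E"
  have shift: "shift ` triangle E \<subseteq> triangle (E + m)" "inj shift"
    using b(1) by (auto simp: shift_def triangle_def inj_on_def)
  have shift_iff: "(i, j) \<in> shift ` triangle E" if "i \<ge> m - b" "j \<ge> b" "(i, j) \<in> triangle (E + m)" for i j
    using that b(1) by (intro image_eqI[of _ _ "(i - (m - b), j - b)"]) (auto simp: shift_def triangle_def)
  have cardB: "card B + card (triangle E) = card (triangle (E + m))"
    unfolding B_def using shift card_mono[OF _ shift(1)]
    by (simp add: card_Diff_subset finite_subset card_image inj_on_subset)
  have finB: "finite B" unfolding B_def by simp
  define J where "J = (triangle (E + n) <+> B) <+> I"
  define v where "v = case_sum (case_sum (\<lambda>a. monomial2 a * F) (\<lambda>a. monomial2 a * G)) g"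
  have mono_deg: "tdeg (monomial2 a :: 'a poly poly) \<le> fst a + snd a" for a
    by (rule tdeg_leI) (auto simp: monomial2_def coeff_monom split: if_splits)
  have deg: "tdeg (v j) \<le> E + m + n" if "j \<in> J" for j
  proof -
    have "tdeg (monomial2 a * F) \<le> E + m + n" if "a \<in> triangle (E + n)" for a
      using tdeg_mult_le[of "monomial2 a" F] mono_deg[of a] that by (auto simp: triangle_def m_def)
    moreover have "tdeg (monomial2 a * G) \<le> E + m + n" if "a \<in> B" for a
      using tdeg_mult_le[of "monomial2 a" G] mono_deg[of a] that by (auto simp: triangle_def n_def B_def)
    moreover have "tdeg (g i) \<le> E + m + n" if "i \<in> I" for i using gE[OF that] by simp
    ultimately show ?thesis using \<open>j \<in> J\<close> by (auto simp: J_def v_def)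
  qed
  have lam0: "lam i 0 = 0" if "i \<in> I" for i using scale[OF that, of 0 0] by simp
  have lam_sum: "lam i (\<Sum>x\<in>A. h x) = (\<Sum>x\<in>A. lam i (h x))" if "i \<in> I" for i A and h :: "'i \<Rightarrow> _"
    using that by (induction A rule: infinite_finite_induct) (auto simp: lam0 add)
  have ind: "\<forall>j\<in>J. c j = 0" if sum0: "(\<Sum>j\<in>J. smult [:c j:] (v j)) = 0" for c
  proof -
    define p where "p = (\<Sum>a\<in>triangle (E + n). smult [:c (Inl (Inl a)):] (monomial2 a))"
    define q where "q = (\<Sum>a\<in>B. smult [:c (Inl (Inr a)):] (monomial2 a))"
    define r where "r = (\<Sum>i\<in>I. smult [:c (Inr i):] (g i))"
    have split: "p * F + q * G + r = 0"
      using sum0 finB I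
      by (simp add: J_def v_def sum.Plus p_def q_def r_def sum_distrib_right mult_smult_left)
    have cI: "c (Inr i) = 0" if i: "i \<in> I" for i
    proof (rule ccontr)
      assume "c (Inr i) \<noteq> 0"
      \<comment> \<open>With \<open>k\<close> of least rank among the nonzero coefficients,
        triangularity makes \<open>lam k\<close> vanish on every other test polynomial that
        occurs.\<close>
      then obtain k where k: "k \<in> I" "c (Inr k) \<noteq> 0" "\<And>j. j \<in> I \<Longrightarrow> c (Inr j) \<noteq> 0 \<Longrightarrow> rk k \<le> rk j"
        using ex_has_least_nat[of "\<lambda>i. i \<in> I \<and> c (Inr i) \<noteq> 0" i rk] i by blast
      have "0 = lam k (p * F + q * G + r)" using split lam0 k by simp
      also have "\<dots> = (\<Sum>j\<in>I. c (Inr j) * lam k (g j))"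
        using k by (simp add: add kill r_def lam_sum scale)
      also have "\<dots> = (\<Sum>j\<in>I. if j = k then c (Inr k) * lam k (g k) else 0)"
        using triang[OF _ k(1)] k(3) by (intro sum.cong) auto
      also have "\<dots> = c (Inr k) * lam k (g k)" using I k by simp
      finally show False using k nz by simp
    qed
    then have "r = 0" by (simp add: r_def)
    then have pq: "q * G = (- p) * F" using split by (simp add: eq_neg_iff_add_eq_0 add.commute)
    then have "F dvd q * G" by simp
    then have "F dvd q" using cop by (simp add: coprime_dvd_mult_left_iff)
    then obtain h where h: "q = h * F" by (metis dvd_def mult.commute)
    \<comment> \<open>A nonzero multiple of \<open>F\<close> contains a monomial divisible by the
      leading monomial of \<open>F\<close>, whereas \<open>q\<close> uses exponents from
      \<open>B\<close> only.\<close>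
    have "h = 0"
    proof (rule ccontr)
      assume "h \<noteq> 0"
      then obtain i j where ij: "i \<ge> m - b" "j \<ge> b" "coeff (coeff q j) i \<noteq> 0" using b(2) h by blast
      then have "(i, j) \<in> B" using finB by (auto simp: q_def coeff_sum_monomial2 split: if_splits)
      then show False using shift_iff[OF ij(1,2)] by (auto simp: B_def)
    qed
    then have "q = 0" "p = 0" using h pq F by auto
    then have "c (Inl (Inr (i, j))) = 0" if "(i, j) \<in> B" for i j
      using coeff_sum_monomial2[OF finB, of "\<lambda>a. c (Inl (Inr a))" j i] that by (simp add: q_def)
    moreover have "c (Inl (Inl (i, j))) = 0" if "(i, j) \<in> triangle (E + n)" for i j
      using coeff_sum_monomial2[OF finite_triangle, where D1 = "E + n" and c = "\<lambda>a. c (Inl (Inl a))" and j = j and i = i] that \<open>p = 0\<close>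
      by (simp add: p_def)
    ultimately show ?thesis using cI by (auto simp: J_def)
  qed
  have "finite J" using finB I by (simp add: J_def)
  then have "card J \<le> card (triangle (E + m + n))"
    by (rule card_independent_le_triangle[OF _ deg ind])
  moreover have "card J = card (triangle (E + n)) + card B + card I"
    using finB I by (simp add: J_def card_Plus)
  ultimately have "2 * card (triangle (E + n)) + 2 * card B + 2 * card I \<le> 2 * card (triangle (E + m + n))"
    by simp
  moreover have "2 * card B + (E + 1) * (E + 2) = (E + m + 1) * (E + m + 2)"
    using cardB card_triangle[of E] card_triangle[of "E + m"] by linarith
  ultimately have "(E + n + 1) * (E + n + 2) + ((E + m + 1) * (E + m + 2)) + 2 * card I
      \<le> (E + m + n + 1) * (E + m + n + 2) + (E + 1) * (E + 2)"
    unfolding card_triangle by linarith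
  \<comment> \<open>The inequality is a second difference of a quadratic, so all terms in
    \<open>E\<close> cancel.\<close>
  then have "card I \<le> m * n" by (simp add: algebra_simps)
  then show ?thesis by (simp add: m_def n_def)
qed

subsection \<open>Tangency to the lines \<open>x\<^sub>2 = const\<close>\<close>

lemma power_dvd_pderiv:
  fixes p :: "'a::idom poly"
  assumes "[:- x, 1:] ^ Suc l dvd p"
  shows "[:- x, 1:] ^ l dvd pderiv p"
proof -
  from assms obtain q where q: "p = [:- x, 1:] ^ Suc l * q" by (auto simp: dvd_def)
  have "pderiv p = [:- x, 1:] ^ l * ([:- x, 1:] * pderiv q + smult (of_nat (Suc l)) q)"
    unfolding q pderiv_mult pderiv_power_Suc by (simp add: pderiv_pCons ring_distribs mult_ac)
  then show ?thesis by simp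
qed

lemma dvd_imp_higher_pderiv_root:
  fixes p :: "'a::idom poly"
  assumes "[:- x, 1:] ^ k dvd p" "j < k"
  shows "poly ((pderiv ^^ j) p) x = 0"
  using assms
proof (induction j arbitrary: k p)
  case 0
  then obtain q where "p = [:- x, 1:] ^ k * q" by (auto simp: dvd_def)
  then show ?case using 0 by (simp add: poly_power)
next
  case (Suc j)
  then obtain l where k: "k = Suc l" by (cases k) auto
  have "[:- x, 1:] ^ l dvd pderiv p"
    using Suc.prems k by (intro power_dvd_pderiv) simp
  from Suc.IH[OF this] show ?case
    using Suc.prems k by (simp add: funpow_Suc_right del: funpow.simps)
qed

lemma higher_pderiv_order_nonzero:
  fixes p :: "real poly"
  assumes "p \<noteq> 0"
  shows "poly ((pderiv ^^ order x p) p) x \<noteq> 0"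
  using assms
proof (induction "order x p" arbitrary: p)
  case 0
  then show ?case by (metis funpow_0 order_root)
next
  case (Suc n)
  have p': "pderiv p \<noteq> 0"
  proof
    assume "pderiv p = 0"
    then obtain a where "p = [:a:]" using pderiv_iszero by blast
    with Suc.prems Suc.hyps(2) order_degree[of p x] show False by simp
  qed
  then have "order x p = Suc (order x (pderiv p))"
    using Suc.hyps(2) Suc.prems order_root[of p x] by (intro order_pderiv) auto
  with Suc.hyps(1)[of "pderiv p"] Suc.hyps(2) p' show ?case
    by (simp add: funpow_Suc_right del: funpow.simps)
qed

definition line_order :: "real poly poly \<Rightarrow> real^2 \<Rightarrow> nat" where
  "line_order F z = order (z $ 1) (poly F [:z $ 2:])"

lemma eval2_line: "eval2 F z = poly (poly F [:z $ 2:]) (z $ 1)"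
  by (simp add: eval2_def)

lemma line_order_2:
  assumes "eval2 F z = 0" "eval2 (pd 1 F) z = 0" "eval2 (pd 1 (pd 1 F)) z \<noteq> 0"
  shows "line_order F z = 2"
proof -
  define p where "p = poly F [:z $ 2:]"
  have p: "poly p (z $ 1) = 0" "poly (pderiv p) (z $ 1) = 0" "poly (pderiv (pderiv p)) (z $ 1) \<noteq> 0"
    using assms by (simp_all add: eval2_line poly_pd1 p_def)
  then have "pderiv p \<noteq> 0" "p \<noteq> 0" "pderiv (pderiv p) \<noteq> 0" by auto
  then have "order (z $ 1) p = Suc (order (z $ 1) (pderiv p))"
    "order (z $ 1) (pderiv p) = Suc (order (z $ 1) (pderiv (pderiv p)))"
    using p by (auto intro!: order_pderiv)
  then show ?thesis using order_0I[OF p(3)] by (simp add: line_order_def p_def)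
qed

lemma pd_square_zero: "eval2 l w = 0 \<Longrightarrow> eval2 (pd j (r * (l * l))) w = 0"
  by (simp add: pd_mult)

text \<open>
  A point where the order of contact with the line is \<open>m\<close> carries the functionals \<open>\<partial>\<^sub>1\<^sup>k\<close> for
  \<open>k < m - 1\<close>, which kill the ideal of \<open>F\<close> and \<open>\<partial>\<^sub>1 F\<close>; at a singular point the derivative
  in the direction conjugate to the line is one more.
\<close>

lemma line_order_sum_le:
  fixes F :: "real poly poly"
  assumes cop: "coprime F (pd 1 F)" and nz: "F \<noteq> 0" "pd 1 F \<noteq> 0"
    and lines: "\<And>b. poly F [:b:] \<noteq> 0"
    and Z: "finite Z" "N \<subseteq> Z"
    and N: "\<And>z. z \<in> N \<Longrightarrow> eval2 F z = 0 \<and> gradient2 F z = 0 \<and> eval2 (pd 1 (pd 1 F)) z \<noteq> 0"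
  shows "(\<Sum>z\<in>Z. line_order F z - 1) + card N \<le> tdeg F * tdeg (pd 1 F)"
proof -
  have grad: "eval2 (pd 1 F) z = 0" "eval2 (pd 2 F) z = 0" if "z \<in> N" for z
    using N[OF that] by (auto simp: gradient2_def vec_eq_iff)
  have ordN: "line_order F z = 2" if "z \<in> N" for z
    using N[OF that] grad[OF that] by (intro line_order_2) auto
  \<comment> \<open>The number of functionals placed at \<open>z\<close>. At a point of
    \<open>N\<close> the order is 2, and the two functionals are the evaluation and one extra
    derivative.\<close>
  define len where "len z = (line_order F z - 1) + (if z \<in> N then 1 else 0)" for z
  \<comment> \<open>Exceeds every derivative order in play and is at least 2, so that
    \<open>l z w ^ M\<close> also has vanishing gradient at \<open>w\<close>.\<close>
  define M where "M = (\<Sum>z\<in>Z. len z) + 2"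
  define l where "l z w = (if z $ 1 \<noteq> w $ 1 then X1 - const2 (w $ 1) else X2 - const2 (w $ 2))"
    for z w :: "real^2"
  define E where "E z = (\<Prod>w\<in>Z - {z}. l z w ^ M)" for z
  define spec where "spec i \<longleftrightarrow> fst i \<in> N \<and> snd i = 1" for i :: "(real^2) \<times> nat"
  \<comment> \<open>The special functional is the derivative along a vector orthogonal to the
    gradient of \<open>pd 1 F\<close>, so it kills \<open>pd 1 F\<close>; it kills \<open>F\<close>
    because the gradient of \<open>F\<close> is zero. Multiples are killed too, since both
    polynomials vanish at the point.\<close>
  define lam where "lam i p = (if spec i
      then eval2 (pd 1 (pd 1 F)) (fst i) * eval2 (pd 2 p) (fst i)
         - eval2 (pd 2 (pd 1 F)) (fst i) * eval2 (pd 1 p) (fst i)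
      else poly ((pderiv ^^ snd i) (poly p [:fst i $ 2:])) (fst i $ 1))" for i p
  \<comment> \<open>The power of x_1 - z_1 is annihilated by all lower derivatives along the line at
    \<open>z\<close>, and \<open>E\<close> takes care of the other points. Hence the order of the
    derivative serves as rank.\<close>
  define g where "g i = (if spec i then X2 - const2 (fst i $ 2)
      else (X1 - const2 (fst i $ 1)) ^ snd i) * E (fst i)" for i
  define I where "I = (SIGMA z:Z. {..<len z})"
  have len_spec: "\<not> spec (z, k) \<Longrightarrow> k < len z \<Longrightarrow> k < line_order F z - 1" for z k
    using ordN by (auto simp: len_def spec_def split: if_splits)
  have lenM: "len z < M" if "z \<in> Z" for z
    using member_le_sum[of z Z len] Z that by (auto simp: M_def)
  have X1_line: "poly X1 [:b:] = [:0, 1:]" for b :: real by (simp add: X1_def)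
  have X2_line: "poly X2 [:b:] = [:b:]" for b :: real by (simp add: X2_def)
  have pdX: "pd 1 (X2 - const2 a) = 0" "pd 2 (X2 - const2 a) = 1" for a :: real
    by (simp_all add: X2_def pd_pCons pd_diff)
  have Ez: "eval2 (E z) z \<noteq> 0" for z
  proof -
    have "w \<noteq> z \<Longrightarrow> eval2 (l z w) z \<noteq> 0" for w
      by (auto simp: l_def vec_eq_iff forall_2)
    then show ?thesis using Z by (simp add: E_def eval2_prod)
  qed
  have E_factor: "\<exists>r. E z = r * l z w ^ M" if "w \<in> Z" "w \<noteq> z" for w z
    unfolding E_def using Z that by (subst prod.remove[of _ w]) (auto simp: mult.commute)
  have E_dvd: "[:- (w $ 1), 1:] ^ M dvd poly (q * E z) [:w $ 2:]" if "w \<in> Z" "w \<noteq> z" for q w z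
  proof -
    have "[:- (w $ 1), 1:] dvd poly (l z w) [:w $ 2:]"
      by (simp add: l_def X1_line X2_line)
    then have "[:- (w $ 1), 1:] ^ M dvd poly (l z w ^ M) [:w $ 2:]"
      by (simp add: poly_power dvd_power_same)
    then show ?thesis using E_factor[OF that] by auto
  qed
  have E_pd: "eval2 (pd j (q * E z)) w = 0" if "w \<in> Z" "w \<noteq> z" for q w z j
  proof -
    from E_factor[OF that] obtain r where r: "E z = r * l z w ^ M" by blast
    obtain k where k: "M = k + 2" using M_def by blast
    have "q * E z = (q * r * l z w ^ k) * (l z w * l z w)"
      by (simp add: r k power_add power2_eq_square mult_ac)
    moreover have "eval2 (l z w) w = 0" by (simp add: l_def)
    ultimately show ?thesis by (simp only: pd_square_zero)
  qed
  have "card I \<le> tdeg F * tdeg (pd 1 F)"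
  proof (rule bezout_functionals[where lam = lam and g = g and rk = snd])
    show "finite I" using Z by (auto simp: I_def)
    show "lam i (p + q) = lam i p + lam i q" for i p q
      by (simp add: lam_def pd_add higher_pderiv_add algebra_simps)
    show "lam i (smult [:c:] p) = c * lam i p" for i c p
    proof -
      have "smult [:c:] p = const2 c * p" by simp
      then show ?thesis
        by (simp only: lam_def pd_mult pd_const eval2_simps poly_mult)
          (simp add: higher_pderiv_smult algebra_simps)
    qed
    fix i assume "i \<in> I"
    then obtain z k where i: "i = (z, k)" "z \<in> Z" "k < len z" by (auto simp: I_def)
    have ord: "[:- (z $ 1), 1:] ^ line_order F z dvd poly F [:z $ 2:]"
      unfolding line_order_def by (rule order_1)
    show "lam i (p * F) = 0" for p
    proof (cases "spec i")
      case True
      then have "z \<in> N" using i by (simp add: spec_def)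
      then show ?thesis using True i grad N by (simp add: lam_def pd_mult)
    next
      case False
      then have "k < line_order F z" using len_spec i by fastforce
      then show ?thesis using False ord i
        by (auto simp: lam_def intro!: dvd_imp_higher_pderiv_root)
    qed
    show "lam i (p * pd 1 F) = 0" for p
    proof (cases "spec i")
      case True
      then have "z \<in> N" using i by (simp add: spec_def)
      then show ?thesis using True i grad by (simp add: lam_def pd_mult)
    next
      case False
      then have k: "k < line_order F z - 1" using len_spec i by fastforce
      then obtain m where m: "line_order F z = Suc m" by (cases "line_order F z") auto
      have "[:- (z $ 1), 1:] ^ m dvd pderiv (poly F [:z $ 2:])"
        using ord m by (intro power_dvd_pderiv) simp
      then have "[:- (z $ 1), 1:] ^ m dvd poly (p * pd 1 F) [:z $ 2:]"
        by (simp add: poly_pd1)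
      then show ?thesis using False i k m
        by (auto simp: lam_def intro!: dvd_imp_higher_pderiv_root)
    qed
    show "lam i (g i) \<noteq> 0"
    proof (cases "spec i")
      case True
      then have "z \<in> N" using i by (simp add: spec_def)
      then show ?thesis using True i N Ez[of z] by (simp add: lam_def g_def pd_mult pdX)
    next
      case False
      define e where "e = poly (E z) [:z $ 2:]"
      have e: "poly e (z $ 1) \<noteq> 0" using Ez[of z] by (simp add: e_def eval2_line)
      then have nz: "[:- (z $ 1), 1:] ^ k * e \<noteq> 0" by auto
      have "order (z $ 1) ([:- (z $ 1), 1:] ^ k * e) = k"
        using e by (simp add: order_mult[OF nz] order_power_n_n order_0I)
      with higher_pderiv_order_nonzero[OF nz, of "z $ 1"]
      have "poly ((pderiv ^^ k) ([:- (z $ 1), 1:] ^ k * e)) (z $ 1) \<noteq> 0" by simp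
      then show ?thesis using False i by (simp add: lam_def g_def poly_power X1_line e_def)
    qed
    fix i' assume "i' \<in> I" and ne: "i \<noteq> i'" and rk: "snd i' \<le> snd i"
    then obtain w k' where i': "i' = (w, k')" "w \<in> Z" "k' < len w" by (auto simp: I_def)
    show "lam i' (g i) = 0"
    proof (cases "w = z")
      case False
      have k': "k' < M" using lenM[OF i'(2)] i'(3) by simp
      obtain q where q: "g i = q * E z" using i by (auto simp: g_def)
      show ?thesis
        using E_pd[OF i'(2) False, of _ q] dvd_imp_higher_pderiv_root[OF E_dvd[OF i'(2) False, of q] k'] i'
        by (simp add: lam_def q del: eval2_simps poly_mult)
    next
      case True
      then have k: "k' < k" using ne rk i i' by auto
      show ?thesis
      proof (cases "spec i")
        case True
        then show ?thesis using k i i' \<open>w = z\<close>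
          by (simp add: lam_def g_def spec_def X2_line)
      next
        case False
        have "\<not> spec i'" using k i i' \<open>w = z\<close> ordN by (auto simp: spec_def len_def)
        moreover have "[:- (z $ 1), 1:] ^ k dvd poly (g i) [:z $ 2:]"
          using False i by (simp add: g_def poly_power X1_line)
        ultimately show ?thesis using k i i' \<open>w = z\<close>
          by (auto simp: lam_def intro!: dvd_imp_higher_pderiv_root)
      qed
    qed
  qed (use cop nz in auto)
  moreover have "card I = (\<Sum>z\<in>Z. line_order F z - 1) + card N"
  proof -
    have "card I = (\<Sum>z\<in>Z. len z)" using Z by (simp add: I_def)
    also have "\<dots> = (\<Sum>z\<in>Z. line_order F z - 1) + (\<Sum>z\<in>Z. if z \<in> N then 1 else 0)"
      by (simp add: len_def sum.distrib)
    also have "(\<Sum>z\<in>Z. if z \<in> N then 1 else 0) = card N"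
      using Z by (simp add: sum.If_cases Int_absorb1)
    finally show ?thesis .
  qed
  ultimately show ?thesis by simp
qed

subsection \<open>Generic coordinates\<close>

text \<open>The direction of the horizontal lines is not asymptotic: no intersection of the curve
  with such a line escapes to infinity.\<close>

definition regular_x1 :: "'a::comm_ring_1 poly poly \<Rightarrow> bool" where
  "regular_x1 p \<longleftrightarrow> coeff (coeff p 0) (tdeg p) \<noteq> 0"

lemma regular_x1_iff: "regular_x1 p \<longleftrightarrow> poly (lead_coeff (radial p)) 0 \<noteq> 0"
  by (simp add: regular_x1_def degree_radial poly_0_coeff_0 coeff_radial)

lemma regular_x1_nonzero: "regular_x1 p \<Longrightarrow> p \<noteq> 0"
  by (auto simp: regular_x1_def)

lemma regular_x1_mult:
  fixes p q :: "'a::idom poly poly"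
  shows "regular_x1 (p * q) \<longleftrightarrow> regular_x1 p \<and> regular_x1 q"
  by (simp only: regular_x1_iff radial_mult lead_coeff_mult poly_mult) simp

lemma coeff_line:
  fixes p :: "'a::comm_ring_1 poly poly"
  assumes "tdeg p \<le> n"
  shows "coeff (poly p [:b:]) n = coeff (coeff p 0) n \<and> (\<forall>k>n. coeff (poly p [:b:]) k = 0)"
proof -
  have high: "coeff (coeff p j) i = 0" if "i + j > n" for i j
    using that assms tdeg_geI[of p j i] by fastforce
  have "coeff (poly p [:b:]) k = (\<Sum>j\<le>degree p. b ^ j * coeff (coeff p j) k)" for k
    by (simp add: poly_altdef coeff_sum poly_const_pow mult.commute)
  moreover have "(\<Sum>j\<le>degree p. b ^ j * coeff (coeff p j) k) = coeff (coeff p 0) k" if "k \<ge> n" for k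
  proof -
    have "(\<Sum>j\<le>degree p. b ^ j * coeff (coeff p j) k) = (\<Sum>j\<in>{0}. b ^ j * coeff (coeff p j) k)"
      using that high by (intro sum.mono_neutral_right) (auto intro: ccontr)
    then show ?thesis by simp
  qed
  ultimately show ?thesis using high by auto
qed

lemma regular_x1_line:
  assumes "regular_x1 p"
  shows "degree (poly p [:b:]) = tdeg p" "lead_coeff (poly p [:b:]) = coeff (coeff p 0) (tdeg p)"
    "poly p [:b:] \<noteq> 0"
proof -
  note c = coeff_line[OF order_refl, of p b]
  show "degree (poly p [:b:]) = tdeg p"
    using c assms by (intro antisym degree_le le_degree) (auto simp: regular_x1_def)
  then show "lead_coeff (poly p [:b:]) = coeff (coeff p 0) (tdeg p)" using c by simp
  show "poly p [:b:] \<noteq> 0" using c assms by (auto simp: regular_x1_def)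
qed

lemma regular_x1_pd1:
  fixes p :: "'a::{idom,semiring_char_0} poly poly"
  assumes "regular_x1 p" "tdeg p > 0"
  shows "coeff (coeff (pd 1 p) 0) (tdeg p - 1) \<noteq> 0"
proof -
  have "of_nat (tdeg p) \<noteq> (0::'a)" using assms(2) by simp
  then show ?thesis using assms
    by (simp add: pd_def coeff_map_poly coeff_pderiv regular_x1_def del: of_nat_Suc of_nat_eq_0_iff)
qed

text \<open>A common prime factor h of F = h g and of its derivative divides
  \<open>g * pd 1 h\<close>. It cannot divide \<open>pd 1 h\<close>, which is nonzero by regularity
  and of smaller degree, so it divides g and its square divides F.\<close>

lemma coprime_pd1:
  fixes F :: "real poly poly"
  assumes reg: "regular_x1 F"
    and sqf: "\<And>h. tdeg h > 0 \<Longrightarrow> regular_x1 h \<Longrightarrow> \<not> h * h dvd F"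
  shows "coprime F (pd 1 F)"
proof (rule ccontr)
  assume "\<not> coprime F (pd 1 F)"
  then have "\<not> is_unit (gcd F (pd 1 F))" by (simp add: coprime_iff_gcd_eq_1)
  moreover have F0: "F \<noteq> 0" using reg by (rule regular_x1_nonzero)
  ultimately obtain h where "h dvd gcd F (pd 1 F)" and "prime h"
    using prime_divisor_exists[of "gcd F (pd 1 F)"] by auto
  then have h: "h dvd F" "h dvd pd 1 F" "prime_elem h" by auto
  then obtain g where g: "F = h * g" by (auto simp: dvd_def)
  have hreg: "regular_x1 h" using reg g by (simp add: regular_x1_mult)
  have deg: "tdeg h > 0"
  proof (rule ccontr)
    assume "\<not> tdeg h > 0"
    then have "tdeg h = 0" by simp
    then have "h = const2 (coeff (coeff h 0) 0)"
      using tdeg_geI[of h] by (intro poly_eqI) (auto simp: coeff_pCons split: nat.splits intro: ccontr)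
    moreover have "coeff (coeff h 0) 0 \<noteq> 0" using hreg \<open>tdeg h = 0\<close> by (simp add: regular_x1_def)
    ultimately have "is_unit h" by (metis is_unit_const_poly_iff dvd_field_iff)
    then show False using h(3) by (simp add: prime_elem_def)
  qed
  have nd: "\<not> h dvd pd 1 h"
  proof
    assume "h dvd pd 1 h"
    then obtain k where k: "pd 1 h = h * k" by (auto simp: dvd_def)
    have "pd 1 h \<noteq> 0" using regular_x1_pd1[OF hreg deg] by auto
    with k have "k \<noteq> 0" "h \<noteq> 0" by auto
    then have "tdeg (pd 1 h) = tdeg h + tdeg k" using k by (simp add: tdeg_mult)
    then show False using tdeg_pd_le[of 1 h] deg by simp
  qed
  have "h dvd g * pd 1 h"
    using h(2) unfolding g pd_mult by (simp add: dvd_add_right_iff)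
  then have "h dvd g" using nd h(3) by (auto simp: prime_elem_dvd_mult_iff)
  then have "h * h dvd F" unfolding g by (rule mult_dvd_mono[OF dvd_refl])
  then show False using sqf[OF deg hreg] by blast
qed

section \<open>Shears, which turn lines of slope c into horizontal lines\<close>

definition shear :: "'a::comm_ring_1 \<Rightarrow> 'a poly poly \<Rightarrow> 'a poly poly" where
  "shear c p = p \<circ>\<^sub>p [:[:0, c:], 1:]"

definition shear_map :: "'a::comm_ring_1 \<Rightarrow> 'a^2 \<Rightarrow> 'a^2" where
  "shear_map c x = vector [x $ 1, x $ 2 + c * x $ 1]"

lemma shear_map_nth [simp]:
  "shear_map c x $ 1 = x $ 1" "shear_map c x $ 2 = x $ 2 + c * x $ 1"
  by (simp_all add: shear_map_def)

lemma shear_map_inverse [simp]: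
  "shear_map (- c) (shear_map c x) = x" "shear_map c (shear_map (- c) x) = x"
  by (simp_all add: vec_eq_iff forall_2)

lemma continuous_on_shear_map [continuous_intros]:
  "continuous_on S (shear_map (c::real))"
proof (rule continuous_on_eq)
  show "continuous_on S (\<lambda>x. (\<chi> i. if i = 1 then x $ 1 else x $ 2 + c * x $ 1) :: real^2)"
  proof (rule continuous_on_vec_lambda)
    show "continuous_on S (\<lambda>x. if i = 1 then x $ 1 else x $ 2 + c * x $ 1)" for i :: 2
      by (cases "i = 1") (auto intro!: continuous_intros)
  qed
qed (simp add: vec_eq_iff forall_2)

lemma eval2_shear: "eval2 (shear c p) x = eval2 p (shear_map c x)"
  by (induction p) (simp_all add: shear_def pcompose_pCons eval2_pCons, simp_all add: eval2_def algebra_simps)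

lemma shear_inverse: "shear (- c) (shear c p) = p"
  by (simp add: shear_def pcompose_pCons flip: pcompose_assoc)

lemma shear_mult: "shear c (p * q) = shear c p * shear c q"
  by (simp add: shear_def pcompose_mult)

lemma tdeg_shear_le: "tdeg (shear c p) \<le> tdeg p"
proof -
  \<comment> \<open>Generalized to all bounds \<open>n\<close> on the exponents: the tail of
    \<open>pCons a p\<close> then inherits the bound \<open>n - 1\<close>, which the linear factor
    brings back to \<open>n\<close>.\<close>
  have "\<forall>n. (\<forall>i j. coeff (coeff p j) i \<noteq> 0 \<longrightarrow> i + j \<le> n) \<longrightarrow> tdeg (shear c p) \<le> n"
  proof (induction p)
    case 0
    then show ?case by (simp add: shear_def)
  next
    case (pCons a p)
    show ?case
    proof (intro allI impI)
      fix n assume n: "\<forall>i j. coeff (coeff (pCons a p) j) i \<noteq> 0 \<longrightarrow> i + j \<le> n"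
      have a: "tdeg [:a:] \<le> n"
      proof (rule tdeg_leI)
        fix i j assume "coeff (coeff [:a:] j) i \<noteq> 0"
        then show "i + j \<le> n" using n[rule_format, of 0 i] by (auto simp: coeff_pCons split: nat.splits)
      qed
      have p: "i + Suc j \<le> n" if "coeff (coeff p j) i \<noteq> 0" for i j
        using n[rule_format, of "Suc j" i] that by simp
      have "tdeg ([:[:0, c:], 1:] * shear c p) \<le> n"
      proof (cases "p = 0")
        case True
        then show ?thesis by (simp add: shear_def)
      next
        case False
        then obtain j i where "coeff (coeff p j) i \<noteq> 0" by (metis leading_coeff_0_iff)
        from p[OF this] have "n \<ge> 1" by simp
        have "tdeg (shear c p) \<le> n - 1" by (rule pCons(2)[rule_format]) (use p in fastforce)
        moreover have "tdeg [:[:0, c:], 1:] \<le> 1"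
          by (rule tdeg_leI) (auto simp: coeff_pCons coeff_1 split: nat.splits if_splits)
        ultimately show ?thesis using tdeg_mult_le[of "[:[:0, c:], 1:]" "shear c p"] \<open>n \<ge> 1\<close> by linarith
      qed
      then show "tdeg (shear c (pCons a p)) \<le> n"
        unfolding shear_def pcompose_pCons by (rule tdeg_add_le[OF a])
    qed
  qed
  then show ?thesis using tdeg_geI by blast
qed

lemma coeff_poly_radial: "coeff (poly p [:0, c:]) n = poly (coeff (radial p) n) c"
proof (induction p arbitrary: n)
  case 0
  then show ?case by simp
next
  case (pCons a p)
  then show ?case
    by (cases n) (simp_all add: radial_pCons coeff_map_poly)
qed

lemma tdeg_shear: "tdeg (shear c p) = tdeg p"
  using tdeg_shear_le[of c p] tdeg_shear_le[of "- c" "shear c p"] by (simp add: shear_inverse)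

text \<open>The right-hand side is the leading form of \<open>p\<close> at the direction (1, c), so
  a nonzero \<open>p\<close> excludes only finitely many \<open>c\<close>.\<close>

lemma regular_shear_iff: "regular_x1 (shear c p) \<longleftrightarrow> poly (lead_coeff (radial p)) c \<noteq> 0"
proof -
  have "coeff (coeff (shear c p) 0) (tdeg p) = coeff (poly p [:0, c:]) (tdeg p)"
    by (simp add: shear_def poly_pcompose flip: poly_0_coeff_0)
  then show ?thesis by (simp add: regular_x1_def tdeg_shear coeff_poly_radial degree_radial)
qed

lemma pd_shear:
  "pd 1 (shear c p) = shear c (pd 1 p + const2 c * pd 2 p)"
proof (induction p)
  case 0
  then show ?case by (simp add: shear_def)
next
  case (pCons a p)
  define L where "L = [:[:0, c:], 1:]"
  have s: "shear c (pCons b q) = [:b:] + L * shear c q" for b q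
    by (simp add: shear_def pcompose_pCons L_def)
  have add: "shear c (q + r) = shear c q + shear c r" for q r
    by (simp add: shear_def pcompose_add)
  have const: "shear c (const2 b) = const2 b" for b by (simp add: shear_def)
  have zero: "shear c 0 = 0" by (simp add: shear_def)
  have L: "pd 1 L = const2 c" "pd 1 [:a:] = [:pderiv a:]"
    by (simp_all add: L_def pd_pCons pderiv_pCons)
  have "pd 1 (shear c (pCons a p)) = [:pderiv a:] + (L * pd 1 (shear c p) + shear c p * const2 c)"
    by (simp only: s pd_add pd_mult L)
  also have "\<dots> = shear c (pd 1 (pCons a p) + const2 c * pd 2 (pCons a p))"
    by (simp only: pd_pCons add s shear_mult const pCons.IH pCons_0_0 add_0 zero ring_distribs mult_zero_left mult_zero_right mult_ac add_ac)
  finally show ?case .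
qed

lemma complexify_shear: "complexify (shear c p) = shear (complex_of_real c) (complexify p)"
proof (induction p)
  case 0
  then show ?case by (simp add: shear_def complexify_def)
next
  case (pCons a p)
  have s: "shear c (pCons b q) = [:b:] + [:[:0, c:], 1:] * shear c q" for b q and c :: "'b::comm_ring_1"
    by (simp add: shear_def pcompose_pCons)
  have "complexify (pCons a p) = pCons (map_poly complex_of_real a) (complexify p)"
    by (simp add: complexify_def map_poly_pCons)
  moreover have "complexify [:[:0, c:], 1:] = [:[:0, complex_of_real c:], 1:]"
    by (simp add: complexify_def map_poly_pCons)
  moreover have "complexify [:a:] = [:map_poly complex_of_real a:]"
    by (simp add: complexify_def map_poly_pCons)
  ultimately show ?case by (simp only: s complexify_add complexify_mult pCons.IH)
qed

text \<open>All complex zeros of a square factor are singular, and regularity supplies one on each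
  of the lines of height 0 and 1, hence two different ones.\<close>

lemma square_factor_singular_points:
  fixes h F :: "real poly poly"
  assumes h: "regular_x1 h" "tdeg h > 0" and dvd: "h * h dvd shear c F"
  shows "\<exists>x y. x \<noteq> y \<and> x \<in> singular_points (complexify F) \<and> y \<in> singular_points (complexify F)"
proof -
  from dvd obtain g where g: "shear c F = h * h * g" by (auto simp: dvd_def)
  define h' where "h' = shear (- c) h"
  have F: "F = h' * h' * shear (- c) g"
    unfolding h'_def by (metis g shear_inverse shear_mult)
  have zero: "\<exists>x. x $ 2 = b \<and> eval2 (complexify h) x = 0" for b
  proof -
    have "regular_x1 (complexify h)"
      using h by (simp add: regular_x1_def coeff_complexify)
    then have "degree (poly (complexify h) [:b:]) > 0"
      using h(2) by (simp add: regular_x1_line)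
    then have "\<not> constant (poly (poly (complexify h) [:b:]))" by (simp add: constant_degree)
    then obtain a where "poly (poly (complexify h) [:b:]) a = 0"
      using fundamental_theorem_of_algebra by blast
    then show ?thesis by (intro exI[of _ "vector [a, b]"]) (simp add: eval2_line)
  qed
  obtain x y where xy: "x $ 2 = 0" "eval2 (complexify h) x = 0" "y $ 2 = 1" "eval2 (complexify h) y = 0"
    using zero[of 0] zero[of 1] by blast
  define C where "C = shear_map (complex_of_real c)"
  have sing: "C z \<in> singular_points (complexify F)" if "eval2 (complexify h) z = 0" for z
  proof -
    have h0: "eval2 (complexify h') (C z) = 0"
      using that by (simp add: h'_def complexify_shear eval2_shear C_def)
    have "eval2 (pd j (complexify F)) (C z) = 0" for j
      using h0 unfolding F complexify_mult by (simp add: pd_mult)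
    moreover have "eval2 (complexify F) (C z) = 0"
      using h0 unfolding F complexify_mult by simp
    ultimately show ?thesis by (simp add: singular_points_def zeros_def gradient2_def vec_eq_iff)
  qed
  have "C x \<noteq> C y"
    using xy unfolding C_def by (metis shear_map_inverse(1) zero_neq_one)
  then show ?thesis using sing xy by blast
qed

subsection \<open>Counting regions by a line sweep\<close>

text \<open>Sending each point of \<open>T\<close> but the largest to the next element of
  \<open>R\<close> on its right is injective.\<close>

lemma card_separated_le:
  fixes T R :: "real set"
  assumes "finite T" "finite R" and sep: "\<And>s t. s \<in> T \<Longrightarrow> t \<in> T \<Longrightarrow> s < t \<Longrightarrow> \<exists>r\<in>R. s < r \<and> r < t"
  shows "card T \<le> Suc (card R)"
proof (cases "T = {}")
  case False
  define \<phi> where "\<phi> t = Min {r \<in> R. t < r}" for t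
  have \<phi>: "\<phi> s \<in> R" "s < \<phi> s" "\<phi> s < t" if st: "s \<in> T" "t \<in> T" "s < t" for s t
  proof -
    obtain r where r: "r \<in> R" "s < r" "r < t" using sep[OF st] by blast
    have "\<phi> s \<in> {r \<in> R. s < r}"
      unfolding \<phi>_def using assms(2) r by (intro Min_in) auto
    moreover have "\<phi> s \<le> r" unfolding \<phi>_def using assms(2) r by (intro Min_le) auto
    ultimately show "\<phi> s \<in> R" "s < \<phi> s" "\<phi> s < t" using r by auto
  qed
  have max: "s < Max T" if "s \<in> T - {Max T}" for s
    using that assms(1) by (simp add: less_le)
  have Max: "Max T \<in> T" using assms(1) False by simp
  have "inj_on \<phi> (T - {Max T})"
  proof (rule inj_onI)
    fix s t assume st: "s \<in> T - {Max T}" "t \<in> T - {Max T}" "\<phi> s = \<phi> t"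
    show "s = t"
      using \<phi>[of s t] \<phi>[of t s] \<phi>(2)[of s "Max T"] \<phi>(2)[of t "Max T"] max[OF st(1)] max[OF st(2)] Max st
      by (cases s t rule: linorder_cases) auto
  qed
  moreover have "\<phi> ` (T - {Max T}) \<subseteq> R" using \<phi>(1) max Max by blast
  ultimately have "card (T - {Max T}) \<le> card R"
    using card_inj_on_le assms(2) by blast
  then show ?thesis using assms(1) Max by (simp add: card_Diff_singleton)
qed simp

text \<open>Rolle's theorem, applied \<open>m\<close> times.\<close>

lemma card_roots_le_higher_pderiv:
  fixes p :: "real poly"
  assumes "a < b" "\<And>x. a < x \<Longrightarrow> x < b \<Longrightarrow> poly ((pderiv ^^ m) p) x \<noteq> 0"
  shows "card {x. a < x \<and> x < b \<and> poly p x = 0} \<le> m"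
  using assms(2)
proof (induction m arbitrary: p)
  case 0
  then have none: "{x. a < x \<and> x < b \<and> poly p x = 0} = {}" by auto
  show ?case unfolding none by simp
next
  case (Suc m)
  define R where "R q = {x. a < x \<and> x < b \<and> poly q x = 0}" for q
  have d: "\<And>x. a < x \<Longrightarrow> x < b \<Longrightarrow> poly ((pderiv ^^ m) (pderiv p)) x \<noteq> 0"
    using Suc.prems by (simp add: funpow_Suc_right del: funpow.simps)
  obtain c where c: "a < c" "c < b" using assms(1) dense by blast
  have p': "pderiv p \<noteq> 0" using d[OF c] by auto
  have "finite (R q)" if "q \<noteq> 0" for q
    unfolding R_def by (rule finite_subset[OF _ poly_roots_finite[OF that]]) auto
  moreover have "p \<noteq> 0" using p' by auto
  ultimately have fin: "finite (R p)" "finite (R (pderiv p))" using p' by auto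
  have "card (R p) \<le> Suc (card (R (pderiv p)))"
  proof (rule card_separated_le[OF fin])
    fix s t assume st: "s \<in> R p" "t \<in> R p" "s < t"
    then obtain x where "s < x" "x < t" "(t - s) * poly (pderiv p) x = 0"
      using poly_MVT[of s t p] by (auto simp: R_def)
    then show "\<exists>r\<in>R (pderiv p). s < r \<and> r < t" using st by (intro bexI[of _ x]) (auto simp: R_def)
  qed
  also have "\<dots> \<le> Suc m" using Suc.IH[OF d] by (simp add: R_def)
  finally show ?case by (simp add: R_def)
qed

definition pt :: "real \<Rightarrow> real \<Rightarrow> real^2" where
  "pt x b = vector [x, b]"

lemma pt_nth [simp]: "pt x b $ 1 = x" "pt x b $ 2 = b"
  by (simp_all add: pt_def)

lemma pt_inject [simp]: "pt x b = pt x' b' \<longleftrightarrow> x = x' \<and> b = b'"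
  by (auto simp: vec_eq_iff forall_2)

lemma pt_eta [simp]: "pt (z $ 1) (z $ 2) = z"
  by (auto simp: vec_eq_iff forall_2)

lemma continuous_on_pt [continuous_intros]:
  assumes "continuous_on S f" "continuous_on S g"
  shows "continuous_on S (\<lambda>u. pt (f u) (g u))"
proof (rule continuous_on_eq)
  show "continuous_on S (\<lambda>u. (\<chi> i. if i = 1 then f u else g u) :: real^2)"
  proof (rule continuous_on_vec_lambda)
    show "continuous_on S (\<lambda>u. if i = 1 then f u else g u)" for i :: 2
      using assms by (cases "i = 1") auto
  qed
qed (simp add: vec_eq_iff forall_2)

lemma eval2_pt: "eval2 P (pt x b) = poly (poly P [:b:]) x"
  by (simp add: eval2_line)

text \<open>On the line of height \<open>b\<close> the leading coefficient does not depend on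
  \<open>b\<close>, while the others are bounded for \<open>b\<close> near \<open>a\<close>; so
  Cauchy's bound for the roots is uniform.\<close>

lemma regular_x1_roots_bounded:
  fixes P :: "real poly poly"
  assumes reg: "regular_x1 P"
  shows "\<exists>M. \<forall>x b. \<bar>b - a\<bar> \<le> 1 \<longrightarrow> eval2 P (pt x b) = 0 \<longrightarrow> \<bar>x\<bar> \<le> M"
proof -
  define n \<kappa> where "n = tdeg P" and "\<kappa> = coeff (coeff P 0) (tdeg P)"
  define A where "A = \<bar>a\<bar> + 1"
  define B where "B = (\<Sum>i<n. \<Sum>j\<le>degree P. A ^ j * \<bar>coeff (coeff P j) i\<bar>)"
  have \<kappa>: "\<kappa> \<noteq> 0" using reg by (simp add: regular_x1_def \<kappa>_def)
  have "\<bar>x\<bar> \<le> max 1 (B / \<bar>\<kappa>\<bar>)" if b: "\<bar>b - a\<bar> \<le> 1" and x0: "eval2 P (pt x b) = 0" for x b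
  proof (rule ccontr)
    assume "\<not> ?thesis"
    then have x: "\<bar>x\<bar> > 1" "\<bar>x\<bar> > B / \<bar>\<kappa>\<bar>" by auto
    define p where "p = poly P [:b:]"
    have p: "degree p = n" "coeff p n = \<kappa>"
      using regular_x1_line[OF reg, of b] by (auto simp: p_def n_def \<kappa>_def)
    have c: "\<bar>coeff p i\<bar> \<le> (\<Sum>j\<le>degree P. A ^ j * \<bar>coeff (coeff P j) i\<bar>)" for i
    proof -
      have "coeff p i = (\<Sum>j\<le>degree P. b ^ j * coeff (coeff P j) i)"
        by (simp add: p_def poly_altdef coeff_sum poly_const_pow mult.commute)
      also have "\<bar>\<dots>\<bar> \<le> (\<Sum>j\<le>degree P. \<bar>b\<bar> ^ j * \<bar>coeff (coeff P j) i\<bar>)"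
        by (rule order_trans[OF sum_abs]) (simp add: abs_mult power_abs)
      also have "\<dots> \<le> (\<Sum>j\<le>degree P. A ^ j * \<bar>coeff (coeff P j) i\<bar>)"
        using b by (intro sum_mono mult_right_mono power_mono) (auto simp: A_def)
      finally show ?thesis .
    qed
    have n0: "n \<noteq> 0"
    proof
      assume "n = 0"
      then have "p = [:\<kappa>:]" using p by (metis degree_eq_zeroE coeff_pCons_0)
      then show False using x0 \<kappa> by (simp add: eval2_pt p_def)
    qed
    then obtain l where l: "n = Suc l" by (cases n) auto
    have "poly p x = 0" using x0 by (simp add: eval2_pt p_def)
    then have "0 = (\<Sum>i<n. coeff p i * x ^ i) + \<kappa> * x ^ n"
      using p by (simp add: poly_altdef flip: lessThan_Suc_atMost)
    then have "\<bar>\<kappa>\<bar> * \<bar>x\<bar> ^ n = \<bar>\<Sum>i<n. coeff p i * x ^ i\<bar>"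
      by (metis abs_minus_cancel abs_mult add_eq_0_iff power_abs)
    also have "\<dots> \<le> (\<Sum>i<n. \<bar>coeff p i\<bar> * \<bar>x\<bar> ^ i)"
      by (rule order_trans[OF sum_abs]) (simp add: abs_mult power_abs)
    also have "\<dots> \<le> (\<Sum>i<n. (\<Sum>j\<le>degree P. A ^ j * \<bar>coeff (coeff P j) i\<bar>) * \<bar>x\<bar> ^ l)"
      using x l by (intro sum_mono mult_mono c power_increasing) (auto simp: A_def intro!: sum_nonneg)
    also have "\<dots> = B * \<bar>x\<bar> ^ l" by (simp add: B_def sum_distrib_right)
    finally have "(\<bar>\<kappa>\<bar> * \<bar>x\<bar>) * \<bar>x\<bar> ^ l \<le> B * \<bar>x\<bar> ^ l" by (simp add: l mult_ac)
    moreover have "0 < \<bar>x\<bar> ^ l" using x by (intro zero_less_power) linarith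
    ultimately have "\<bar>\<kappa>\<bar> * \<bar>x\<bar> \<le> B" by (rule mult_right_le_imp_le)
    then show False using x \<kappa> by (simp add: field_simps)
  qed
  then show ?thesis by blast
qed

section \<open>Regions of the complement of a curve and the heights where they start\<close>

context
  fixes P :: "real poly poly" and U :: "(real^2) set"
  assumes reg: "regular_x1 P"
  defines "U \<equiv> {x. eval2 P x \<noteq> 0}"
begin

lemma line_nonzero: "poly P [:b:] \<noteq> 0"
  using regular_x1_line[OF reg] by blast

lemma region_path:
  assumes "\<Omega> \<in> components U" "x \<in> \<Omega>" "connected S" "S \<subseteq> U" "x \<in> S"
  shows "S \<subseteq> \<Omega>"
  using components_maximal[OF assms(1,3,4)] assms(2,5) by blast

lemma region_horizontal:
  assumes \<Omega>: "\<Omega> \<in> components U" "pt s b \<in> \<Omega>"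
    and nz: "\<And>r. r \<in> {min s t..max s t} \<Longrightarrow> poly (poly P [:b:]) r \<noteq> 0"
  shows "pt t b \<in> \<Omega>"
proof -
  have "(\<lambda>r. pt r b) ` {min s t..max s t} \<subseteq> \<Omega>"
  proof (rule region_path[OF \<Omega>])
    show "connected ((\<lambda>r. pt r b) ` {min s t..max s t})"
      by (intro connected_continuous_image continuous_intros) auto
  qed (use nz in \<open>auto simp: U_def eval2_pt\<close>)
  then show ?thesis by (auto simp: image_subset_iff)
qed

lemma region_vertical:
  assumes \<Omega>: "\<Omega> \<in> components U" "pt x s \<in> \<Omega>"
    and nz: "\<And>r. r \<in> {min s t..max s t} \<Longrightarrow> eval2 P (pt x r) \<noteq> 0"
  shows "pt x t \<in> \<Omega>"
proof -
  have "(\<lambda>r. pt x r) ` {min s t..max s t} \<subseteq> \<Omega>"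
  proof (rule region_path[OF \<Omega>])
    show "connected ((\<lambda>r. pt x r) ` {min s t..max s t})"
      by (intro connected_continuous_image continuous_intros) auto
  qed (use nz in \<open>auto simp: U_def\<close>)
  then show ?thesis by (auto simp: image_subset_iff)
qed

definition heights :: "(real^2) set \<Rightarrow> real set" where
  "heights \<Omega> = (\<lambda>x. x $ 2) ` \<Omega>"

lemma in_heights_iff: "t \<in> heights \<Omega> \<longleftrightarrow> (\<exists>x. pt x t \<in> \<Omega>)"
proof
  assume "t \<in> heights \<Omega>"
  then obtain z where "z \<in> \<Omega>" "t = z $ 2" by (auto simp: heights_def)
  then have "pt (z $ 1) t \<in> \<Omega>" by simp
  then show "\<exists>x. pt x t \<in> \<Omega>" ..
qed (force simp: heights_def)

lemma heights_convex:
  assumes "\<Omega> \<in> components U" "s \<in> heights \<Omega>" "t \<in> heights \<Omega>" "s \<le> r" "r \<le> t"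
  shows "r \<in> heights \<Omega>"
proof -
  have "connected (heights \<Omega>)"
    unfolding heights_def using in_components_connected[OF assms(1)]
    by (intro connected_continuous_image continuous_intros)
  then show ?thesis using assms(2-) unfolding connected_iff_interval by blast
qed

text \<open>Regions are open, so the infimum of the heights is never attained: a region starting at
  height a does not meet the line of height a.\<close>

lemma heights_lower:
  assumes "\<Omega> \<in> components U" "t \<in> heights \<Omega>"
  shows "\<exists>s\<in>heights \<Omega>. s < t"
proof -
  obtain x where x: "pt x t \<in> \<Omega>" using assms(2) by (auto simp: heights_def) (metis pt_eta)
  have "open \<Omega>" using open_components[OF _ assms(1)] open_eval2_nonzero U_def by auto
  then obtain e where e: "e > 0" "ball (pt x t) e \<subseteq> \<Omega>" using x openE by blast
  have "dist (pt x t) (pt x (t - e / 2)) = norm (pt 0 (e / 2))"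
    by (simp add: dist_norm) (rule arg_cong[where f = norm], simp add: vec_eq_iff forall_2)
  also have "\<dots> \<le> \<bar>e / 2\<bar>" by (simp add: norm_vec_def L2_set_def UNIV_2)
  also have "\<dots> < e" using e by simp
  finally have "pt x (t - e / 2) \<in> \<Omega>" using e by auto
  then show ?thesis using e by (intro bexI[of _ "t - e / 2"]) (auto simp: heights_def image_iff intro!: bexI)
qed

lemma regions_disjoint:
  assumes "\<Omega> \<in> components U" "\<Omega>' \<in> components U" "x \<in> \<Omega>" "x \<in> \<Omega>'"
  shows "\<Omega> = \<Omega>'"
  using assms components_nonoverlap[of \<Omega> U \<Omega>'] by blast

lemma regions_separated:
  assumes "\<Omega> \<in> components U" "\<Omega>' \<in> components U" "\<Omega> \<noteq> \<Omega>'" "pt s b \<in> \<Omega>" "pt t b \<in> \<Omega>'" "s < t"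
  shows "\<exists>r. s < r \<and> r < t \<and> poly (poly P [:b:]) r = 0"
proof (rule ccontr)
  assume *: "\<not> ?thesis"
  have "pt s b \<in> U" "pt t b \<in> U" using assms in_components_subset by blast+
  then have "s \<noteq> r \<and> t \<noteq> r" if "poly (poly P [:b:]) r = 0" for r
    using that by (auto simp: U_def eval2_pt)
  with * have "pt t b \<in> \<Omega>"
    using assms by (intro region_horizontal[of \<Omega> s b t]) (auto simp: less_le)
  then show False using regions_disjoint assms by blast
qed

lemma card_unbounded_regions:
  assumes Q: "finite Q" "Q \<subseteq> components U" "\<And>\<Omega>. \<Omega> \<in> Q \<Longrightarrow> \<not> bdd_below (heights \<Omega>)"
  shows "card Q \<le> Suc (tdeg P)"
proof (cases "Q = {}")
  case False
  have "\<forall>\<Omega>\<in>Q. \<exists>t. t \<in> heights \<Omega>"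
    using Q(2) in_components_nonempty unfolding heights_def by fastforce
  then obtain t where t: "\<And>\<Omega>. \<Omega> \<in> Q \<Longrightarrow> t \<Omega> \<in> heights \<Omega>" by metis
  \<comment> \<open>Heights form intervals unbounded below, so the line at the lowest chosen height
    meets all regions of \<open>Q\<close>.\<close>
  define b where "b = Min (t ` Q)"
  have "b \<in> heights \<Omega>" if \<Omega>: "\<Omega> \<in> Q" for \<Omega>
  proof -
    obtain s where "s \<in> heights \<Omega>" "s < b" using Q(3)[OF \<Omega>] unfolding bdd_below_def by (meson not_le)
    moreover have "b \<le> t \<Omega>" unfolding b_def using that Q by (intro Min_le) auto
    ultimately show ?thesis using heights_convex[of \<Omega> s "t \<Omega>" b] t[OF \<Omega>] \<Omega> Q by auto
  qed
  then have "\<forall>\<Omega>\<in>Q. \<exists>x. pt x b \<in> \<Omega>" by (simp add: in_heights_iff)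
  then obtain x where x: "\<And>\<Omega>. \<Omega> \<in> Q \<Longrightarrow> pt (x \<Omega>) b \<in> \<Omega>" by metis
  have inj: "inj_on x Q"
  proof (rule inj_onI)
    fix \<Omega> \<Omega>' assume "\<Omega> \<in> Q" "\<Omega>' \<in> Q" "x \<Omega> = x \<Omega>'"
    then show "\<Omega> = \<Omega>'"
      using regions_disjoint[of \<Omega> \<Omega>' "pt (x \<Omega>) b"] x[of \<Omega>] x[of \<Omega>'] Q(2) by auto
  qed
  define R where "R = {r. poly (poly P [:b:]) r = 0}"
  have "card (x ` Q) \<le> Suc (card R)"
  proof (rule card_separated_le)
    fix s t assume "s \<in> x ` Q" "t \<in> x ` Q" "s < t"
    then obtain \<Omega> \<Omega>' where "\<Omega> \<in> Q" "\<Omega>' \<in> Q" "s = x \<Omega>" "t = x \<Omega>'" by blast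
    then show "\<exists>r\<in>R. s < r \<and> r < t"
      using regions_separated[of \<Omega> \<Omega>' s b t] x Q \<open>s < t\<close> by (force simp: R_def)
  qed (use Q line_nonzero in \<open>auto simp: R_def poly_roots_finite\<close>)
  also have "card R \<le> tdeg P"
    using card_poly_roots_bound[OF line_nonzero[of b]] regular_x1_line(1)[OF reg] by (simp add: R_def)
  finally show ?thesis using card_image[OF inj] by simp
qed simp

text \<open>
  Near the line at height \<open>a\<close> all zeros lie in small boxes around the zeros on that line; a region
  that starts at height \<open>a\<close> meets a slightly higher line strictly between two zeros in one box, since
  all other points of that line can be joined to points below.
\<close>

lemma card_regions_starting_at:
  assumes Q: "finite Q" "Q \<subseteq> components U"
    and inf: "\<And>\<Omega>. \<Omega> \<in> Q \<Longrightarrow> bdd_below (heights \<Omega>) \<and> Inf (heights \<Omega>) = a"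
  shows "card Q \<le> (\<Sum>y\<in>{y. poly (poly P [:a:]) y = 0}. line_order P (pt y a) - 1)"
proof -
  define Y where "Y = {y. poly (poly P [:a:]) y = 0}"
  define m where "m y = line_order P (pt y a)" for y
  have finY: "finite Y" unfolding Y_def using poly_roots_finite line_nonzero by blast
  have low: "a < s" if \<Omega>: "\<Omega> \<in> Q" "s \<in> heights \<Omega>" for \<Omega> s
  proof -
    obtain r where "r \<in> heights \<Omega>" "r < s" using heights_lower[of \<Omega> s] \<Omega> Q by auto
    moreover have "a \<le> r" using inf[OF \<Omega>(1)] \<open>r \<in> heights \<Omega>\<close> cInf_lower by metis
    ultimately show ?thesis by simp
  qed
  have pd_pow: "poly ((pd 1 ^^ k) P) [:b:] = (pderiv ^^ k) (poly P [:b:])" for k b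
    by (induction k) (simp_all add: poly_pd1)
  \<comment> \<open>The derivative whose order equals the order of contact is nonzero at the point,
    hence in a box around it; this will allow at most \<open>m y\<close> zeros per line in the
    box.\<close>
  have "\<exists>e>0. \<forall>x b. \<bar>x - y\<bar> < e \<longrightarrow> \<bar>b - a\<bar> < e \<longrightarrow> poly ((pderiv ^^ m y) (poly P [:b:])) x \<noteq> 0" for y
  proof -
    have "eval2 ((pd 1 ^^ m y) P) (pt y a) \<noteq> 0"
      using higher_pderiv_order_nonzero[OF line_nonzero, of y a]
      by (simp add: eval2_pt pd_pow m_def line_order_def)
    then obtain e where e: "e > 0" "ball (pt y a) e \<subseteq> {x. eval2 ((pd 1 ^^ m y) P) x \<noteq> 0}"
      using openE[OF open_eval2_nonzero] by blast
    show ?thesis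
    proof (intro exI[of _ "e / 2"] conjI allI impI)
      fix x b assume xb: "\<bar>x - y\<bar> < e / 2" "\<bar>b - a\<bar> < e / 2"
      have "dist (pt y a) (pt x b) \<le> \<bar>x - y\<bar> + \<bar>b - a\<bar>"
        using norm_le_l1_cart[of "pt y a - pt x b"] by (simp add: dist_norm UNIV_2 sum_2 abs_minus_commute)
      then have "pt x b \<in> ball (pt y a) e" using xb by simp
      then show "poly ((pderiv ^^ m y) (poly P [:b:])) x \<noteq> 0"
        using e by (auto simp: eval2_pt pd_pow)
    qed (use e in simp)
  qed
  then obtain \<epsilon>0 where \<epsilon>0: "\<And>y. \<epsilon>0 y > 0"
    "\<And>y x b. \<bar>x - y\<bar> < \<epsilon>0 y \<Longrightarrow> \<bar>b - a\<bar> < \<epsilon>0 y \<Longrightarrow> poly ((pderiv ^^ m y) (poly P [:b:])) x \<noteq> 0"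
    by metis
  \<comment> \<open>All constraints on the box size: the boxes above, and half the distances between
    zeros, so that boxes are disjoint and their sides lie in \<open>C\<close>. The 1 keeps the set
    nonempty.\<close>
  define D where "D = insert 1 (\<epsilon>0 ` Y \<union> (\<lambda>(y, y'). \<bar>y - y'\<bar> / 2) ` {(y, y') \<in> Y \<times> Y. y \<noteq> y'})"
  define \<epsilon> where "\<epsilon> = Min D"
  have finD: "finite D" unfolding D_def using finY
    by (intro finite.insertI finite_UnI finite_imageI) (auto intro: finite_subset[of _ "Y \<times> Y"])
  have "\<epsilon> \<in> D" unfolding \<epsilon>_def using finD by (intro Min_in) (auto simp: D_def)
  then have \<epsilon>pos: "\<epsilon> > 0" using \<epsilon>0(1) by (auto simp: D_def)
  have \<epsilon>le: "\<epsilon> \<le> d" if "d \<in> D" for d unfolding \<epsilon>_def using finD that by simp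
  have \<epsilon>Y: "\<epsilon> \<le> \<epsilon>0 y" if "y \<in> Y" for y using that by (intro \<epsilon>le) (auto simp: D_def)
  have \<epsilon>sep: "2 * \<epsilon> \<le> \<bar>y - y'\<bar>" if "y \<in> Y" "y' \<in> Y" "y \<noteq> y'" for y y'
    using \<epsilon>le[of "\<bar>y - y'\<bar> / 2"] that by (force simp: D_def)
  define C where "C = {x. \<forall>y\<in>Y. \<epsilon> \<le> \<bar>x - y\<bar>}"
  \<comment> \<open>The zeros outside the boxes at heights within 1 of \<open>a\<close> form a
    compact set that misses the line at height \<open>a\<close>, so they keep a positive distance
    from it.\<close>
  have "\<exists>h>0. h \<le> 1 \<and> (\<forall>x\<in>C. \<forall>b. \<bar>b - a\<bar> < h \<longrightarrow> eval2 P (pt x b) \<noteq> 0)"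
  proof -
    obtain M where M: "\<And>x b. \<bar>b - a\<bar> \<le> 1 \<Longrightarrow> eval2 P (pt x b) = 0 \<Longrightarrow> \<bar>x\<bar> \<le> M"
      using regular_x1_roots_bounded[OF reg, of a] by blast
    define K where "K = {z. z $ 1 \<in> C \<and> \<bar>z $ 2 - a\<bar> \<le> 1 \<and> eval2 P z = 0}"
    have "closed K"
    proof -
      have "K = (\<Inter>y\<in>Y. {z. \<epsilon> \<le> \<bar>z $ 1 - y\<bar>}) \<inter> {z. \<bar>z $ 2 - a\<bar> \<le> 1} \<inter> {z. eval2 P z = 0}"
        by (auto simp: K_def C_def)
      then show ?thesis
        by (auto intro!: closed_Int closed_INT closed_Collect_le closed_Collect_eq continuous_intros)
    qed
    moreover have "bounded K"
    proof (rule boundedI)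
      fix z assume "z \<in> K"
      then have "\<bar>z $ 1\<bar> \<le> M" "\<bar>z $ 2 - a\<bar> \<le> 1" using M[of "z $ 2" "z $ 1"] by (auto simp: K_def)
      then show "norm z \<le> M + (\<bar>a\<bar> + 1)"
        using norm_le_l1_cart[of z] by (simp add: UNIV_2 sum_2)
    qed
    ultimately have compact: "compact K" by (simp add: compact_eq_bounded_closed)
    show ?thesis
    proof (cases "K = {}")
      case True
      then have "eval2 P (pt x b) \<noteq> 0" if "x \<in> C" "\<bar>b - a\<bar> < 1" for x b
        using that unfolding K_def by (auto dest!: spec[of _ "pt x b"])
      then show ?thesis by (intro exI[of _ 1]) auto
    next
      case False
      have "\<exists>z\<in>K. \<forall>w\<in>K. \<bar>z $ 2 - a\<bar> \<le> \<bar>w $ 2 - a\<bar>"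
        by (rule continuous_attains_inf[OF compact False]) (intro continuous_intros)
      then obtain z where z: "z \<in> K" "\<And>w. w \<in> K \<Longrightarrow> \<bar>z $ 2 - a\<bar> \<le> \<bar>w $ 2 - a\<bar>" by blast
      have "z $ 2 \<noteq> a"
      proof
        assume "z $ 2 = a"
        then have "z $ 1 \<in> Y" using z(1) by (auto simp: Y_def K_def eval2_line)
        then show False using z(1) \<epsilon>pos by (auto simp: K_def C_def)
      qed
      moreover have "eval2 P (pt x b) \<noteq> 0" if "x \<in> C" "\<bar>b - a\<bar> < \<bar>z $ 2 - a\<bar>" for x b
      proof
        assume "eval2 P (pt x b) = 0"
        then have "pt x b \<in> K" using that z(1) by (auto simp: K_def)
        from z(2)[OF this] that show False by simp
      qed
      ultimately show ?thesis using z(1) by (intro exI[of _ "\<bar>z $ 2 - a\<bar>"]) (auto simp: K_def)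
    qed
  qed
  then obtain h where h: "h > 0" "\<And>x b. x \<in> C \<Longrightarrow> \<bar>b - a\<bar> < h \<Longrightarrow> eval2 P (pt x b) \<noteq> 0" by blast
  \<comment> \<open>From a point outside the boxes one can descend vertically to height
    \<open>a\<close> without meeting a zero, but the region stays strictly above
    \<open>a\<close>.\<close>
  have notC: "pt x b \<notin> \<Omega>" if "\<Omega> \<in> Q" "x \<in> C" "\<bar>b - a\<bar> < h" for \<Omega> x b
  proof
    assume "pt x b \<in> \<Omega>"
    then have "pt x a \<in> \<Omega>"
      using that Q h by (intro region_vertical[of \<Omega> x b a]) auto
    then show False using low[OF that(1), of a] by (force simp: heights_def)
  qed
  have "\<forall>\<Omega>\<in>Q. \<exists>t. t \<in> heights \<Omega>"
    using Q(2) in_components_nonempty unfolding heights_def by fastforce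
  then obtain t where t: "\<And>\<Omega>. \<Omega> \<in> Q \<Longrightarrow> t \<Omega> \<in> heights \<Omega>" by metis
  \<comment> \<open>Low enough to stay in the zero-free strips and in the boxes, and below a known
    height of each region, so that the line at height \<open>a + k\<close> meets all of
    them.\<close>
  define k where "k = Min (insert (h / 2) (insert (\<epsilon> / 2) ((\<lambda>\<Omega>. t \<Omega> - a) ` Q)))"
  have "k > 0" unfolding k_def using Q h \<epsilon>pos low t by (subst Min_gr_iff) auto
  moreover have kle: "k \<le> d" if "d \<in> insert (h / 2) (insert (\<epsilon> / 2) ((\<lambda>\<Omega>. t \<Omega> - a) ` Q))" for d
    unfolding k_def using Q that by (intro Min_le) auto
  ultimately have k: "k > 0" "k \<le> h / 2" "k \<le> \<epsilon> / 2" "\<And>\<Omega>. \<Omega> \<in> Q \<Longrightarrow> k \<le> t \<Omega> - a"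
    using kle[of "h / 2"] kle[of "\<epsilon> / 2"] kle by auto
  define b where "b = a + k"
  have bh: "\<bar>b - a\<bar> < h" "\<bar>b - a\<bar> < \<epsilon>" using k h \<epsilon>pos by (auto simp: b_def)
  have "b \<in> heights \<Omega>" if "\<Omega> \<in> Q" for \<Omega>
  proof -
    have "\<exists>s\<in>heights \<Omega>. s < b"
      using cInf_lessD[of "heights \<Omega>" b] inf[OF that] t[OF that] k(1) by (auto simp: b_def)
    then obtain s where "s \<in> heights \<Omega>" "s < b" by blast
    then show ?thesis using heights_convex[of \<Omega> s "t \<Omega>" b] t[OF that] that Q k(4)[OF that]
      by (auto simp: b_def)
  qed
  then have "\<forall>\<Omega>\<in>Q. \<exists>x. pt x b \<in> \<Omega>" by (simp add: in_heights_iff)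
  then obtain x where x: "\<And>\<Omega>. \<Omega> \<in> Q \<Longrightarrow> pt (x \<Omega>) b \<in> \<Omega>" by metis
  have inj: "inj_on x Q"
  proof (rule inj_onI)
    fix \<Omega> \<Omega>' assume "\<Omega> \<in> Q" "\<Omega>' \<in> Q" "x \<Omega> = x \<Omega>'"
    then show "\<Omega> = \<Omega>'"
      using regions_disjoint[of \<Omega> \<Omega>' "pt (x \<Omega>) b"] x[of \<Omega>] x[of \<Omega>'] Q(2) by auto
  qed
  define T where "T y = {s \<in> x ` Q. \<bar>s - y\<bar> < \<epsilon>}" for y
  have cover: "x ` Q \<subseteq> (\<Union>y\<in>Y. T y)"
  proof
    fix s assume s: "s \<in> x ` Q"
    then have "s \<notin> C" using notC x bh by blast
    then show "s \<in> (\<Union>y\<in>Y. T y)" using s by (auto simp: C_def T_def not_le)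
  qed
  have cardT: "card (T y) \<le> m y - 1" if y: "y \<in> Y" for y
  proof (cases "T y = {}")
    case False
    define R where "R = {r. y - \<epsilon> < r \<and> r < y + \<epsilon> \<and> poly (poly P [:b:]) r = 0}"
    have finR: "finite R" unfolding R_def
      by (rule finite_subset[OF _ poly_roots_finite[OF line_nonzero[of b]]]) auto
    have finT: "finite (T y)" using Q by (simp add: T_def)
    have ends: "y - \<epsilon> \<in> C" "y + \<epsilon> \<in> C"
      using \<epsilon>sep[OF y] \<epsilon>pos by (fastforce simp: C_def)+
    \<comment> \<open>Without a zero in between, the region would reach the side of the box, which
      is a point of \<open>C\<close>.\<close>
    have sep_end: "\<exists>r\<in>R. min s c < r \<and> r < max s c"
      if s: "s \<in> T y" and c: "c \<in> {y - \<epsilon>, y + \<epsilon>}" for s c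
    proof (rule ccontr)
      assume *: "\<not> ?thesis"
      from s obtain \<Omega> where \<Omega>: "\<Omega> \<in> Q" "s = x \<Omega>" and sy: "\<bar>s - y\<bar> < \<epsilon>" by (auto simp: T_def)
      have "pt c b \<in> \<Omega>"
      proof (rule region_horizontal)
        show "\<Omega> \<in> components U" "pt s b \<in> \<Omega>" using \<Omega> Q x by auto
        fix r assume r: "r \<in> {min s c..max s c}"
        have "pt s b \<in> U" using x[OF \<Omega>(1)] \<Omega> Q in_components_subset by blast
        then have "poly (poly P [:b:]) s \<noteq> 0" by (simp add: U_def eval2_pt)
        moreover have "poly (poly P [:b:]) c \<noteq> 0"
          using h(2)[of c b] ends c bh by (auto simp: eval2_pt)
        ultimately have sc: "poly (poly P [:b:]) s \<noteq> 0" "poly (poly P [:b:]) c \<noteq> 0" .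
        show "poly (poly P [:b:]) r \<noteq> 0"
        proof
          assume r0: "poly (poly P [:b:]) r = 0"
          with sc have "r \<noteq> s" "r \<noteq> c" by auto
          with r have lt: "min s c < r" "r < max s c" by (auto simp: min_def max_def split: if_splits)
          then have "r \<in> R" using r0 sy c unfolding R_def by (auto simp: min_def max_def abs_less_iff split: if_splits)
          with * lt show False by blast
        qed
      qed
      then show False using notC[OF \<Omega>(1)] ends c bh by auto
    qed
    \<comment> \<open>The two sides of the box are separated from the regions as well. Counting them
      with \<open>T y\<close> turns the bound \<open>m y + 1\<close> into
      \<open>m y - 1\<close>.\<close>
    have "card (insert (y - \<epsilon>) (insert (y + \<epsilon>) (T y))) \<le> Suc (card R)"
    proof (rule card_separated_le)
      fix s t assume st: "s \<in> insert (y - \<epsilon>) (insert (y + \<epsilon>) (T y))"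
        "t \<in> insert (y - \<epsilon>) (insert (y + \<epsilon>) (T y))" "s < t"
      have Ty: "y - \<epsilon> < s \<and> s < y + \<epsilon>" if "s \<in> T y" for s using that by (auto simp: T_def)
      obtain u where u: "u \<in> T y" using False by blast
      consider "s \<in> T y" "t \<in> T y" | "s \<in> T y" "t = y + \<epsilon>" | "s = y - \<epsilon>" "t \<in> T y" | "s = y - \<epsilon>" "t = y + \<epsilon>"
        using st Ty \<epsilon>pos by fastforce
      then show "\<exists>r\<in>R. s < r \<and> r < t"
      proof cases
        case 1
        then obtain \<Omega> \<Omega>' where \<Omega>: "\<Omega> \<in> Q" "\<Omega>' \<in> Q" "s = x \<Omega>" "t = x \<Omega>'" by (auto simp: T_def)
        then obtain r where "s < r" "r < t" "poly (poly P [:b:]) r = 0"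
          using regions_separated[of \<Omega> \<Omega>' s b t] x Q \<open>s < t\<close> by force
        then show ?thesis using Ty[OF 1(1)] Ty[OF 1(2)] by (intro bexI[of _ r]) (auto simp: R_def)
      next
        case 2
        then show ?thesis using sep_end[of s "y + \<epsilon>"] st(3) by (auto simp: min_def max_def split: if_splits)
      next
        case 3
        then show ?thesis using sep_end[of t "y - \<epsilon>"] st(3) by (auto simp: min_def max_def split: if_splits)
      next
        case 4
        then show ?thesis using sep_end[OF u, of "y - \<epsilon>"] Ty[OF u] by (force simp: min_def max_def split: if_splits)
      qed
    qed (use finT finR in auto)
    moreover have "card (insert (y - \<epsilon>) (insert (y + \<epsilon>) (T y))) = card (T y) + 2"
      using finT \<epsilon>pos by (subst card_insert_disjoint) (auto simp: T_def)
    moreover have "card R \<le> m y"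
      unfolding R_def
    proof (rule card_roots_le_higher_pderiv)
      fix r assume "y - \<epsilon> < r" "r < y + \<epsilon>"
      then show "poly ((pderiv ^^ m y) (poly P [:b:])) r \<noteq> 0"
        using \<epsilon>Y[OF y] bh by (intro \<epsilon>0(2)) auto
    qed (use \<epsilon>pos in simp)
    ultimately show ?thesis by simp
  qed simp
  have "card Q = card (x ` Q)" using card_image[OF inj] by simp
  also have "\<dots> \<le> card (\<Union>y\<in>Y. T y)"
    using cover finY Q by (intro card_mono finite_UN_I) (auto simp: T_def)
  also have "\<dots> \<le> (\<Sum>y\<in>Y. card (T y))" by (rule card_UN_le[OF finY])
  also have "\<dots> \<le> (\<Sum>y\<in>Y. m y - 1)" by (rule sum_mono[OF cardT])
  finally show ?thesis by (simp add: Y_def m_def)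
qed

text \<open>The regions are sorted by starting height, those without one being counted on a low
  line. Working with finite sets of regions lets finiteness of the whole set follow from the
  bound.\<close>

lemma card_regions_le:
  assumes R: "finite R" "R \<subseteq> components U"
    and bound: "\<And>Z. finite Z \<Longrightarrow> (\<Sum>z\<in>Z. line_order P z - 1) \<le> K"
  shows "card R \<le> Suc (tdeg P) + K"
proof -
  define R0 where "R0 = {\<Omega> \<in> R. \<not> bdd_below (heights \<Omega>)}"
  define R1 where "R1 a = {\<Omega> \<in> R. bdd_below (heights \<Omega>) \<and> Inf (heights \<Omega>) = a}" for a
  define A where "A = (\<lambda>\<Omega>. Inf (heights \<Omega>)) ` R"
  define Y where "Y a = {y. poly (poly P [:a:]) y = 0}" for a
  have finA: "finite A" using R by (simp add: A_def)
  have finY: "finite (Y a)" for a unfolding Y_def using poly_roots_finite line_nonzero by blast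
  have "R \<subseteq> R0 \<union> (\<Union>a\<in>A. R1 a)" by (auto simp: R0_def R1_def A_def)
  then have "card R \<le> card (R0 \<union> (\<Union>a\<in>A. R1 a))"
    using R finA by (intro card_mono) (auto simp: R0_def R1_def)
  also have "\<dots> \<le> card R0 + card (\<Union>a\<in>A. R1 a)" by (rule card_Un_le)
  also have "card R0 \<le> Suc (tdeg P)"
    using R by (intro card_unbounded_regions) (auto simp: R0_def)
  also have "card (\<Union>a\<in>A. R1 a) \<le> (\<Sum>a\<in>A. card (R1 a))" by (rule card_UN_le[OF finA])
  also have "\<dots> \<le> (\<Sum>a\<in>A. \<Sum>y\<in>Y a. line_order P (pt y a) - 1)"
    unfolding Y_def using R by (intro sum_mono card_regions_starting_at) (auto simp: R1_def)
  also have "\<dots> = (\<Sum>(a, y)\<in>Sigma A Y. line_order P (pt y a) - 1)"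
    using finA finY by (subst sum.Sigma) auto
  also have "\<dots> = (\<Sum>z\<in>(\<lambda>(a, y). pt y a) ` Sigma A Y. line_order P z - 1)"
    by (subst sum.reindex) (auto simp: inj_on_def case_prod_unfold)
  also have "\<dots> \<le> K" using finA finY by (intro bound finite_imageI finite_SigmaI) auto
  finally show ?thesis by simp
qed

end

subsection \<open>Zero sets as graphs\<close>

text \<open>Monotonicity and the sign change give a unique zero over each \<open>x\<close>. It
  depends continuously on \<open>x\<close> because signs slightly below and above it persist, so the
  zero set is a continuous image of \<open>I\<close>.\<close>

lemma zero_set_graph:
  fixes G :: "real \<Rightarrow> real \<Rightarrow> real"
  assumes cont: "\<And>y. c \<le> y \<Longrightarrow> y \<le> d \<Longrightarrow> continuous_on I (\<lambda>x. G x y)"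
    and cont_y: "\<And>x. x \<in> I \<Longrightarrow> continuous_on {c..d} (G x)"
    and inc: "\<And>x y y'. x \<in> I \<Longrightarrow> c \<le> y \<Longrightarrow> y < y' \<Longrightarrow> y' \<le> d \<Longrightarrow> G x y < G x y'"
    and signs: "\<And>x. x \<in> I \<Longrightarrow> G x c < 0" "\<And>x. x \<in> I \<Longrightarrow> G x d > 0"
    and I: "connected I" and cd: "c < d"
  shows "connected {(x, y). x \<in> I \<and> c \<le> y \<and> y \<le> d \<and> G x y = 0}"
    and "\<forall>x\<in>I. \<exists>y. c \<le> y \<and> y \<le> d \<and> G x y = 0"
proof -
  show ex: "\<forall>x\<in>I. \<exists>y. c \<le> y \<and> y \<le> d \<and> G x y = 0"
  proof
    fix x assume x: "x \<in> I"
    then show "\<exists>y. c \<le> y \<and> y \<le> d \<and> G x y = 0"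
      using IVT'[of "G x" c 0 d] cont_y signs[OF x] cd by (auto simp: less_imp_le)
  qed
  then obtain \<phi> where \<phi>: "\<And>x. x \<in> I \<Longrightarrow> c \<le> \<phi> x \<and> \<phi> x \<le> d \<and> G x (\<phi> x) = 0" by metis
  have mono: "G x y < G x y' \<longleftrightarrow> y < y'" if "x \<in> I" "c \<le> y" "y \<le> d" "c \<le> y'" "y' \<le> d" for x y y'
    using inc[OF that(1)] that by (metis less_irrefl less_trans linorder_neqE)
  have "continuous_on I \<phi>"
    unfolding continuous_on_iff
  proof (intro ballI allI impI)
    fix x0 and e :: real assume x0: "x0 \<in> I" and e: "0 < e"
    \<comment> \<open>Brackets around the zero, cut off at the ends of the interval on which
      monotonicity is available.\<close>
    define l u where "l = max c (\<phi> x0 - e / 2)" and "u = min d (\<phi> x0 + e / 2)"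
    have "\<phi> x0 \<noteq> c" "\<phi> x0 \<noteq> d" using signs[OF x0] \<phi>[OF x0] by auto
    then have lu: "c \<le> l" "l < \<phi> x0" "\<phi> x0 < u" "u \<le> d" "l \<le> d" "c \<le> u"
      using \<phi>[OF x0] e by (auto simp: l_def u_def)
    have "G x0 l < 0" "G x0 u > 0"
      using inc[OF x0, of l "\<phi> x0"] inc[OF x0, of "\<phi> x0" u] \<phi>[OF x0] lu by auto
    moreover have "((\<lambda>x. G x l) \<longlongrightarrow> G x0 l) (at x0 within I)" "((\<lambda>x. G x u) \<longlongrightarrow> G x0 u) (at x0 within I)"
      using cont lu x0 by (auto simp: continuous_on_def)
    ultimately have "\<forall>\<^sub>F x in at x0 within I. G x l < 0 \<and> G x u > 0"
      by (intro eventually_conj order_tendstoD)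
    then obtain \<delta> where \<delta>: "\<delta> > 0" "\<And>x. x \<in> I \<Longrightarrow> x \<noteq> x0 \<Longrightarrow> dist x x0 < \<delta> \<Longrightarrow> G x l < 0 \<and> G x u > 0"
      unfolding eventually_at by auto
    have "dist (\<phi> x) (\<phi> x0) < e" if x: "x \<in> I" "dist x x0 < \<delta>" for x
    proof (cases "x = x0")
      case False
      then have "G x l < G x (\<phi> x)" "G x (\<phi> x) < G x u" using \<delta>(2)[OF x(1)] x \<phi>[OF x(1)] by auto
      then have "l < \<phi> x" "\<phi> x < u"
        using mono[OF x(1), of l "\<phi> x"] mono[OF x(1), of "\<phi> x" u] \<phi>[OF x(1)] lu by auto
      then show ?thesis using e by (auto simp: l_def u_def dist_real_def)
    qed (use e in simp)
    then show "\<exists>\<delta>>0. \<forall>x\<in>I. dist x x0 < \<delta> \<longrightarrow> dist (\<phi> x) (\<phi> x0) < e" using \<delta>(1) by blast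
  qed
  then have "connected ((\<lambda>x. (x, \<phi> x)) ` I)"
    using I by (intro connected_continuous_image continuous_intros)
  moreover have "(\<lambda>x. (x, \<phi> x)) ` I = {(x, y). x \<in> I \<and> c \<le> y \<and> y \<le> d \<and> G x y = 0}"
  proof -
    have "y = \<phi> x" if "x \<in> I" "c \<le> y" "y \<le> d" "G x y = 0" for x y
      using mono[OF that(1,2,3), of "\<phi> x"] mono[OF that(1) _ _ that(2,3), of "\<phi> x"] \<phi>[OF that(1)] that
      by auto
    then show ?thesis using \<phi> by auto
  qed
  ultimately show "connected {(x, y). x \<in> I \<and> c \<le> y \<and> y \<le> d \<and> G x y = 0}" by simp
qed

text \<open>The implicit function theorem with one box for all parameters \<open>r\<close> near
  \<open>b\<close>. The set \<open>I\<close> is left free because it will be an interval, a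
  half-open interval that leaves out infinity, or a single point.\<close>

lemma implicit_zero_set_pos:
  fixes G G' :: "'a::metric_space \<Rightarrow> real \<Rightarrow> real \<Rightarrow> real"
  assumes G: "continuous_on UNIV (\<lambda>(r, x, y). G r x y)"
    and G': "continuous_on UNIV (\<lambda>(r, x, y). G' r x y)"
    and deriv: "\<And>r x y. (G r x has_real_derivative G' r x y) (at y)"
    and zero: "G b 0 0 = 0" and pos: "G' b 0 0 > 0" and e: "e > 0"
  shows "\<exists>\<kappa> \<eta> \<delta>. 0 < \<kappa> \<and> \<kappa> < e \<and> 0 < \<eta> \<and> \<eta> < e \<and> 0 < \<delta> \<and>
    (\<forall>r I. dist r b < \<delta> \<longrightarrow> connected I \<longrightarrow> I \<subseteq> {-\<kappa>..\<kappa>} \<longrightarrow>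
       connected {(x, y). x \<in> I \<and> -\<eta> \<le> y \<and> y \<le> \<eta> \<and> G r x y = 0}
       \<and> (\<forall>x\<in>I. \<exists>y. -\<eta> \<le> y \<and> y \<le> \<eta> \<and> G r x y = 0))"
proof -
  have near: "\<exists>\<delta>>0. \<forall>r x y. dist r b < \<delta> \<longrightarrow> \<bar>x\<bar> < \<delta> \<longrightarrow> \<bar>y - y0\<bar> < \<delta> \<longrightarrow> h r x y > 0"
    if h: "continuous_on UNIV (\<lambda>(r, x, y). h r x y)" "h b 0 y0 > 0" for h :: "'a \<Rightarrow> real \<Rightarrow> real \<Rightarrow> real" and y0
  proof -
    have "open {t. case t of (r, x, y) \<Rightarrow> h r x y > 0}"
      using open_Collect_less[OF continuous_on_const h(1)] by (simp add: case_prod_unfold)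
    then obtain \<epsilon> where \<epsilon>: "\<epsilon> > 0" "ball (b, 0, y0) \<epsilon> \<subseteq> {t. case t of (r, x, y) \<Rightarrow> h r x y > 0}"
      using openE[of _ "(b, 0, y0)"] h(2) by auto
    have "h r x y > 0" if "dist r b < \<epsilon> / 3" "\<bar>x\<bar> < \<epsilon> / 3" "\<bar>y - y0\<bar> < \<epsilon> / 3" for r x y
    proof -
      have "dist (b, 0, y0) (r, x, y) \<le> dist b r + dist (0, y0) (x, y)"
        unfolding dist_Pair_Pair[of b "(0, y0)"] by (rule sqrt_sum_squares_le_sum) auto
      also have "dist (0, y0) (x, y) \<le> dist 0 x + dist y0 y"
        unfolding dist_Pair_Pair by (rule sqrt_sum_squares_le_sum) auto
      finally have "dist (b, 0, y0) (r, x, y) < \<epsilon>"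
        using that by (simp add: dist_commute dist_real_def abs_minus_commute)
      then show ?thesis using \<epsilon>(2) by auto
    qed
    then show ?thesis using \<epsilon>(1) by (intro exI[of _ "\<epsilon> / 3"]) auto
  qed
  obtain \<delta>1 where \<delta>1: "\<delta>1 > 0"
    "\<And>r x y. dist r b < \<delta>1 \<Longrightarrow> \<bar>x\<bar> < \<delta>1 \<Longrightarrow> \<bar>y\<bar> < \<delta>1 \<Longrightarrow> G' r x y > 0"
    using near[OF G' pos] by auto
  define \<eta> where "\<eta> = min e \<delta>1 / 2"
  have \<eta>: "0 < \<eta>" "\<eta> < e" "\<eta> < \<delta>1" using e \<delta>1 by (auto simp: \<eta>_def min_def)
  have inc: "G r x y < G r x y'"
    if "dist r b < \<delta>1" "\<bar>x\<bar> < \<delta>1" "- \<eta> \<le> y" "y < y'" "y' \<le> \<eta>" for r x y y'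
  proof (rule DERIV_pos_imp_increasing[OF that(4)])
    fix t assume "y \<le> t" "t \<le> y'"
    then have "\<bar>t\<bar> < \<delta>1" using that \<eta> by auto
    then show "\<exists>z. (G r x has_real_derivative z) (at t) \<and> z > 0"
      using deriv \<delta>1(2)[OF that(1,2)] by blast
  qed
  have "G b 0 (-\<eta>) < 0" "G b 0 \<eta> > 0"
    using inc[of b 0 "-\<eta>" 0] inc[of b 0 0 \<eta>] zero \<delta>1 \<eta> by auto
  moreover have "continuous_on UNIV (\<lambda>(r, x, y). - G r x y)"
    using continuous_on_minus[OF G] by (simp add: case_prod_unfold)
  ultimately obtain \<delta>2 \<delta>3 where \<delta>23: "\<delta>2 > 0" "\<delta>3 > 0"
    "\<And>r x. dist r b < \<delta>2 \<Longrightarrow> \<bar>x\<bar> < \<delta>2 \<Longrightarrow> G r x (-\<eta>) < 0"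
    "\<And>r x. dist r b < \<delta>3 \<Longrightarrow> \<bar>x\<bar> < \<delta>3 \<Longrightarrow> G r x \<eta> > 0"
    using near[of "\<lambda>r x y. - G r x y" "-\<eta>"] near[OF G, of \<eta>] by force
  define \<delta> where "\<delta> = min e (min \<delta>1 (min \<delta>2 \<delta>3)) / 2"
  have \<delta>: "0 < \<delta>" "\<delta> < e" "\<delta> < \<delta>1" "\<delta> < \<delta>2" "\<delta> < \<delta>3" using e \<delta>1 \<delta>23 by (auto simp: \<delta>_def min_def)
  have "continuous_on I (\<lambda>x. (\<lambda>(r, x, y). G r x y) (r, x, y))" for I r y
    by (rule continuous_on_compose2[OF G]) (intro continuous_intros, simp)
  then have contx: "continuous_on I (\<lambda>x. G r x y)" for I r y by simp
  have "continuous_on I (\<lambda>y. (\<lambda>(r, x, y). G r x y) (r, x, y))" for I r x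
    by (rule continuous_on_compose2[OF G]) (intro continuous_intros, simp)
  then have conty: "continuous_on I (G r x)" for I r x by simp
  show ?thesis
  proof (rule exI[of _ \<delta>], rule exI[of _ \<eta>], rule exI[of _ \<delta>], intro conjI allI impI)
    fix r I assume r: "dist r b < \<delta>" and I: "connected I" "I \<subseteq> {-\<delta>..\<delta>}"
    have x: "\<bar>x\<bar> < \<delta>1" "\<bar>x\<bar> < \<delta>2" "\<bar>x\<bar> < \<delta>3" if "x \<in> I" for x
      using that I(2) \<delta> by (force simp: subset_iff)+
    have signs: "\<And>x. x \<in> I \<Longrightarrow> G r x (-\<eta>) < 0" "\<And>x. x \<in> I \<Longrightarrow> G r x \<eta> > 0"
      using \<delta>23 x r \<delta> by auto
    have inc': "\<And>x y y'. x \<in> I \<Longrightarrow> -\<eta> \<le> y \<Longrightarrow> y < y' \<Longrightarrow> y' \<le> \<eta> \<Longrightarrow> G r x y < G r x y'"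
      using inc x r \<delta> by auto
    show "connected {(x, y). x \<in> I \<and> -\<eta> \<le> y \<and> y \<le> \<eta> \<and> G r x y = 0}"
      by (rule zero_set_graph(1)) (use contx conty signs inc' I \<eta> in auto)
    show "\<forall>x\<in>I. \<exists>y. -\<eta> \<le> y \<and> y \<le> \<eta> \<and> G r x y = 0"
      by (rule zero_set_graph(2)) (use contx conty signs inc' I \<eta> in auto)
  qed (use \<delta> \<eta> in auto)
qed

lemma implicit_zero_set:
  fixes G G' :: "'a::metric_space \<Rightarrow> real \<Rightarrow> real \<Rightarrow> real"
  assumes G: "continuous_on UNIV (\<lambda>(r, x, y). G r x y)"
    and G': "continuous_on UNIV (\<lambda>(r, x, y). G' r x y)"
    and deriv: "\<And>r x y. (G r x has_real_derivative G' r x y) (at y)"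
    and zero: "G b 0 0 = 0" and nz: "G' b 0 0 \<noteq> 0" and e: "e > 0"
  shows "\<exists>\<kappa> \<eta> \<delta>. 0 < \<kappa> \<and> \<kappa> < e \<and> 0 < \<eta> \<and> \<eta> < e \<and> 0 < \<delta> \<and>
    (\<forall>r I. dist r b < \<delta> \<longrightarrow> connected I \<longrightarrow> I \<subseteq> {-\<kappa>..\<kappa>} \<longrightarrow>
       connected {(x, y). x \<in> I \<and> -\<eta> \<le> y \<and> y \<le> \<eta> \<and> G r x y = 0}
       \<and> (\<forall>x\<in>I. \<exists>y. -\<eta> \<le> y \<and> y \<le> \<eta> \<and> G r x y = 0))"
proof (cases "G' b 0 0 > 0")
  case True
  show ?thesis by (rule implicit_zero_set_pos[OF G G' deriv zero True e])
next
  case False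
  have neg: "continuous_on UNIV (\<lambda>(r, x, y). - G r x y)" "continuous_on UNIV (\<lambda>(r, x, y). - G' r x y)"
    using continuous_on_minus[OF G] continuous_on_minus[OF G'] by (simp_all add: case_prod_unfold)
  show ?thesis
    using implicit_zero_set_pos[OF neg DERIV_minus[OF deriv] _ _ e, of b] zero nz False by simp
qed

subsection \<open>Homogenization\<close>

lemma coeff_hom_part:
  "coeff (coeff (hom_part k p) j) i = (if i + j = k then coeff (coeff p j) i else 0)"
proof -
  have "coeff (coeff (hom_part k p) j) i
      = (\<Sum>l\<le>k. if l = j then (if i + l = k then coeff (coeff p l) i else 0) else 0)"
    unfolding hom_part_def coeff_sum by (intro sum.cong refl) auto
  then show ?thesis by (auto simp: sum.delta)
qed

lemma sum_hom_part:
  assumes "tdeg p \<le> n"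
  shows "(\<Sum>k\<le>n. hom_part k p) = p"
proof (rule poly_eqI, rule poly_eqI)
  fix j i
  have "i + j > n \<Longrightarrow> coeff (coeff p j) i = 0" using tdeg_geI[of p j i] assms by fastforce
  then show "coeff (coeff (\<Sum>k\<le>n. hom_part k p) j) i = coeff (coeff p j) i"
    by (auto simp: coeff_sum coeff_hom_part sum.delta not_le)
qed

lemma hom_part_eq_0: "tdeg p < k \<Longrightarrow> hom_part k p = 0"
  using tdeg_geI[of p] by (intro poly_eqI) (fastforce simp: coeff_hom_part)

lemma eval2_monom: "eval2 (monom (monom a i) j) x = a * x $ 1 ^ i * x $ 2 ^ j"
  by (simp add: eval2_def poly_monom poly_const_pow mult_ac)

lemma eval2_hom_part: "eval2 (hom_part k p) x = (\<Sum>j\<le>k. coeff (coeff p j) (k - j) * x $ 1 ^ (k - j) * x $ 2 ^ j)"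
  by (simp add: hom_part_def eval2_sum eval2_monom)

lemma eval2_hom_part_scale: "eval2 (hom_part k p) (c *\<^sub>R x) = c ^ k * eval2 (hom_part k p) x"
  for p :: "real poly poly"
  unfolding eval2_hom_part sum_distrib_left
proof (rule sum.cong)
  fix j assume "j \<in> {..k}"
  then have "c ^ k = c ^ (k - j) * c ^ j" by (simp flip: power_add)
  then show "coeff (coeff p j) (k - j) * (c *\<^sub>R x) $ 1 ^ (k - j) * (c *\<^sub>R x) $ 2 ^ j
      = c ^ k * (coeff (coeff p j) (k - j) * x $ 1 ^ (k - j) * x $ 2 ^ j)"
    by (simp add: power_mult_distrib mult_ac)
qed simp

text \<open>The value at (y, s) of \<open>p\<close> homogenized in degree \<open>n\<close>, with s
  the homogenizing coordinate. The degree may exceed \<open>tdeg p\<close>, so that f_2 can be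
  homogenized together with f_1.\<close>

definition heval :: "nat \<Rightarrow> real poly poly \<Rightarrow> real^2 \<Rightarrow> real \<Rightarrow> real" where
  "heval n p y s = (\<Sum>k\<le>n. s ^ (n - k) * eval2 (hom_part k p) y)"

lemma heval_nonzero:
  assumes "tdeg p \<le> n" "s \<noteq> 0"
  shows "heval n p y s = s ^ n * eval2 p ((1 / s) *\<^sub>R y)"
proof -
  have "heval n p y s = (\<Sum>k\<le>n. s ^ n * eval2 (hom_part k p) ((1 / s) *\<^sub>R y))"
    unfolding heval_def
  proof (rule sum.cong)
    fix k assume "k \<in> {..n}"
    then have "s ^ n = s ^ (n - k) * s ^ k" by (simp flip: power_add)
    then show "s ^ (n - k) * eval2 (hom_part k p) y = s ^ n * eval2 (hom_part k p) ((1 / s) *\<^sub>R y)"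
      using assms(2) by (simp add: eval2_hom_part_scale field_simps)
  qed simp
  also have "\<dots> = s ^ n * eval2 p ((1 / s) *\<^sub>R y)"
    using sum_hom_part[OF assms(1)] by (simp flip: sum_distrib_left eval2_sum)
  finally show ?thesis .
qed

lemma heval_0: "heval n p y 0 = eval2 (hom_part n p) y"
proof -
  have "heval n p y 0 = (\<Sum>k\<le>n. if k = n then eval2 (hom_part n p) y else 0)"
    unfolding heval_def by (intro sum.cong) (auto simp: power_0_left)
  then show ?thesis by simp
qed

lemma continuous_on_heval [continuous_intros]:
  assumes "continuous_on S g" "continuous_on S h"
  shows "continuous_on S (\<lambda>x. heval n p (g x) (h x))"
  unfolding heval_def using assms by (intro continuous_intros)

section \<open>Directional derivatives and orthogonal frames\<close>

definition slope :: "real poly poly \<Rightarrow> real^2 \<Rightarrow> real^2 \<Rightarrow> real" where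
  "slope p x v = eval2 (pd 1 p) x * v $ 1 + eval2 (pd 2 p) x * v $ 2"

lemma slope_inner: "slope p x v = gradient2 p x \<bullet> v"
  by (simp add: slope_def gradient2_def inner_vec_def sum_2)

lemma DERIV_eval2_line:
  "((\<lambda>t. eval2 p (a + t *\<^sub>R v)) has_real_derivative slope p (a + t *\<^sub>R v) v) (at t)"
proof -
  have "((\<lambda>t. a + t *\<^sub>R v) has_derivative (\<lambda>h. h *\<^sub>R v)) (at t)"
    by (auto intro!: derivative_eq_intros)
  from has_derivative_compose[OF this eval2_has_derivative]
  have "((\<lambda>t. eval2 p (a + t *\<^sub>R v)) has_derivative (\<lambda>h. h * slope p (a + t *\<^sub>R v) v)) (at t)"
    by (simp add: slope_def algebra_simps)
  then show ?thesis by (simp add: has_field_derivative_def mult_commute_abs)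
qed

text \<open>A form that vanishes at \<open>u\<close> vanishes on the whole line through the origin
  and \<open>u\<close>.\<close>

lemma slope_hom_part_radial:
  assumes "eval2 (hom_part k p) u = 0"
  shows "slope (hom_part k p) u u = 0"
proof -
  have "((\<lambda>t. eval2 (hom_part k p) (0 + t *\<^sub>R u)) has_real_derivative slope (hom_part k p) (0 + 1 *\<^sub>R u) u) (at 1)"
    by (rule DERIV_eval2_line)
  moreover have "(\<lambda>t. eval2 (hom_part k p) (0 + t *\<^sub>R u)) = (\<lambda>t. 0)"
    using assms by (simp add: eval2_hom_part_scale)
  ultimately have "((\<lambda>t. 0) has_real_derivative slope (hom_part k p) u u) (at 1)" by simp
  then show ?thesis using DERIV_unique DERIV_const by blast
qed

definition perp :: "real^2 \<Rightarrow> real^2" where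
  "perp v = pt (- v $ 2) (v $ 1)"

lemma inner_perp [simp]: "perp v \<bullet> perp v = v \<bullet> v" "v \<bullet> perp v = 0" "perp v \<bullet> v = 0"
  by (simp_all add: perp_def inner_vec_def sum_2)

lemma norm_perp [simp]: "norm (perp v) = norm v"
  by (simp add: norm_eq_sqrt_inner)

lemma perp_expansion:
  assumes "v \<noteq> 0"
  shows "x = ((x \<bullet> perp v) / (v \<bullet> v)) *\<^sub>R perp v + ((x \<bullet> v) / (v \<bullet> v)) *\<^sub>R v"
proof -
  have "v \<bullet> v \<noteq> 0" using assms by simp
  moreover have "(v \<bullet> v) *\<^sub>R x = (x \<bullet> perp v) *\<^sub>R perp v + (x \<bullet> v) *\<^sub>R v"
    by (simp add: vec_eq_iff forall_2 perp_def inner_vec_def sum_2 algebra_simps)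
  ultimately have "x = (1 / (v \<bullet> v)) *\<^sub>R ((x \<bullet> perp v) *\<^sub>R perp v + (x \<bullet> v) *\<^sub>R v)"
    by (metis divide_self_if scaleR_one scaleR_scaleR times_divide_eq_left mult_1)
  then show ?thesis by (simp add: scaleR_add_right)
qed

subsection \<open>Components of a family of curves transversal at infinity\<close>

text \<open>The open unit disc is a model of the plane in which the boundary circle carries the asymptotic
  directions, so that homogenized equations extend continuously to the closed disc.\<close>

definition to_disc :: "real^2 \<Rightarrow> real^2" where
  "to_disc x = (1 / (1 + norm x)) *\<^sub>R x"

definition from_disc :: "real^2 \<Rightarrow> real^2" where
  "from_disc z = (1 / (1 - norm z)) *\<^sub>R z"

lemma norm_to_disc: "1 - norm (to_disc x) = 1 / (1 + norm x)"
  using norm_ge_zero[of x] by (simp add: to_disc_def field_simps add_nonneg_eq_0_iff)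

lemma norm_to_disc_less: "norm (to_disc x) < 1"
proof -
  have "1 / (1 + norm x) > 0" using norm_ge_zero[of x] by (intro divide_pos_pos) linarith+
  then show ?thesis using norm_to_disc[of x] by linarith
qed

lemma from_to_disc [simp]: "from_disc (to_disc x) = x"
proof -
  have "1 + norm x \<noteq> 0" using norm_ge_zero[of x] by linarith
  then show ?thesis by (simp add: from_disc_def norm_to_disc) (simp add: to_disc_def)
qed

lemma to_from_disc:
  assumes "norm z < 1"
  shows "to_disc (from_disc z) = z"
proof -
  have "norm (from_disc z) = norm z / (1 - norm z)" using assms by (simp add: from_disc_def)
  then have "1 + norm (from_disc z) = 1 / (1 - norm z)" using assms by (simp add: field_simps)
  then show ?thesis using assms by (simp add: to_disc_def) (simp add: from_disc_def)
qed

lemma continuous_on_to_disc [continuous_intros]: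
  "continuous_on S g \<Longrightarrow> continuous_on S (\<lambda>x. to_disc (g x))"
  unfolding to_disc_def
  by (intro continuous_intros) (auto simp: add_nonneg_eq_0_iff)

context
  fixes f1 f2 :: "real poly poly" and b :: "real^2" and F :: "real^2 \<Rightarrow> real poly poly" and K :: "real^2 \<Rightarrow> (real^2) set"
  defines "F \<equiv> \<lambda>r. f1 * const2 (eval2 f2 r) - f2 * const2 (eval2 f1 r)"
    and "K \<equiv> \<lambda>r. {x. eval2 (F r) x = 0}"
  assumes deg: "tdeg f2 < tdeg f1"
    and inf: "\<And>u. u \<noteq> 0 \<Longrightarrow> eval2 (leading_form f1) u = 0 \<Longrightarrow> gradient2 (leading_form f1) u \<noteq> 0"
    and f2b: "eval2 f2 b \<noteq> 0"
    and smooth: "\<And>x. eval2 (F b) x = 0 \<Longrightarrow> gradient2 (F b) x \<noteq> 0"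
begin

lemma eval2_F: "eval2 (F r) x = eval2 f1 x * eval2 f2 r - eval2 f2 x * eval2 f1 r"
  by (simp only: F_def eval2_simps)

lemma slope_F: "slope (F r) x v = slope f1 x v * eval2 f2 r - slope f2 x v * eval2 f1 r"
  by (simp only: F_def slope_def pd_diff pd_mult pd_const eval2_simps) (simp add: algebra_simps)

lemma closed_K: "closed (K r)"
  unfolding K_def by (intro closed_Collect_eq continuous_intros)

text \<open>In the frame of the gradient at \<open>p\<close> and its perpendicular, the curves near
  \<open>p\<close> are graphs, in one box for all nearby \<open>r\<close>. So they are connected
  there, and they come arbitrarily close to \<open>p\<close>.\<close>

lemma local_chart:
  assumes p: "p \<in> K b" and e: "e > 0"
  shows "\<exists>\<rho>>0. \<exists>\<delta>>0. \<forall>r. dist r b < \<delta> \<longrightarrow>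
    (\<forall>x y. x \<in> K r \<inter> ball p \<rho> \<longrightarrow> y \<in> K r \<inter> ball p \<rho> \<longrightarrow> connected_component (K r) x y)
    \<and> (\<exists>x\<in>K r. dist x p < e)"
proof -
  define v where "v = gradient2 (F b) p"
  have v: "v \<noteq> 0" using smooth p by (simp add: v_def K_def)
  define w where "w = perp v"
  have nv: "norm v > 0" "norm w = norm v" using v by (simp_all add: w_def)
  define Q where "Q h t = p + h *\<^sub>R w + t *\<^sub>R v" for h t
  define G where "G r h t = eval2 (F r) (Q h t)" for r h t
  define G' where "G' r h t = slope (F r) (Q h t) v" for r h t
  have "continuous_on UNIV (\<lambda>(r, h, t). G r h t)"
    unfolding G_def eval2_F Q_def case_prod_unfold by (intro continuous_intros)
  moreover have "continuous_on UNIV (\<lambda>(r, h, t). G' r h t)"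
    unfolding G'_def slope_F Q_def case_prod_unfold unfolding slope_def by (intro continuous_intros)
  moreover have "(G r h has_real_derivative G' r h t) (at t)" for r h t
    unfolding G_def G'_def Q_def by (rule DERIV_eval2_line)
  moreover have "G b 0 0 = 0" using p by (simp add: G_def Q_def K_def)
  moreover have "G' b 0 0 \<noteq> 0" using v by (simp add: G'_def Q_def slope_inner v_def)
  moreover have "e / (2 * norm v) > 0" using e nv by simp
  ultimately obtain \<kappa> \<eta> \<delta> where \<kappa>: "0 < \<kappa>" "\<kappa> < e / (2 * norm v)" "0 < \<eta>" "\<eta> < e / (2 * norm v)" "0 < \<delta>"
    and graph: "\<And>r I. dist r b < \<delta> \<Longrightarrow> connected I \<Longrightarrow> I \<subseteq> {-\<kappa>..\<kappa>} \<Longrightarrow>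
       connected {(h, t). h \<in> I \<and> -\<eta> \<le> t \<and> t \<le> \<eta> \<and> G r h t = 0}
       \<and> (\<forall>h\<in>I. \<exists>t. -\<eta> \<le> t \<and> t \<le> \<eta> \<and> G r h t = 0)"
    using implicit_zero_set[of G G' b "e / (2 * norm v)"] by blast
  \<comment> \<open>Both frame vectors have length \<open>norm v\<close>, so a point of this ball
    has both coordinates at most \<open>min \<kappa> \<eta>\<close> in absolute value.\<close>
  define \<rho> where "\<rho> = min \<kappa> \<eta> * norm v"
  show ?thesis
  proof (rule exI[of _ \<rho>], rule conjI[OF _ exI[of _ \<delta>]], goal_cases)
    case 1
    show ?case using \<kappa> nv by (auto simp: \<rho>_def)
  next
    case 2
    show ?case
    proof (intro conjI allI impI)
      show "\<delta> > 0" by (rule \<kappa>(5))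
      fix r assume r: "dist r b < \<delta>"
      define Z where "Z = {(h, t). h \<in> {-\<kappa>..\<kappa>} \<and> -\<eta> \<le> t \<and> t \<le> \<eta> \<and> G r h t = 0}"
      have Z: "connected Z" using graph[OF r, of "{-\<kappa>..\<kappa>}"] by (simp add: Z_def)
      have "connected ((\<lambda>(h, t). Q h t) ` Z)"
        unfolding Q_def case_prod_unfold by (intro connected_continuous_image continuous_intros Z)
      moreover have "(\<lambda>(h, t). Q h t) ` Z \<subseteq> K r" by (auto simp: Z_def K_def G_def)
      moreover have cover: "x \<in> (\<lambda>(h, t). Q h t) ` Z" if x: "x \<in> K r \<inter> ball p \<rho>" for x
      proof -
        define h t where "h = ((x - p) \<bullet> w) / (v \<bullet> v)" and "t = ((x - p) \<bullet> v) / (v \<bullet> v)"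
        have Q: "Q h t = x" using perp_expansion[OF v, of "x - p"] by (simp add: Q_def h_def t_def w_def algebra_simps)
        have d: "norm (x - p) \<le> \<rho>" using x by (simp add: dist_norm norm_minus_commute)
        have bound: "\<bar>((x - p) \<bullet> a) / (v \<bullet> v)\<bar> \<le> \<rho> / norm v" if "norm a = norm v" for a
        proof -
          have "\<bar>(x - p) \<bullet> a\<bar> \<le> norm (x - p) * norm v" using Cauchy_Schwarz_ineq2[of "x - p" a] that by simp
          also have "\<dots> \<le> \<rho> * norm v" using d nv by simp
          finally show ?thesis using nv by (simp add: dot_square_norm power2_eq_square field_simps)
        qed
        have "\<rho> / norm v = min \<kappa> \<eta>" using nv by (simp add: \<rho>_def)
        then have "\<bar>h\<bar> \<le> min \<kappa> \<eta>" "\<bar>t\<bar> \<le> min \<kappa> \<eta>" using bound nv by (simp_all add: h_def t_def)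
        then have "(h, t) \<in> Z" using x Q by (auto simp: Z_def G_def K_def)
        then show ?thesis using Q by (auto intro!: image_eqI[of _ _ "(h, t)"])
      qed
      ultimately show "x \<in> K r \<inter> ball p \<rho> \<Longrightarrow> y \<in> K r \<inter> ball p \<rho> \<Longrightarrow> connected_component (K r) x y" for x y
        unfolding connected_component_def by blast
      obtain t where t: "-\<eta> \<le> t" "t \<le> \<eta>" "G r 0 t = 0" using graph[OF r, of "{0}"] \<kappa> by auto
      have "dist (Q 0 t) p = \<bar>t\<bar> * norm v" by (simp add: Q_def dist_norm)
      also have "\<dots> \<le> \<eta> * norm v" using t by (intro mult_right_mono) auto
      also have "\<dots> < e" using \<kappa>(4) nv e by (simp add: field_simps)
      finally show "\<exists>x\<in>K r. dist x p < e" using t by (intro bexI[of _ "Q 0 t"]) (auto simp: K_def G_def)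
    qed
  qed
qed

text \<open>The equation of \<open>K r\<close>, homogenized in degree d_1 and carried to the closed
  disc. As f_2 has lower degree, only the leading form of f_1, scaled by f_2(r), is left on the
  circle.\<close>

definition \<Phi> :: "real^2 \<Rightarrow> real^2 \<Rightarrow> real" where
  "\<Phi> r z = eval2 f2 r * heval (tdeg f1) f1 z (1 - norm z) - eval2 f1 r * heval (tdeg f1) f2 z (1 - norm z)"

lemma \<Phi>_interior:
  assumes "norm z < 1"
  shows "\<Phi> r z = (1 - norm z) ^ tdeg f1 * eval2 (F r) (from_disc z)"
  using assms deg by (simp add: \<Phi>_def heval_nonzero eval2_F from_disc_def algebra_simps)

lemma \<Phi>_interior_iff: "norm z < 1 \<Longrightarrow> \<Phi> r z = 0 \<longleftrightarrow> from_disc z \<in> K r"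
  by (simp add: \<Phi>_interior K_def)

lemma \<Phi>_boundary: "norm z = 1 \<Longrightarrow> \<Phi> r z = eval2 f2 r * eval2 (leading_form f1) z"
  using deg by (simp add: \<Phi>_def heval_0 hom_part_eq_0 leading_form_def)

lemma continuous_on_\<Phi>: "continuous_on S g \<Longrightarrow> continuous_on S h \<Longrightarrow> continuous_on S (\<lambda>x. \<Phi> (g x) (h x))"
  unfolding \<Phi>_def by (intro continuous_intros)

text \<open>The chart at infinity is s = 1 / (x . u), m = (x . w) / (x . u). The leading form has a
  simple zero at \<open>u\<close>, so the homogenized curve is a graph over s, and its half s > 0 is
  the only end of \<open>K b\<close> in the direction \<open>u\<close>.\<close>

lemma end_chart:
  assumes u: "norm u = 1" "eval2 (leading_form f1) u = 0" and e: "e > 0"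
  shows "\<exists>N. open N \<and> u \<in> N
    \<and> (\<forall>x y. x \<in> K b \<longrightarrow> y \<in> K b \<longrightarrow> to_disc x \<in> N \<longrightarrow> to_disc y \<in> N \<longrightarrow> connected_component (K b) x y)
    \<and> (\<exists>x\<in>K b. dist (to_disc x) u < e)"
proof -
  define d where "d = tdeg f1"
  define w where "w = perp u"
  define y where "y m = u + m *\<^sub>R w" for m
  \<comment> \<open>The parameter \<open>r\<close> is a dummy: only the fixed curve
    \<open>K b\<close> is described near infinity.\<close>
  define G where "G (r::real) s m = eval2 f2 b * heval d f1 (y m) s - eval2 f1 b * heval d f2 (y m) s" for r s m
  define G' where "G' (r::real) s m = eval2 f2 b * (\<Sum>k\<le>d. s ^ (d - k) * slope (hom_part k f1) (y m) w)
      - eval2 f1 b * (\<Sum>k\<le>d. s ^ (d - k) * slope (hom_part k f2) (y m) w)" for r s m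
  have uu: "u \<bullet> u = 1" using u(1) by (simp add: dot_square_norm)
  then have u0: "u \<noteq> 0" by auto
  have disc_eq: "to_disc ((1 / s) *\<^sub>R y m) = (1 / (s + norm (y m))) *\<^sub>R y m" if "s > 0" for s m
  proof -
    have "1 + norm (y m) / s = (s + norm (y m)) / s" using that by (simp add: field_simps)
    then show ?thesis using that by (simp add: to_disc_def)
  qed
  have "isCont (\<lambda>(s, m). (1 / (s + norm (y m))) *\<^sub>R y m) (0, 0)"
    unfolding y_def case_prod_unfold using u by (intro continuous_intros) auto
  then obtain e' where e': "e' > 0"
    "\<And>s m. dist (s, m) (0, 0) < e' \<Longrightarrow> dist ((1 / (s + norm (y m))) *\<^sub>R y m) u < e"
    using e u unfolding continuous_at_eps_delta by (force simp: y_def)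
  have "continuous_on UNIV (\<lambda>(r, s, m). G r s m)"
    unfolding G_def y_def case_prod_unfold by (intro continuous_intros)
  moreover have "continuous_on UNIV (\<lambda>(r, s, m). G' r s m)"
    unfolding G'_def y_def case_prod_unfold slope_def by (intro continuous_intros)
  moreover have "(G r s has_real_derivative G' r s m) (at m)" for r s m
    unfolding G_def G'_def y_def heval_def
    by (intro DERIV_diff DERIV_cmult DERIV_sum DERIV_eval2_line)
  moreover have "G 0 0 0 = 0"
    using u deg by (simp add: G_def y_def heval_0 hom_part_eq_0 d_def leading_form_def)
  moreover have "G' 0 0 0 \<noteq> 0"
  proof -
    have delta: "(\<Sum>k\<le>d. 0 ^ (d - k) * a k) = a d" for a :: "nat \<Rightarrow> real"
    proof -
      have "(\<Sum>k\<le>d. 0 ^ (d - k) * a k) = (\<Sum>k\<le>d. if k = d then a d else 0)"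
        by (intro sum.cong) (auto simp: power_0_left)
      then show ?thesis by simp
    qed
    have "slope (leading_form f1) u w \<noteq> 0"
    proof
      assume 0: "slope (leading_form f1) u w = 0"
      have "slope (leading_form f1) u u = 0"
        using u(2) unfolding leading_form_def by (rule slope_hom_part_radial)
      with 0 have "gradient2 (leading_form f1) u = 0"
        using perp_expansion[OF u0, of "gradient2 (leading_form f1) u"] by (simp add: slope_inner w_def)
      then show False using inf[OF u0 u(2)] by simp
    qed
    moreover have "hom_part d f1 = leading_form f1" "hom_part d f2 = 0"
      using deg by (simp_all add: d_def leading_form_def hom_part_eq_0)
    ultimately show ?thesis using f2b by (simp add: G'_def delta y_def slope_def[of 0])
  qed
  moreover have "e' / 2 > 0" using e' by simp
  ultimately obtain \<kappa> \<eta> \<delta> where \<kappa>: "0 < \<kappa>" "\<kappa> < e' / 2" "0 < \<eta>" "\<eta> < e' / 2" "0 < \<delta>"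
    and graph: "\<And>r I. dist r 0 < \<delta> \<Longrightarrow> connected I \<Longrightarrow> I \<subseteq> {-\<kappa>..\<kappa>} \<Longrightarrow>
       connected {(s, m). s \<in> I \<and> -\<eta> \<le> m \<and> m \<le> \<eta> \<and> G r s m = 0}
       \<and> (\<forall>s\<in>I. \<exists>m. -\<eta> \<le> m \<and> m \<le> \<eta> \<and> G r s m = 0)"
    using implicit_zero_set[of G G' 0 "e' / 2"] by blast
  have G_iff: "G 0 s m = 0 \<longleftrightarrow> (1 / s) *\<^sub>R y m \<in> K b" if "s > 0" for s m
  proof -
    have "G 0 s m = s ^ d * eval2 (F b) ((1 / s) *\<^sub>R y m)"
      using that deg by (simp add: G_def heval_nonzero d_def eval2_F algebra_simps)
    then show ?thesis using that by (simp add: K_def)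
  qed
  \<comment> \<open>These are the conditions x . u > 0, |m| < \<eta> and s < \<kappa>, written in
    terms of the image of x in the disc.\<close>
  define N where "N = {z. 0 < z \<bullet> u \<and> \<bar>z \<bullet> w\<bar> < \<eta> * (z \<bullet> u) \<and> 1 - norm z < \<kappa> * (z \<bullet> u)}"
  define Z where "Z = {(s, m). s \<in> {0<..\<kappa>} \<and> -\<eta> \<le> m \<and> m \<le> \<eta> \<and> G 0 s m = 0}"
  have Z: "connected Z" using graph[of 0 "{0<..\<kappa>}"] \<kappa> by (simp add: Z_def subset_iff)
  show ?thesis
  proof (intro exI[of _ N] conjI allI impI)
    show "open N" unfolding N_def
      by (intro open_Collect_conj open_Collect_less continuous_intros)
    show "u \<in> N" using u \<kappa> by (simp add: N_def uu w_def)
    have "continuous_on Z (\<lambda>(s, m). (1 / s) *\<^sub>R y m)"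
      unfolding y_def case_prod_unfold by (intro continuous_intros) (auto simp: Z_def)
    then have "connected ((\<lambda>(s, m). (1 / s) *\<^sub>R y m) ` Z)"
      by (rule connected_continuous_image[OF _ Z])
    moreover have "(\<lambda>(s, m). (1 / s) *\<^sub>R y m) ` Z \<subseteq> K b" using G_iff by (auto simp: Z_def)
    moreover have "x \<in> (\<lambda>(s, m). (1 / s) *\<^sub>R y m) ` Z" if x: "x \<in> K b" "to_disc x \<in> N" for x
    proof -
      define l where "l = 1 + norm x"
      have l: "l > 0" using norm_ge_zero[of x] unfolding l_def by linarith
      have z: "to_disc x = (1 / l) *\<^sub>R x" "1 - norm (to_disc x) = 1 / l"
        by (simp_all add: norm_to_disc l_def) (simp add: to_disc_def)
      have N: "0 < x \<bullet> u" "\<bar>x \<bullet> w\<bar> < \<eta> * (x \<bullet> u)" "1 < \<kappa> * (x \<bullet> u)"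
        using x(2) l unfolding N_def mem_Collect_eq z(2) unfolding z(1)
        by (simp_all add: field_simps abs_mult zero_less_divide_iff)
      define s m where "s = 1 / (x \<bullet> u)" and "m = (x \<bullet> w) / (x \<bullet> u)"
      have s: "0 < s" "s \<le> \<kappa>" using N by (simp_all add: s_def field_simps)
      have m: "\<bar>m\<bar> \<le> \<eta>" using N by (simp add: m_def abs_mult field_simps)
      have "(1 / s) *\<^sub>R y m = (x \<bullet> u) *\<^sub>R u + (x \<bullet> w) *\<^sub>R w"
        using N by (simp add: s_def m_def y_def scaleR_add_right)
      then have eq: "(1 / s) *\<^sub>R y m = x"
        using perp_expansion[OF u0, of x] by (simp add: uu w_def add.commute)
      then have "(s, m) \<in> Z" using s m x G_iff[OF s(1), of m] by (auto simp: Z_def)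
      then show ?thesis using eq by (auto intro!: image_eqI[of _ _ "(s, m)"])
    qed
    ultimately show "x \<in> K b \<Longrightarrow> x' \<in> K b \<Longrightarrow> to_disc x \<in> N \<Longrightarrow> to_disc x' \<in> N \<Longrightarrow> connected_component (K b) x x'" for x x'
      unfolding connected_component_def by blast
    obtain m where m: "-\<eta> \<le> m" "m \<le> \<eta>" "G 0 \<kappa> m = 0" using graph[of 0 "{\<kappa>}"] \<kappa> by auto
    have "dist (\<kappa>, m) (0, 0) \<le> dist \<kappa> 0 + dist m 0"
      unfolding dist_Pair_Pair by (rule sqrt_sum_squares_le_sum) auto
    also have "\<dots> < e'" using \<kappa> m by (auto simp: dist_real_def)
    finally have "dist (to_disc ((1 / \<kappa>) *\<^sub>R y m)) u < e" using e'(2) \<kappa> by (simp add: disc_eq)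
    then show "\<exists>x\<in>K b. dist (to_disc x) u < e"
      using m G_iff[OF \<kappa>(1), of m] by (intro bexI[of _ "(1 / \<kappa>) *\<^sub>R y m"]) auto
  qed
qed

lemma self_in_K: "r \<in> K r"
  by (simp add: K_def eval2_F)

text \<open>The property \<open>P p\<close>, that all points of nearby curves close to
  \<open>p\<close> are joined to their parameter \<open>r\<close>, holds at \<open>b\<close> and
  spreads along the connected component because the charts are uniform in \<open>r\<close>.\<close>

lemma component_persists:
  assumes v: "\<And>r. v \<in> K r" and conn: "connected_component (K b) b v"
  shows "\<exists>\<delta>>0. \<forall>r. dist r b < \<delta> \<longrightarrow> connected_component (K r) r v"
proof -
  define A where "A = connected_component_set (K b) b"
  define P where "P p \<longleftrightarrow> (\<exists>\<epsilon>>0. \<forall>r x. dist r b < \<epsilon> \<longrightarrow> x \<in> K r \<longrightarrow> dist x p < \<epsilon> \<longrightarrow> connected_component (K r) r x)" for p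
  have AK: "A \<subseteq> K b" unfolding A_def by (rule connected_component_subset)
  have "P v"
  proof (rule connected_induction_simple[of A b v P])
    show "connected A" "b \<in> A" "v \<in> A" using conn self_in_K by (auto simp: A_def)
    show "P b"
    proof -
      from local_chart[OF self_in_K zero_less_one]
      obtain \<rho> \<delta> where \<rho>: "\<rho> > 0" "\<delta> > 0"
        "\<And>r x y. dist r b < \<delta> \<Longrightarrow> x \<in> K r \<inter> ball b \<rho> \<Longrightarrow> y \<in> K r \<inter> ball b \<rho> \<Longrightarrow> connected_component (K r) x y"
        by blast
      have "connected_component (K r) r x" if "dist r b < min \<rho> \<delta>" "x \<in> K r" "dist x b < min \<rho> \<delta>" for r x
        using that self_in_K by (intro \<rho>(3)) (auto simp: dist_commute)
      then show ?thesis using \<rho>(1,2) unfolding P_def by (intro exI[of _ "min \<rho> \<delta>"]) auto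
    qed
    fix p assume p: "p \<in> A"
    from local_chart[OF subsetD[OF AK p] zero_less_one]
    obtain \<rho> \<delta> where \<rho>: "\<rho> > 0" "\<delta> > 0"
      "\<And>r x y. dist r b < \<delta> \<Longrightarrow> x \<in> K r \<inter> ball p \<rho> \<Longrightarrow> y \<in> K r \<inter> ball p \<rho> \<Longrightarrow> connected_component (K r) x y"
      by blast
    have step: "P y" if x: "x \<in> A \<inter> ball p \<rho>" and y: "y \<in> A \<inter> ball p \<rho>" and Px: "P x" for x y
    proof -
      obtain \<epsilon> where \<epsilon>: "\<epsilon> > 0"
        "\<And>r z. dist r b < \<epsilon> \<Longrightarrow> z \<in> K r \<Longrightarrow> dist z x < \<epsilon> \<Longrightarrow> connected_component (K r) r z"
        using Px unfolding P_def by blast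
      \<comment> \<open>Within this distance of \<open>x\<close> a point of a nearby curve both is
        joined to \<open>r\<close> and lies in the chart around \<open>p\<close>, where it can be
        joined to the points near \<open>y\<close>.\<close>
      define e where "e = min \<epsilon> (\<rho> - dist p x)"
      have e: "e > 0" using \<epsilon>(1) x by (simp add: e_def)
      have "x \<in> K b" using x AK by blast
      from local_chart[OF this e]
      obtain \<delta>' where \<delta>': "\<delta>' > 0" "\<And>r. dist r b < \<delta>' \<Longrightarrow> \<exists>z\<in>K r. dist z x < e"
        by blast
      define \<epsilon>' where "\<epsilon>' = min (min \<epsilon> \<delta>) (min \<delta>' (\<rho> - dist p y))"
      have "connected_component (K r) r z" if r: "dist r b < \<epsilon>'" and z: "z \<in> K r" "dist z y < \<epsilon>'" for r z
      proof -
        obtain z' where z': "z' \<in> K r" "dist z' x < e" using \<delta>'(2) r by (auto simp: \<epsilon>'_def)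
        have "connected_component (K r) r z'" using \<epsilon>(2) r z' by (auto simp: \<epsilon>'_def e_def)
        moreover have "z' \<in> ball p \<rho>" "z \<in> ball p \<rho>"
          using z' z dist_triangle[of p z' x] dist_triangle[of p z y] by (auto simp: e_def \<epsilon>'_def dist_commute)
        then have "connected_component (K r) z' z" using z' z r by (intro \<rho>(3)) (auto simp: \<epsilon>'_def)
        ultimately show ?thesis by (rule connected_component_trans)
      qed
      moreover have "\<epsilon>' > 0" using \<epsilon> \<delta>' \<rho> y by (simp add: \<epsilon>'_def)
      ultimately show ?thesis unfolding P_def by blast
    qed
    show "\<exists>T. openin (top_of_set A) T \<and> p \<in> T \<and> (\<forall>x\<in>T. \<forall>y\<in>T. P x \<longrightarrow> P y)"
    proof (intro exI conjI ballI impI)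
      show "openin (top_of_set A) (A \<inter> ball p \<rho>)" by (intro openin_open_Int open_ball)
      show "p \<in> A \<inter> ball p \<rho>" using p \<rho>(1) by simp
    qed (rule step)
  qed
  then obtain \<epsilon> where "\<epsilon> > 0"
    "\<And>r x. dist r b < \<epsilon> \<Longrightarrow> x \<in> K r \<Longrightarrow> dist x v < \<epsilon> \<Longrightarrow> connected_component (K r) r x"
    unfolding P_def by blast
  then show ?thesis using v by (intro exI[of _ \<epsilon>]) auto
qed

text \<open>
  A component of \<open>K b\<close> and the rest of \<open>K b\<close> have disjoint closures in the disc, so the points
  equidistant from both closures form a compact set that nearby curves do not meet.
\<close>

lemma component_separation_persists:
  assumes v: "\<And>r. v \<in> K r" and nconn: "\<not> connected_component (K b) b v"
  shows "\<exists>\<delta>>0. \<forall>r. dist r b < \<delta> \<longrightarrow> \<not> connected_component (K r) r v"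
proof -
  define A where "A = connected_component_set (K b) b"
  define A' where "A' = K b - A"
  have AK: "A \<subseteq> K b" unfolding A_def by (rule connected_component_subset)
  have bv: "b \<in> A" "v \<in> A'" using self_in_K v nconn by (auto simp: A_def A'_def)
  have same: "y \<in> A" if "x \<in> A" "connected_component (K b) x y" for x y
    using that by (auto simp: A_def intro: connected_component_trans)
  have clA: "closed A" unfolding A_def by (rule closed_connected_component[OF closed_K])
  \<comment> \<open>The charts show that \<open>A\<close> is open in \<open>K b\<close>, so the rest
    of the curve is closed as well.\<close>
  have "\<exists>\<rho>>0. K b \<inter> ball p \<rho> \<subseteq> A" if p: "p \<in> A" for p
  proof -
    from local_chart[OF subsetD[OF AK p] zero_less_one]
    obtain \<rho> \<delta> where \<rho>: "\<rho> > 0" and \<delta>: "\<delta> > 0"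
      "\<And>r x y. dist r b < \<delta> \<Longrightarrow> x \<in> K r \<inter> ball p \<rho> \<Longrightarrow> y \<in> K r \<inter> ball p \<rho> \<Longrightarrow> connected_component (K r) x y"
      by blast
    then have "K b \<inter> ball p \<rho> \<subseteq> A" using same[OF p] \<delta>(2)[of b p] \<delta>(1) p AK \<rho> by auto
    then show ?thesis using \<rho>(1) by blast
  qed
  then obtain \<rho> where \<rho>: "\<And>p. p \<in> A \<Longrightarrow> \<rho> p > 0" "\<And>p. p \<in> A \<Longrightarrow> K b \<inter> ball p (\<rho> p) \<subseteq> A" by metis
  have "A' = K b - (\<Union>p\<in>A. ball p (\<rho> p))" using \<rho> by (force simp: A'_def)
  then have clA': "closed A'" using closed_K by auto
  define C where "C = closure (to_disc ` A)"
  define C' where "C' = closure (to_disc ` A')"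
  have cball: "closure (to_disc ` X) \<subseteq> cball 0 1" for X
    using norm_to_disc_less by (intro closure_minimal) (auto simp: less_imp_le)
  have interior: "from_disc z \<in> X" if z: "z \<in> closure (to_disc ` X)" "norm z < 1" and X: "closed X" for X z
  proof -
    have "continuous_on {z. norm z < 1} from_disc"
      unfolding from_disc_def by (intro continuous_intros) auto
    moreover have "open {z :: real^2. norm z < 1}" by (intro open_Collect_less continuous_intros)
    ultimately have cont: "isCont from_disc z" using z(2) by (simp add: continuous_on_eq_continuous_at)
    from z(1) obtain a where a: "\<And>n. a n \<in> to_disc ` X" "a \<longlonglongrightarrow> z" unfolding closure_sequential by blast
    have "(\<lambda>n. from_disc (a n)) \<longlonglongrightarrow> from_disc z" using cont a(2) by (rule isCont_tendsto_compose)
    moreover have "from_disc (a n) \<in> X" for n using a(1)[of n] by auto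
    ultimately show ?thesis using closed_sequentially[OF X, of "\<lambda>n. from_disc (a n)"] by simp
  qed
  have \<Phi>_closure: "\<Phi> b z = 0" if "z \<in> closure (to_disc ` K b)" for z
  proof -
    have "closed {z. \<Phi> b z = 0}" by (intro closed_Collect_eq continuous_on_\<Phi> continuous_intros)
    moreover have "to_disc ` K b \<subseteq> {z. \<Phi> b z = 0}"
      using norm_to_disc_less by (auto simp: \<Phi>_interior_iff)
    ultimately show ?thesis using that closure_minimal[of "to_disc ` K b" "{z. \<Phi> b z = 0}"] by auto
  qed
  have boundary: "eval2 (leading_form f1) z = 0" if "\<Phi> b z = 0" "norm z = 1" for z
    using that f2b by (simp add: \<Phi>_boundary)
  \<comment> \<open>Inside the disc the closures add nothing, and on the circle a common limit would
    have points of both parts in one end, which is connected.\<close>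
  have disj: "C \<inter> C' = {}"
  proof (rule ccontr)
    assume "C \<inter> C' \<noteq> {}"
    then obtain z where z: "z \<in> C" "z \<in> C'" by blast
    then have "norm z \<le> 1" using cball[of A] by (auto simp: C_def)
    then consider "norm z < 1" | "norm z = 1" by linarith
    then show False
    proof cases
      case 1
      then have "from_disc z \<in> A" "from_disc z \<in> A'" using interior z clA clA' by (auto simp: C_def C'_def)
      then show False by (simp add: A'_def)
    next
      case 2
      have "z \<in> closure (to_disc ` K b)"
        using z(1) closure_mono[OF image_mono[OF AK]] by (auto simp: C_def)
      then have "eval2 (leading_form f1) z = 0" using boundary \<Phi>_closure 2 by blast
      from end_chart[OF 2 this zero_less_one] obtain N where N: "open N" "z \<in> N"
        "\<And>x y. x \<in> K b \<Longrightarrow> y \<in> K b \<Longrightarrow> to_disc x \<in> N \<Longrightarrow> to_disc y \<in> N \<Longrightarrow> connected_component (K b) x y"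
        by blast
      obtain x where x: "x \<in> A" "to_disc x \<in> N"
        using z(1) N(1,2) unfolding C_def closure_iff_nhds_not_empty by blast
      obtain y where y: "y \<in> A'" "to_disc y \<in> N"
        using z(2) N(1,2) unfolding C'_def closure_iff_nhds_not_empty by blast
      have "y \<in> A" using same[OF x(1) N(3)] x y AK by (auto simp: A'_def)
      then show False using y by (simp add: A'_def)
    qed
  qed
  have ne: "C \<noteq> {}" "C' \<noteq> {}" "closed C" "closed C'" using bv by (auto simp: C_def C'_def)
  \<comment> \<open>A continuous function that is negative on \<open>C\<close> and positive on
    \<open>C'\<close>; its zeros form the separating set.\<close>
  define g where "g z = infdist z C - infdist z C'" for z
  have g_cont: "continuous_on S g" for S
    unfolding g_def by (intro continuous_intros)
  have gC: "g z < 0" if "z \<in> C" for z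
    using that disj infdist_pos_not_in_closed[of C' z] ne by (auto simp: g_def)
  have gC': "g z > 0" if "z \<in> C'" for z
    using that disj infdist_pos_not_in_closed[of C z] ne by (auto simp: g_def)
  define T where "T = cball 0 1 \<inter> {z. g z = 0}"
  have compT: "compact T" unfolding T_def
    by (intro compact_Int_closed compact_cball closed_Collect_eq g_cont continuous_on_const)
  \<comment> \<open>Every zero of \<open>\<Phi> b\<close> in the closed disc lies in
    \<open>C\<close> or \<open>C'\<close>. On the circle this holds because each asymptotic
    direction is a limit of points of the curve.\<close>
  have T: "\<Phi> b z \<noteq> 0" if z: "z \<in> T" for z
  proof
    assume 0: "\<Phi> b z = 0"
    have "z \<in> C \<union> C'"
    proof (cases "norm z < 1")
      case True
      then have "from_disc z \<in> A \<union> A'" using 0 by (simp add: \<Phi>_interior_iff A'_def)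
      then have "to_disc (from_disc z) \<in> to_disc ` A \<union> to_disc ` A'" by blast
      then have "z \<in> to_disc ` A \<union> to_disc ` A'" by (simp only: to_from_disc[OF True])
      then show ?thesis
        using closure_subset[of "to_disc ` A"] closure_subset[of "to_disc ` A'"] by (auto simp: C_def C'_def)
    next
      case False
      then have n: "norm z = 1" using z by (simp add: T_def)
      have "\<exists>y\<in>to_disc ` K b. dist y z < e" if "e > 0" for e
        using end_chart[OF n boundary[OF 0 n] that] by blast
      then have "z \<in> closure (to_disc ` K b)" unfolding closure_approachable by blast
      moreover have "K b = A \<union> A'" using AK by (auto simp: A'_def)
      ultimately show ?thesis by (simp add: C_def C'_def image_Un)
    qed
    then have "g z \<noteq> 0" using gC gC' by fastforce
    then show False using z by (simp add: T_def)
  qed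
  \<comment> \<open>By the tube lemma, since \<open>T\<close> is compact.\<close>
  have "\<exists>\<delta>>0. \<forall>r z. dist r b < \<delta> \<longrightarrow> z \<in> T \<longrightarrow> \<Phi> r z \<noteq> 0"
  proof -
    have "openin euclidean {(r, z). \<Phi> r z \<noteq> 0}"
      unfolding case_prod_unfold open_openin[symmetric]
      by (intro open_Collect_neq continuous_on_\<Phi> continuous_intros)
    then have op: "openin (prod_topology euclidean euclidean) {(r, z). \<Phi> r z \<noteq> 0}" by simp
    have "\<exists>U V. openin euclidean U \<and> openin euclidean V \<and> b \<in> U \<and> T \<subseteq> V \<and> U \<times> V \<subseteq> {(r, z). \<Phi> r z \<noteq> 0}"
      by (rule tube_lemma_right[OF op]) (use compT T in auto)
    then obtain U V where UV: "open U" "b \<in> U" "T \<subseteq> V" "U \<times> V \<subseteq> {(r, z). \<Phi> r z \<noteq> 0}" by auto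
    then obtain \<delta> where "\<delta> > 0" "ball b \<delta> \<subseteq> U" using openE by blast
    then show ?thesis using UV by (intro exI[of _ \<delta>]) (auto simp: dist_commute subset_iff)
  qed
  then obtain \<delta>1 where \<delta>1: "\<delta>1 > 0" "\<And>r z. dist r b < \<delta>1 \<Longrightarrow> z \<in> T \<Longrightarrow> \<Phi> r z \<noteq> 0" by blast
  have "open {r. g (to_disc r) < 0}"
    by (intro open_Collect_less continuous_on_compose2[OF g_cont[of UNIV]] continuous_intros) auto
  moreover have "g (to_disc b) < 0"
    using bv(1) closure_subset[of "to_disc ` A"] by (intro gC) (auto simp: C_def)
  ultimately obtain \<delta>2 where \<delta>2: "\<delta>2 > 0" "ball b \<delta>2 \<subseteq> {r. g (to_disc r) < 0}" using openE by blast
  have "\<not> connected_component (K r) r v" if r: "dist r b < min \<delta>1 \<delta>2" for r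
  proof
    assume "connected_component (K r) r v"
    then obtain S where S: "connected S" "S \<subseteq> K r" "r \<in> S" "v \<in> S"
      unfolding connected_component_def by blast
    define h where "h x = g (to_disc x)" for x
    have "connected (h ` S)" unfolding h_def
      by (intro connected_continuous_image S(1) continuous_on_compose2[OF g_cont[of UNIV]] continuous_intros) auto
    moreover have "h r < 0" using \<delta>2(2) r by (auto simp: h_def dist_commute)
    moreover have "h v > 0" unfolding h_def using bv(2) closure_subset[of "to_disc ` A'"] by (intro gC') (auto simp: C'_def)
    \<comment> \<open>A connected set joining \<open>r\<close> to \<open>v\<close> would have to
      cross the separating set.\<close>
    ultimately have "0 \<in> h ` S"
      using connectedD_interval[of "h ` S" "h r" "h v" 0] S(3,4) by auto
    then obtain x where x: "x \<in> S" "g (to_disc x) = 0" by (auto simp: h_def)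
    have "to_disc x \<in> T" using x norm_to_disc_less[of x] by (simp add: T_def)
    moreover have "\<Phi> r (to_disc x) = 0" using x S(2) norm_to_disc_less by (auto simp: \<Phi>_interior_iff)
    ultimately show False using \<delta>1(2) r by auto
  qed
  then show ?thesis using \<delta>1(1) \<delta>2(1) by (intro exI[of _ "min \<delta>1 \<delta>2"]) auto
qed

lemma component_zeros_locally_constant:
  assumes V: "finite V" "\<And>v r. v \<in> V \<Longrightarrow> v \<in> K r"
  shows "\<exists>\<delta>>0. \<forall>r. dist r b < \<delta> \<longrightarrow> V \<inter> connected_component_set (K r) r = V \<inter> connected_component_set (K b) b"
proof -
  have "\<exists>\<delta>>0. \<forall>r. dist r b < \<delta> \<longrightarrow> (connected_component (K r) r v \<longleftrightarrow> connected_component (K b) b v)"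
    if v: "v \<in> V" for v
  proof (cases "connected_component (K b) b v")
    case True
    from component_persists[OF V(2)[OF v] True] show ?thesis using True by simp
  next
    case False
    from component_separation_persists[OF V(2)[OF v] False] show ?thesis using False by simp
  qed
  then obtain \<delta> where \<delta>: "\<And>v. v \<in> V \<Longrightarrow> \<delta> v > 0"
    "\<And>v r. v \<in> V \<Longrightarrow> dist r b < \<delta> v \<Longrightarrow> connected_component (K r) r v \<longleftrightarrow> connected_component (K b) b v"
    by metis
  have "V \<inter> connected_component_set (K r) r = V \<inter> connected_component_set (K b) b"
    if "dist r b < Min (insert 1 (\<delta> ` V))" for r
    using that V(1) \<delta>(2) by auto
  moreover have "Min (insert 1 (\<delta> ` V)) > 0" using V(1) \<delta>(1) by (subst Min_gr_iff) auto
  ultimately show ?thesis by blast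
qed

end

subsection \<open>Singular Newton curves\<close>

lemma pd_commute: "pd 1 (pd 2 p) = pd 2 (pd 1 (p :: 'a::idom poly poly))"
proof (rule poly_eqI)
  have "pderiv (of_nat n * q) = of_nat n * pderiv q" for n and q :: "'a poly"
    by (simp add: pderiv_mult)
  then show "coeff (pd 1 (pd 2 p)) n = coeff (pd 2 (pd 1 p)) n" for n
    by (simp add: pd_def coeff_map_poly coeff_pderiv del: of_nat_Suc)
qed

lemma complex_zero_exists:
  fixes h :: "complex poly poly"
  assumes "h \<noteq> 0" "\<not> is_unit h"
  shows "\<exists>x. eval2 h x = 0"
proof (cases "degree h = 0")
  case True
  then obtain q where q: "h = [:q:]" by (metis degree_eq_zeroE)
  have "degree q \<noteq> 0"
  proof
    assume "degree q = 0"
    then obtain a where "q = [:a:]" by (metis degree_eq_zeroE)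
    then show False using assms q by (auto simp: is_unit_const_poly_iff dvd_field_iff)
  qed
  then obtain a where "poly q a = 0"
    using fundamental_theorem_of_algebra[of q] by (auto simp: constant_degree)
  then show ?thesis by (intro exI[of _ "vector [a, 0]"]) (simp add: q eval2_def)
next
  case False
  \<comment> \<open>A value of x_1 is chosen that keeps the degree in x_2, so that the fundamental
    theorem of algebra applies on that vertical line.\<close>
  have "finite {a. poly (lead_coeff h) a = 0}" using assms(1) by (intro poly_roots_finite) simp
  then obtain a where a: "poly (lead_coeff h) a \<noteq> 0"
    using ex_new_if_finite[OF infinite_UNIV_char_0] by blast
  define q where "q = map_poly (\<lambda>p. poly p a) h"
  have "degree q = degree h" unfolding q_def using a by (intro map_poly_degree_eq) auto
  then obtain b where b: "poly q b = 0"
    using fundamental_theorem_of_algebra[of q] False by (auto simp: constant_degree)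
  have "poly (map_poly (\<lambda>p. poly p a) g) b = poly (poly g [:b:]) a" for g
    by (induction g) (simp_all add: map_poly_pCons)
  then show ?thesis using b by (intro exI[of _ "vector [a, b]"]) (simp add: q_def eval2_def)
qed

text \<open>At a zero of a common factor both gradients are multiples of the gradient of that
  factor.\<close>

lemma common_factor_gradients:
  assumes h: "h dvd G1" "h dvd G2" "eval2 h z = 0"
  shows "eval2 (pd 1 G1) z * eval2 (pd 2 G2) z - eval2 (pd 2 G1) z * eval2 (pd 1 G2) z = 0"
proof -
  obtain k1 k2 where "G1 = h * k1" "G2 = h * k2" using h by (auto simp: dvd_def)
  then show ?thesis using h(3) by (simp add: pd_mult)
qed

text \<open>Bezout's bound without multiplicities: the functionals are the evaluations, and products
  of linear polynomials separate the points.\<close>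

lemma card_zeros_le:
  fixes F G :: "'a::field_gcd poly poly"
  assumes "F \<noteq> 0" "G \<noteq> 0" "coprime F G" "finite Z" "\<And>z. z \<in> Z \<Longrightarrow> eval2 F z = 0 \<and> eval2 G z = 0"
  shows "card Z \<le> tdeg F * tdeg G"
proof -
  define l where "l z w = (if z $ 1 \<noteq> w $ 1 then X1 - const2 (w $ 1) else X2 - const2 (w $ 2))"
    for z w :: "'a^2"
  define g where "g z = (\<Prod>w\<in>Z - {z}. l z w)" for z
  have l: "eval2 (l z w) w = 0" "w \<noteq> z \<Longrightarrow> eval2 (l z w) z \<noteq> 0" for z w
    by (auto simp: l_def vec_eq_iff forall_2)
  show ?thesis
  proof (rule bezout_functionals[where lam = "\<lambda>z p. eval2 p z" and g = g and rk = "\<lambda>_. 0"])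
    show "eval2 (smult [:c:] p) z = c * eval2 p z" for c p and z :: "'a^2" by (simp add: eval2_def)
    show "eval2 (g z) z \<noteq> 0" if "z \<in> Z" for z using l assms(4) by (simp add: g_def eval2_prod)
    show "eval2 (g z) w = 0" if "z \<in> Z" "w \<in> Z" "z \<noteq> w" for z w
      using that l(1) assms(4) by (auto simp: g_def eval2_prod)
  qed (use assms in auto)
qed

lemma eval2_newton:
  "eval2 (newton_poly f r) x = eval2 (f $ 1) x * eval2 (f $ 2) r - eval2 (f $ 2) x * eval2 (f $ 1) r"
  by (simp only: newton_poly_def eval2_simps)

lemma pd_newton:
  "pd j (newton_poly f r) = pd j (f $ 1) * const2 (eval2 (f $ 2) r) - pd j (f $ 2) * const2 (eval2 (f $ 1) r)"
  by (simp only: newton_poly_def pd_diff pd_mult pd_const mult_zero_right mult_zero_left add_0 add_0_right mult.commute)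

lemma eval2_pd_newton:
  "eval2 (pd j (newton_poly f r)) x = eval2 (pd j (f $ 1)) x * eval2 (f $ 2) r - eval2 (pd j (f $ 2)) x * eval2 (f $ 1) r"
  by (simp only: pd_newton eval2_simps)

lemma eval2_pd2_newton:
  "eval2 (pd i (pd j (newton_poly f r))) x
    = eval2 (pd i (pd j (f $ 1))) x * eval2 (f $ 2) r - eval2 (pd i (pd j (f $ 2))) x * eval2 (f $ 1) r"
  by (simp only: pd_newton pd_diff pd_mult pd_const mult_zero_right mult_zero_left add_0 add_0_right mult.commute eval2_simps)

lemma singular_points_iff:
  "x \<in> singular_points p \<longleftrightarrow> eval2 p x = 0 \<and> eval2 (pd 1 p) x = 0 \<and> eval2 (pd 2 p) x = 0"
  by (auto simp: singular_points_def zeros_def gradient2_def vec_eq_iff forall_2)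

lemma common_zeros_iff: "x \<in> common_zeros f \<longleftrightarrow> eval2 (f $ 1) x = 0 \<and> eval2 (f $ 2) x = 0"
  by (auto simp: common_zeros_def eval_sys_def vec_eq_iff forall_2)

lemma sing_set_iff:
  "r \<in> sing_set f \<longleftrightarrow> r \<notin> common_zeros f \<and> r \<in> singular_points (newton_poly f r)"
  by (simp add: sing_set_def common_zeros_def)

text \<open>The expression is the discriminant of the quadratic part, which equals
  \<open>(a * d - b * c) ^ 2\<close> for the two tangents.\<close>

lemma ordinary_double_point_hessian:
  assumes "ordinary_double_point p x"
  shows "eval2 (pd 1 (pd 2 p)) x ^ 2 - eval2 (pd 1 (pd 1 p)) x * eval2 (pd 2 (pd 2 p)) x \<noteq> 0"
proof -
  define h11 h12 h22 where "h11 = eval2 (pd 1 (pd 1 p)) x" and "h12 = eval2 (pd 1 (pd 2 p)) x"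
    and "h22 = eval2 (pd 2 (pd 2 p)) x"
  obtain a b c d where nd: "a * d - b * c \<noteq> 0"
    and q: "\<And>u v. (h11 * u^2 + 2 * h12 * u * v + h22 * v^2) / 2 = (a * u + b * v) * (c * u + d * v)"
    using assms unfolding ordinary_double_point_def h11_def h12_def h22_def by blast
  have 1: "h11 = 2 * (a * c)" and 2: "h22 = 2 * (b * d)" using q[of 1 0] q[of 0 1] by (simp_all add: field_simps)
  have "h12 = a * d + b * c" using q[of 1 1] 1 2 by (simp add: field_simps)
  then have "h12 ^ 2 - h11 * h22 = (a * d - b * c) ^ 2"
    using 1 2 by (simp add: power2_eq_square algebra_simps)
  then show ?thesis using nd by (simp add: h11_def h12_def h22_def)
qed

lemma complexify_newton: "complexify (newton_poly f r) = newton_poly (complexify_sys f) (cvec r)"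
  by (simp only: newton_poly_def complexify_diff complexify_mult complexify_const complexify_sys_def
      vec_lambda_beta eval2_complexify)

lemma cvec_singular_points_iff: "cvec x \<in> singular_points (complexify p) \<longleftrightarrow> x \<in> singular_points p"
  by (simp add: singular_points_iff complexify_pd[symmetric] eval2_complexify)

lemma cvec_common_zeros_iff: "cvec x \<in> common_zeros (complexify_sys f) \<longleftrightarrow> x \<in> common_zeros f"
  by (simp add: common_zeros_iff complexify_sys_def eval2_complexify)

section \<open>The pencil of Newton curves of a generic system\<close>

context
  fixes f :: "real poly poly ^ 2"
  assumes gen: "generic f" and deg: "tdeg (f $ 2) < tdeg (f $ 1)" "0 < tdeg (f $ 2)"
begin

abbreviation "FC \<equiv> complexify_sys f"

lemma FC_nth: "FC $ j = complexify (f $ j)"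
  by (simp add: complexify_sys_def)

lemma FC_smooth: "x \<notin> singular_points (FC $ j)"
  using gen by (simp add: generic_def generic1_def FC_nth)

lemma FC_common:
  "finite (common_zeros FC)" "card (common_zeros FC) = tdeg (f $ 1) * tdeg (f $ 2)"
  using gen by (simp_all add: generic_def generic3_def Let_def)

lemma FC_jacobian:
  assumes "x \<in> common_zeros FC"
  shows "eval2 (pd 1 (FC $ 1)) x * eval2 (pd 2 (FC $ 2)) x - eval2 (pd 2 (FC $ 1)) x * eval2 (pd 1 (FC $ 2)) x \<noteq> 0"
  using gen assms by (simp add: generic_def generic3_def Let_def det_2 gradient2_def)

lemma FC_unique:
  assumes "r \<notin> common_zeros FC" "x \<in> singular_points (newton_poly FC r)" "y \<in> singular_points (newton_poly FC r)"
  shows "x = y"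
  using gen assms unfolding generic_def generic4_def Let_def by blast

lemma FC_double:
  assumes "r \<notin> common_zeros FC" "x \<in> singular_points (newton_poly FC r)"
  shows "ordinary_double_point (newton_poly FC r) x"
  using gen assms unfolding generic_def generic4_def Let_def by blast

lemma finite_common_zeros: "finite (common_zeros f)"
  and card_common_zeros: "card (common_zeros f) \<le> tdeg (f $ 1) * tdeg (f $ 2)"
proof -
  have inj: "inj_on cvec (common_zeros f)" by (simp add: inj_on_def)
  have sub: "cvec ` common_zeros f \<subseteq> common_zeros FC" by (auto simp: cvec_common_zeros_iff)
  show "finite (common_zeros f)" using finite_imageD[OF finite_subset[OF sub FC_common(1)] inj] .
  show "card (common_zeros f) \<le> tdeg (f $ 1) * tdeg (f $ 2)"
    using card_mono[OF FC_common(1) sub] FC_common(2) card_image[OF inj] by simp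
qed

lemma real_smooth: "x \<notin> singular_points (f $ j)"
  using FC_smooth[of "cvec x" j] by (simp add: FC_nth cvec_singular_points_iff)

lemma real_jacobian:
  assumes "x \<in> common_zeros f"
  shows "eval2 (pd 1 (f $ 1)) x * eval2 (pd 2 (f $ 2)) x - eval2 (pd 2 (f $ 1)) x * eval2 (pd 1 (f $ 2)) x \<noteq> 0"
proof -
  have "complex_of_real (eval2 (pd 1 (f $ 1)) x * eval2 (pd 2 (f $ 2)) x - eval2 (pd 2 (f $ 1)) x * eval2 (pd 1 (f $ 2)) x) \<noteq> 0"
    using FC_jacobian[of "cvec x"] assms
    by (simp add: cvec_common_zeros_iff FC_nth complexify_pd[symmetric] eval2_complexify)
  then show ?thesis by (simp only: of_real_eq_0_iff) simp
qed

text \<open>If f_2(r) = 0, then C_r is the smooth curve f_2 = 0.\<close>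

lemma sing_f2_nonzero:
  assumes "r \<in> sing_set f"
  shows "eval2 (f $ 2) r \<noteq> 0"
proof
  assume 0: "eval2 (f $ 2) r = 0"
  then have "eval2 (f $ 1) r \<noteq> 0" using assms by (simp add: sing_set_iff common_zeros_iff)
  then have "r \<in> singular_points (f $ 2)"
    using assms 0 by (simp add: sing_set_iff singular_points_iff eval2_pd_newton)
  then show False using real_smooth by blast
qed

text \<open>If \<open>x\<close> lies on C_r, the polynomials of C_r and C_x are proportional, so
  \<open>x\<close> and \<open>r\<close> are singular points of the same curve, which has at most
  one.\<close>

lemma sing_curve_unique:
  assumes r: "r \<in> sing_set f" and x: "x \<in> sing_set f" and on: "eval2 (newton_poly f r) x = 0"
  shows "x = r"
proof -
  have f2: "eval2 (f $ 2) x \<noteq> 0" "eval2 (f $ 2) r \<noteq> 0" using sing_f2_nonzero r x by auto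
  have on': "eval2 (f $ 1) x * eval2 (f $ 2) r = eval2 (f $ 2) x * eval2 (f $ 1) r"
    using on by (simp add: eval2_newton)
  have pd: "eval2 (pd j (newton_poly f r)) x = 0" if "eval2 (pd j (newton_poly f x)) x = 0" for j
  proof -
    have "eval2 (f $ 2) x * eval2 (pd j (newton_poly f r)) x
        = eval2 (f $ 2) r * eval2 (pd j (newton_poly f x)) x"
      unfolding eval2_pd_newton right_diff_distrib using on' by (simp add: algebra_simps)
    then show ?thesis using f2 that by simp
  qed
  have "x \<in> singular_points (newton_poly f r)"
    using x on pd by (simp add: sing_set_iff singular_points_iff)
  moreover have "r \<in> singular_points (newton_poly f r)" "r \<notin> common_zeros f" using r by (auto simp: sing_set_iff)
  ultimately have "cvec x = cvec r"
    using FC_unique[of "cvec r" "cvec x" "cvec r"]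
    by (simp add: cvec_common_zeros_iff cvec_singular_points_iff flip: complexify_newton)
  then show ?thesis by simp
qed

lemma newton_hessian:
  assumes "r \<in> sing_set f"
  shows "eval2 (pd 1 (pd 2 (newton_poly f r))) r ^ 2
    - eval2 (pd 1 (pd 1 (newton_poly f r))) r * eval2 (pd 2 (pd 2 (newton_poly f r))) r \<noteq> 0"
proof -
  have "ordinary_double_point (newton_poly FC (cvec r)) (cvec r)"
    using assms FC_double[of "cvec r" "cvec r"]
    by (simp add: sing_set_iff cvec_common_zeros_iff cvec_singular_points_iff flip: complexify_newton)
  from ordinary_double_point_hessian[OF this]
  have "complex_of_real (eval2 (pd 1 (pd 2 (newton_poly f r))) r ^ 2
    - eval2 (pd 1 (pd 1 (newton_poly f r))) r * eval2 (pd 2 (pd 2 (newton_poly f r))) r) \<noteq> 0"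
    by (simp add: eval2_complexify flip: complexify_newton complexify_pd)
  then show ?thesis by (simp only: of_real_eq_0_iff) simp
qed

text \<open>
  The singular points of the curves of the pencil, together with the base points, are the zeros of
  \<open>f\<^sub>2 \<nabla>f\<^sub>1 - f\<^sub>1 \<nabla>f\<^sub>2\<close>, and all these zeros are nondegenerate.
\<close>

definition crit :: "2 \<Rightarrow> complex poly poly" where
  "crit j = FC $ 2 * pd j (FC $ 1) - FC $ 1 * pd j (FC $ 2)"

lemma pd_crit:
  "eval2 (pd i (crit j)) z = eval2 (FC $ 2) z * eval2 (pd i (pd j (FC $ 1))) z - eval2 (FC $ 1) z * eval2 (pd i (pd j (FC $ 2))) z
    + (eval2 (pd i (FC $ 2)) z * eval2 (pd j (FC $ 1)) z - eval2 (pd i (FC $ 1)) z * eval2 (pd j (FC $ 2)) z)"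
  by (simp add: crit_def pd_diff pd_mult)

text \<open>At a root of the system the Jacobian matrix is antisymmetric with entries J and - J, J
  being the Jacobian of the system. At any other zero \<open>z\<close> it is the Hessian of the
  curve through \<open>z\<close>, which has an ordinary double point there.\<close>

lemma crit_nondegenerate:
  assumes z: "eval2 (crit 1) z = 0" "eval2 (crit 2) z = 0"
  shows "eval2 (pd 1 (crit 1)) z * eval2 (pd 2 (crit 2)) z - eval2 (pd 2 (crit 1)) z * eval2 (pd 1 (crit 2)) z \<noteq> 0"
proof (cases "z \<in> common_zeros FC")
  case True
  define J where "J = eval2 (pd 1 (FC $ 1)) z * eval2 (pd 2 (FC $ 2)) z - eval2 (pd 2 (FC $ 1)) z * eval2 (pd 1 (FC $ 2)) z"
  have "eval2 (pd 1 (crit 1)) z = 0" "eval2 (pd 1 (crit 2)) z = - J" "eval2 (pd 2 (crit 1)) z = J"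
    using True by (simp_all add: pd_crit common_zeros_iff J_def mult.commute)
  then show ?thesis using FC_jacobian[OF True] by (simp add: J_def)
next
  case False
  have e: "eval2 (FC $ 2) z * eval2 (pd j (FC $ 1)) z = eval2 (FC $ 1) z * eval2 (pd j (FC $ 2)) z" for j
    using z exhaust_2[of j] by (auto simp: crit_def)
  have f2: "eval2 (FC $ 2) z \<noteq> 0"
  proof
    assume 0: "eval2 (FC $ 2) z = 0"
    then have "eval2 (FC $ 1) z \<noteq> 0" using False by (simp add: common_zeros_iff)
    then have "z \<in> singular_points (FC $ 2)" using e 0 by (auto simp: singular_points_iff)
    then show False using FC_smooth by blast
  qed
  have "z \<in> singular_points (newton_poly FC z)"
    using e[of 1] e[of 2] by (simp add: singular_points_iff eval2_newton eval2_pd_newton mult.commute)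
  from ordinary_double_point_hessian[OF FC_double[OF False this]]
  have hess: "eval2 (pd 1 (pd 2 (newton_poly FC z))) z ^ 2
    - eval2 (pd 1 (pd 1 (newton_poly FC z))) z * eval2 (pd 2 (pd 2 (newton_poly FC z))) z \<noteq> 0" .
  \<comment> \<open>The gradients of f_1 and f_2 are parallel at \<open>z\<close>, so the products
    of first derivatives in \<open>pd_crit\<close> cancel.\<close>
  have par: "eval2 (pd i (FC $ 2)) z * eval2 (pd j (FC $ 1)) z = eval2 (pd i (FC $ 1)) z * eval2 (pd j (FC $ 2)) z" for i j
  proof -
    have "eval2 (FC $ 2) z * (eval2 (pd i (FC $ 2)) z * eval2 (pd j (FC $ 1)) z)
        = eval2 (pd i (FC $ 2)) z * (eval2 (FC $ 2) z * eval2 (pd j (FC $ 1)) z)" by simp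
    also have "\<dots> = eval2 (FC $ 1) z * eval2 (pd i (FC $ 2)) z * eval2 (pd j (FC $ 2)) z"
      unfolding e by simp
    also have "\<dots> = eval2 (FC $ 2) z * (eval2 (pd i (FC $ 1)) z * eval2 (pd j (FC $ 2)) z)"
      unfolding e[symmetric] by simp
    finally show ?thesis using f2 by (simp only: mult_cancel_left) simp
  qed
  have "eval2 (pd i (crit j)) z = eval2 (pd i (pd j (newton_poly FC z))) z" for i j
    unfolding pd_crit par eval2_pd2_newton by (simp add: mult.commute)
  then show ?thesis using hess by (simp add: pd_commute power2_eq_square algebra_simps)
qed

text \<open>Both polynomials \<open>crit j\<close> have degree at most d_1 + d_2 - 1, and the
  complex roots of the system are d_1 d_2 common zeros outside the image of
  \<open>X\<close>.\<close>

lemma sing_set_bound: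
  assumes X: "finite X" "X \<subseteq> sing_set f"
  shows "card X + tdeg (f $ 1) * tdeg (f $ 2) \<le> (tdeg (f $ 1) + tdeg (f $ 2) - 1) ^ 2"
proof -
  have nz: "crit 1 \<noteq> 0 \<and> crit 2 \<noteq> 0"
  proof -
    have "card (common_zeros FC) > 0" using FC_common(2) deg by simp
    then obtain z where z: "z \<in> common_zeros FC" by (metis card_eq_0_iff ex_in_conv less_irrefl)
    then have "eval2 (crit 1) z = 0" "eval2 (crit 2) z = 0" by (auto simp: crit_def common_zeros_iff)
    from crit_nondegenerate[OF this] show ?thesis by auto
  qed
  \<comment> \<open>A nonconstant common factor would have a complex zero, at which the Jacobian of
    the two polynomials degenerates.\<close>
  have cop: "coprime (crit 1) (crit 2)"
  proof (rule ccontr)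
    assume "\<not> coprime (crit 1) (crit 2)"
    then have "\<not> is_unit (gcd (crit 1) (crit 2))" by (simp add: coprime_iff_gcd_eq_1)
    moreover have "gcd (crit 1) (crit 2) \<noteq> 0" using nz by simp
    ultimately obtain z where z: "eval2 (gcd (crit 1) (crit 2)) z = 0" using complex_zero_exists by blast
    have "eval2 (crit 1) z = 0" "eval2 (crit 2) z = 0"
      using z by (metis dvd_def eval2_simps(6) gcd_dvd1 gcd_dvd2 mult_zero_left)+
    from crit_nondegenerate[OF this] show False
      using common_factor_gradients[of "gcd (crit 1) (crit 2)" "crit 1" "crit 2" z] z by simp
  qed
  have degc: "tdeg (crit j) \<le> tdeg (f $ 1) + tdeg (f $ 2) - 1" for j
  proof -
    have "tdeg (FC $ 2 * pd j (FC $ 1)) \<le> tdeg (f $ 2) + (tdeg (f $ 1) - 1)"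
      using tdeg_mult_le[of "FC $ 2" "pd j (FC $ 1)"] tdeg_pd_le[of j "FC $ 1"] by (simp add: FC_nth)
    moreover have "tdeg (FC $ 1 * pd j (FC $ 2)) \<le> tdeg (f $ 1) + (tdeg (f $ 2) - 1)"
      using tdeg_mult_le[of "FC $ 1" "pd j (FC $ 2)"] tdeg_pd_le[of j "FC $ 2"] by (simp add: FC_nth)
    ultimately show ?thesis unfolding crit_def using deg by (intro tdeg_diff_le) auto
  qed
  have disj: "common_zeros FC \<inter> cvec ` X = {}"
    using X(2) by (auto simp: cvec_common_zeros_iff sing_set_iff)
  have zero: "eval2 (crit 1) z = 0 \<and> eval2 (crit 2) z = 0" if z: "z \<in> common_zeros FC \<union> cvec ` X" for z
  proof (cases "z \<in> common_zeros FC")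
    case True
    then show ?thesis by (auto simp: crit_def common_zeros_iff)
  next
    case False
    then obtain r where r: "z = cvec r" "r \<in> sing_set f" using z X(2) by auto
    have "eval2 (crit j) z = complex_of_real (eval2 (pd j (newton_poly f r)) r)" for j
      by (simp add: crit_def r FC_nth eval2_pd_newton complexify_pd[symmetric] eval2_complexify mult.commute)
    then show ?thesis using r(2) by (simp add: sing_set_iff singular_points_iff)
  qed
  have "card (common_zeros FC \<union> cvec ` X) \<le> tdeg (crit 1) * tdeg (crit 2)"
    by (rule card_zeros_le[OF conjunct1[OF nz] conjunct2[OF nz] cop _ zero]) (use FC_common(1) X(1) in auto)
  also have "\<dots> \<le> (tdeg (f $ 1) + tdeg (f $ 2) - 1) ^ 2"
    unfolding power2_eq_square by (intro mult_mono degc) auto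
  also have "card (common_zeros FC \<union> cvec ` X) = tdeg (f $ 1) * tdeg (f $ 2) + card X"
    using disj FC_common X(1) by (subst card_Un_disjoint) (auto simp: card_image inj_on_def)
  finally show ?thesis by simp
qed

lemma finite_sing_set: "finite (sing_set f)"
proof (rule ccontr)
  assume "infinite (sing_set f)"
  then obtain X where "X \<subseteq> sing_set f" "finite X" "card X = Suc ((tdeg (f $ 1) + tdeg (f $ 2) - 1) ^ 2)"
    using infinite_arbitrarily_large by metis
  then show False using sing_set_bound[of X] by simp
qed

subsection \<open>The arrangement of singular curves\<close>

text \<open>\<open>None\<close> stands for the curve \<open>f\<^sub>2 = 0\<close>, the member of the pencil at infinity.\<close>

definition curve :: "(real^2) option \<Rightarrow> real poly poly" where
  "curve i = (case i of None \<Rightarrow> f $ 2 | Some r \<Rightarrow> newton_poly f r)"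

definition indices :: "(real^2) option set" where
  "indices = insert None (Some ` sing_set f)"

lemma curve_simps [simp]: "curve None = f $ 2" "curve (Some r) = newton_poly f r"
  by (simp_all add: curve_def)

lemma finite_indices: "finite indices"
  by (simp add: indices_def finite_sing_set)

lemma sum_indices: "(\<Sum>i\<in>indices. g i) = g None + (\<Sum>r\<in>sing_set f. g (Some r))"
  using finite_sing_set by (simp add: indices_def sum.reindex)

text \<open>As d_2 < d_1, the top-degree part of \<open>newton_poly f r\<close> is that of f_1
  scaled by f_2(r).\<close>

lemma radial_newton:
  assumes "eval2 (f $ 2) r \<noteq> 0"
  shows "tdeg (newton_poly f r) = tdeg (f $ 1)"
    and "lead_coeff (radial (newton_poly f r)) = smult (eval2 (f $ 2) r) (lead_coeff (radial (f $ 1)))"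
proof -
  define d where "d = tdeg (f $ 1)"
  have "coeff (radial (newton_poly f r)) k
      = smult (eval2 (f $ 2) r) (coeff (radial (f $ 1)) k) - smult (eval2 (f $ 1) r) (coeff (radial (f $ 2)) k)" for k
    by (rule poly_eqI) (simp add: coeff_radial newton_poly_def)
  moreover have "coeff (radial (f $ 2)) d = 0"
    using deg by (intro coeff_eq_0) (simp add: degree_radial d_def)
  ultimately have c: "coeff (radial (newton_poly f r)) d = smult (eval2 (f $ 2) r) (lead_coeff (radial (f $ 1)))"
    by (simp add: degree_radial d_def)
  have "f $ 1 \<noteq> 0" using deg by auto
  then have "coeff (radial (newton_poly f r)) d \<noteq> 0"
    using assms unfolding c by (simp add: radial_eq_0_iff)
  then have "d \<le> tdeg (newton_poly f r)" unfolding degree_radial[symmetric] by (rule le_degree)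
  moreover have "tdeg (newton_poly f r) \<le> d"
    unfolding newton_poly_def
    using tdeg_mult_le[of "f $ 1" "const2 (eval2 (f $ 2) r)"] tdeg_mult_le[of "f $ 2" "const2 (eval2 (f $ 1) r)"] deg
    by (intro tdeg_diff_le) (simp_all add: d_def del: mult_pCons_right)
  ultimately show t: "tdeg (newton_poly f r) = tdeg (f $ 1)" by (simp add: d_def)
  show "lead_coeff (radial (newton_poly f r)) = smult (eval2 (f $ 2) r) (lead_coeff (radial (f $ 1)))"
    using c by (simp only: degree_radial t d_def)
qed

lemma curves_meet_in_base:
  assumes ij: "i \<in> indices" "j \<in> indices" "i \<noteq> j"
    and zero: "eval2 (curve i) x = 0" "eval2 (curve j) x = 0"
  shows "x \<in> common_zeros f"
proof -
  have one: "x \<in> common_zeros f" if "r \<in> sing_set f" "eval2 (f $ 2) x = 0" "eval2 (newton_poly f r) x = 0" for r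
    using that sing_f2_nonzero by (simp add: common_zeros_iff eval2_newton)
  have two: "x \<in> common_zeros f"
    if rs: "r \<in> sing_set f" "s \<in> sing_set f" "r \<noteq> s" "eval2 (newton_poly f r) x = 0" "eval2 (newton_poly f s) x = 0" for r s
  proof -
    \<comment> \<open>Elimination of f_1(x) from two members of the pencil. The factor at
      \<open>s\<close> is nonzero because a curve contains only one point of S, so f_2(x) =
      0.\<close>
    have "eval2 (f $ 2) x * eval2 (newton_poly f r) s
        = eval2 (f $ 2) s * eval2 (newton_poly f r) x - eval2 (f $ 2) r * eval2 (newton_poly f s) x"
      unfolding eval2_newton by (simp add: algebra_simps)
    then have "eval2 (f $ 2) x = 0" using rs sing_curve_unique[of r s] by auto
    then show ?thesis using one rs by blast
  qed
  show ?thesis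
  proof (cases i; cases j)
    fix r s assume "i = Some r" "j = Some s"
    then show ?thesis using ij zero two[of r s] by (auto simp: indices_def)
  qed (use ij zero one in \<open>auto simp: indices_def\<close>)
qed

text \<open>At a root the gradients of f_1 and f_2 are linearly independent, so no nontrivial
  combination vanishes.\<close>

lemma newton_gradient_at_base:
  assumes v: "v \<in> common_zeros f" and r: "eval2 (f $ 1) r \<noteq> 0 \<or> eval2 (f $ 2) r \<noteq> 0"
  shows "eval2 (pd 1 (newton_poly f r)) v \<noteq> 0 \<or> eval2 (pd 2 (newton_poly f r)) v \<noteq> 0"
proof (rule ccontr)
  define a b c d where "a = eval2 (pd 1 (f $ 1)) v" and "b = eval2 (pd 2 (f $ 1)) v"
    and "c = eval2 (pd 1 (f $ 2)) v" and "d = eval2 (pd 2 (f $ 2)) v"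
  define x y where "x = eval2 (f $ 1) r" and "y = eval2 (f $ 2) r"
  assume "\<not> ?thesis"
  then have e: "a * y = c * x" "b * y = d * x"
    by (simp_all add: eval2_pd_newton a_def b_def c_def d_def x_def y_def)
  have "(a * d - b * c) * y = d * (a * y) - c * (b * y)" by (simp add: algebra_simps)
  then have "(a * d - b * c) * y = 0" unfolding e by simp
  moreover have "(a * d - b * c) * x = a * (d * x) - b * (c * x)" by (simp add: algebra_simps)
  then have "(a * d - b * c) * x = 0" unfolding e[symmetric] by simp
  ultimately show False using real_jacobian[OF v] r by (auto simp: a_def b_def c_def d_def x_def y_def)
qed

text \<open>The second derivative in the direction (1, c).\<close>

definition hess :: "real poly poly \<Rightarrow> real^2 \<Rightarrow> real \<Rightarrow> real" where
  "hess p x c = eval2 (pd 1 (pd 1 p)) x + 2 * c * eval2 (pd 1 (pd 2 p)) x + c ^ 2 * eval2 (pd 2 (pd 2 p)) x"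

text \<open>Lines of slope \<open>c\<close> are not asymptotic to f_1 or f_2, not tangent to a
  branch at a double point, and transversal to every curve of the arrangement at the roots.\<close>

definition good_direction :: "real \<Rightarrow> bool" where
  "good_direction c \<longleftrightarrow> poly (lead_coeff (radial (f $ 1))) c \<noteq> 0 \<and> poly (lead_coeff (radial (f $ 2))) c \<noteq> 0
     \<and> (\<forall>r\<in>sing_set f. hess (newton_poly f r) r c \<noteq> 0)
     \<and> (\<forall>i\<in>indices. \<forall>v\<in>common_zeros f. slope (curve i) v (pt 1 c) \<noteq> 0)"

text \<open>Each condition excludes the roots of one polynomial in c. These are finitely many, and
  none is zero by nondegeneracy of the Hessians and of the gradients at the roots.\<close>

lemma good_direction_exists: "\<exists>c. good_direction c"
proof -
  define hp where "hp r = [:eval2 (pd 1 (pd 1 (newton_poly f r))) r, 2 * eval2 (pd 1 (pd 2 (newton_poly f r))) r,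
    eval2 (pd 2 (pd 2 (newton_poly f r))) r:]" for r
  define sp where "sp iv = [:eval2 (pd 1 (curve (fst iv))) (snd iv), eval2 (pd 2 (curve (fst iv))) (snd iv):]" for iv
  define W where "W = {lead_coeff (radial (f $ 1)), lead_coeff (radial (f $ 2))} \<union> hp ` sing_set f
    \<union> sp ` (indices \<times> common_zeros f)"
  have "hp r \<noteq> 0" if "r \<in> sing_set f" for r using newton_hessian[OF that] by (auto simp: hp_def)
  moreover have "sp (i, v) \<noteq> 0" if iv: "i \<in> indices" "v \<in> common_zeros f" for i v
  proof (cases i)
    case None
    then show ?thesis using real_smooth[of v 2] iv by (auto simp: sp_def singular_points_iff common_zeros_iff)
  next
    case (Some r)
    then show ?thesis
      using newton_gradient_at_base[OF iv(2), of r] iv(1) sing_f2_nonzero by (auto simp: sp_def indices_def)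
  qed
  moreover have "f $ 1 \<noteq> 0" "f $ 2 \<noteq> 0" using deg by auto
  ultimately have nz: "0 \<notin> W" by (auto simp: W_def radial_eq_0_iff eq_commute[of 0])
  have "finite (\<Union>w\<in>W. {c. poly w c = 0})"
    using nz finite_sing_set finite_indices finite_common_zeros
    by (intro finite_UN_I poly_roots_finite) (auto simp: W_def)
  then obtain c where "c \<notin> (\<Union>w\<in>W. {c. poly w c = 0})"
    using ex_new_if_finite[OF infinite_UNIV_char_0] by blast
  then have c: "poly w c \<noteq> 0" if "w \<in> W" for w using that by blast
  have "hess (newton_poly f r) r c = poly (hp r) c" for r
    by (simp add: hess_def hp_def power2_eq_square algebra_simps)
  moreover have "slope (curve i) v (pt 1 c) = poly (sp (i, v)) c" for i v
    by (simp add: slope_def sp_def algebra_simps)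
  ultimately have "good_direction c"
    unfolding good_direction_def using c by (auto simp: W_def)
  then show ?thesis ..
qed

lemma regular_curve:
  assumes c: "good_direction c" and i: "i \<in> indices"
  shows "regular_x1 (shear c (curve i))"
proof -
  have "poly (lead_coeff (radial (newton_poly f r))) c \<noteq> 0" if "r \<in> sing_set f" for r
    using c sing_f2_nonzero[OF that] radial_newton(2)[OF sing_f2_nonzero[OF that]] by (simp add: good_direction_def)
  then show ?thesis using c i unfolding regular_shear_iff by (auto simp: indices_def good_direction_def)
qed

lemma eval2_pd1_shear: "eval2 (pd 1 (shear c p)) z = slope p (shear_map c z) (pt 1 c)"
  by (simp only: pd_shear eval2_shear eval2_simps slope_def pt_nth) simp

lemma pd2_shear: "pd 2 (shear c p) = shear c (pd 2 (p :: real poly poly))"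
  by (simp add: pd_def shear_def pderiv_pcompose pderiv_pCons)

lemma eval2_pd11_shear: "eval2 (pd 1 (pd 1 (shear c p))) z = hess p (shear_map c z) c"
  by (simp only: pd_shear eval2_shear eval2_simps pd_add pd_mult pd_const hess_def pd_commute)
    (simp add: power2_eq_square algebra_simps)

lemma line_order_eq_0_iff: "regular_x1 F \<Longrightarrow> line_order F z = 0 \<longleftrightarrow> eval2 F z \<noteq> 0"
  using regular_x1_line(3)[of F "z $ 2"] by (simp add: line_order_def order_eq_0_iff eval2_line)

lemma line_order_1:
  assumes "eval2 F z = 0" "eval2 (pd 1 F) z \<noteq> 0"
  shows "line_order F z = 1"
proof -
  define p where "p = poly F [:z $ 2:]"
  have p: "poly p (z $ 1) = 0" "poly (pderiv p) (z $ 1) \<noteq> 0"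
    using assms by (simp_all add: eval2_line poly_pd1 p_def)
  then have "p \<noteq> 0" by auto
  from order_pderiv[OF this p(1)] show ?thesis
    using order_0I[OF p(2)] by (simp add: line_order_def p_def)
qed

lemma line_order_prod:
  assumes "finite I" "\<And>i. i \<in> I \<Longrightarrow> regular_x1 (F i)"
  shows "line_order (\<Prod>i\<in>I. F i) z = (\<Sum>i\<in>I. line_order (F i) z)"
  using assms
proof (induction I rule: finite_induct)
  case empty
  then show ?case by (simp add: line_order_def)
next
  case (insert i I)
  have "poly (F j) [:z $ 2:] \<noteq> 0" if "j \<in> insert i I" for j
    using insert.prems that regular_x1_line(3) by blast
  then have "poly (F i) [:z $ 2:] * (\<Prod>j\<in>I. poly (F j) [:z $ 2:]) \<noteq> 0"
    using insert.hyps(1) by simp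
  then show ?case using insert by (simp add: line_order_def poly_prod order_mult)
qed

text \<open>A square factor would yield two complex singular points, but f_2 = 0 has none and each
  singular Newton curve only one.\<close>

lemma curve_coprime:
  assumes c: "good_direction c" and i: "i \<in> indices"
  shows "coprime (shear c (curve i)) (pd 1 (shear c (curve i)))"
proof (rule coprime_pd1[OF regular_curve[OF c i]])
  fix h :: "real poly poly" assume h: "tdeg h > 0" "regular_x1 h"
  show "\<not> h * h dvd shear c (curve i)"
  proof
    assume "h * h dvd shear c (curve i)"
    then obtain x y where xy: "x \<noteq> y" "x \<in> singular_points (complexify (curve i))"
      "y \<in> singular_points (complexify (curve i))"
      using square_factor_singular_points[OF h(2,1)] by blast
    show False
    proof (cases i)
      case None
      then show False using xy FC_smooth[of x 2] by (simp add: FC_nth)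
    next
      case (Some r)
      then have "r \<in> sing_set f" using i by (auto simp: indices_def)
      then show False
        using xy Some FC_unique[of "cvec r" x y]
        by (simp add: complexify_newton cvec_common_zeros_iff sing_set_iff)
    qed
  qed
qed

lemma tdeg_curve:
  "tdeg (curve None) = tdeg (f $ 2)" "r \<in> sing_set f \<Longrightarrow> tdeg (curve (Some r)) = tdeg (f $ 1)"
  using radial_newton(1) sing_f2_nonzero by auto

lemma curve_tangents:
  assumes c: "good_direction c" and i: "i \<in> indices" and Z: "finite Z" "N \<subseteq> Z"
    and N: "\<And>z. z \<in> N \<Longrightarrow> eval2 (shear c (curve i)) z = 0 \<and> gradient2 (shear c (curve i)) z = 0
      \<and> eval2 (pd 1 (pd 1 (shear c (curve i)))) z \<noteq> 0"
  shows "(\<Sum>z\<in>Z. line_order (shear c (curve i)) z - 1) + card N \<le> tdeg (curve i) * (tdeg (curve i) - 1)"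
proof -
  define G where "G = shear c (curve i)"
  have reg: "regular_x1 G" using regular_curve[OF c i] by (simp add: G_def)
  have pos: "tdeg G > 0" using i deg tdeg_curve by (auto simp: G_def tdeg_shear indices_def)
  have "(\<Sum>z\<in>Z. line_order G z - 1) + card N \<le> tdeg G * tdeg (pd 1 G)"
  proof (rule line_order_sum_le)
    show "pd 1 G \<noteq> 0" using regular_x1_pd1[OF reg pos] by auto
  qed (use curve_coprime[OF c i] reg regular_x1_nonzero regular_x1_line(3) Z N in \<open>auto simp: G_def\<close>)
  also have "\<dots> \<le> tdeg G * (tdeg G - 1)" by (intro mult_le_mono2 tdeg_pd_le)
  finally show ?thesis by (simp add: G_def tdeg_shear)
qed

lemma newton_tangents:
  assumes c: "good_direction c" and r: "r \<in> sing_set f" and Z: "finite Z"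
  shows "(\<Sum>z\<in>Z. line_order (shear c (newton_poly f r)) z - 1) + 1 \<le> tdeg (f $ 1) * (tdeg (f $ 1) - 1)"
proof -
  \<comment> \<open>The double point in sheared coordinates. It is adjoined to \<open>Z\<close> so
    that its extra functional is counted; this is the gain of 1.\<close>
  define n where "n = shear_map (- c) r"
  have sing: "eval2 (newton_poly f r) r = 0" "eval2 (pd 1 (newton_poly f r)) r = 0" "eval2 (pd 2 (newton_poly f r)) r = 0"
    using r by (auto simp: sing_set_iff singular_points_iff)
  have "eval2 (shear c (newton_poly f r)) n = 0 \<and> gradient2 (shear c (newton_poly f r)) n = 0
      \<and> eval2 (pd 1 (pd 1 (shear c (newton_poly f r)))) n \<noteq> 0"
  proof (intro conjI)
    show "eval2 (shear c (newton_poly f r)) n = 0" using sing by (simp add: eval2_shear n_def)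
    have "eval2 (pd 1 (shear c (newton_poly f r))) n = 0" unfolding eval2_pd1_shear n_def
      using sing by (simp add: slope_def)
    moreover have "eval2 (pd 2 (shear c (newton_poly f r))) n = 0"
      using sing by (simp add: pd2_shear eval2_shear n_def)
    ultimately show "gradient2 (shear c (newton_poly f r)) n = 0"
      by (simp add: gradient2_def vec_eq_iff forall_2)
    show "eval2 (pd 1 (pd 1 (shear c (newton_poly f r)))) n \<noteq> 0"
      unfolding eval2_pd11_shear n_def using c r by (simp add: good_direction_def)
  qed
  then have "(\<Sum>z\<in>insert n Z. line_order (shear c (curve (Some r))) z - 1) + card {n}
      \<le> tdeg (curve (Some r)) * (tdeg (curve (Some r)) - 1)"
    using r Z by (intro curve_tangents[OF c]) (auto simp: indices_def)
  moreover have "(\<Sum>z\<in>Z. line_order (shear c (newton_poly f r)) z - 1)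
      \<le> (\<Sum>z\<in>insert n Z. line_order (shear c (newton_poly f r)) z - 1)"
    using Z by (intro sum_mono2) auto
  ultimately show ?thesis using tdeg_curve(2)[OF r] by simp
qed

text \<open>At a root all s + 1 curves pass, each with order 1, so the excess is s. Elsewhere at
  most one curve passes, and the excess is its own.\<close>

lemma arrangement_order:
  assumes c: "good_direction c"
  shows "line_order (\<Prod>i\<in>indices. shear c (curve i)) z - 1
    \<le> (\<Sum>i\<in>indices. line_order (shear c (curve i)) z - 1)
      + (if shear_map c z \<in> common_zeros f then card (sing_set f) else 0)"
proof -
  define m where "m i = line_order (shear c (curve i)) z" for i
  have total: "line_order (\<Prod>i\<in>indices. shear c (curve i)) z = (\<Sum>i\<in>indices. m i)"
    unfolding m_def using finite_indices regular_curve[OF c] by (rule line_order_prod)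
  have m0: "m i = 0 \<longleftrightarrow> eval2 (curve i) (shear_map c z) \<noteq> 0" if "i \<in> indices" for i
    using line_order_eq_0_iff[OF regular_curve[OF c that]] by (simp add: m_def eval2_shear)
  show ?thesis
  proof (cases "shear_map c z \<in> common_zeros f")
    case True
    have "m i = 1" if i: "i \<in> indices" for i
      unfolding m_def
    proof (rule line_order_1)
      show "eval2 (shear c (curve i)) z = 0"
        using True i by (cases i) (auto simp: eval2_shear common_zeros_iff eval2_newton)
      show "eval2 (pd 1 (shear c (curve i))) z \<noteq> 0"
        unfolding eval2_pd1_shear using c True i by (simp add: good_direction_def)
    qed
    then have "(\<Sum>i\<in>indices. m i) = card indices" by simp
    also have "\<dots> = Suc (card (sing_set f))"
      unfolding indices_def using finite_sing_set by (subst card_insert_disjoint) (auto simp: card_image)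
    finally show ?thesis using True total by simp
  next
    case False
    show ?thesis
    proof (cases "\<exists>i\<in>indices. m i \<noteq> 0")
      case True
      then obtain i where i: "i \<in> indices" "m i \<noteq> 0" by blast
      have "m j = 0" if "j \<in> indices - {i}" for j
        using curves_meet_in_base[of i j "shear_map c z"] m0 i that False by auto
      then have "(\<Sum>i\<in>indices. m i) = m i"
        using i(1) finite_indices by (subst sum.remove[of _ i]) auto
      moreover have "m i - 1 \<le> (\<Sum>i\<in>indices. m i - 1)"
        using i finite_indices by (intro member_le_sum) auto
      ultimately show ?thesis by (simp add: total m_def)
    next
      case False
      then show ?thesis by (simp add: total)
    qed
  qed
qed

lemma arrangement_order_sum:
  assumes c: "good_direction c" and Z: "finite Z"
  shows "(\<Sum>z\<in>Z. line_order (\<Prod>i\<in>indices. shear c (curve i)) z - 1)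
    \<le> card (sing_set f) * (tdeg (f $ 1) * (tdeg (f $ 1) - 1) - 1) + tdeg (f $ 2) * (tdeg (f $ 2) - 1)
      + card (sing_set f) * (tdeg (f $ 1) * tdeg (f $ 2))"
proof -
  define s where "s = card (sing_set f)"
  have "(\<Sum>z\<in>Z. line_order (\<Prod>i\<in>indices. shear c (curve i)) z - 1)
    \<le> (\<Sum>z\<in>Z. (\<Sum>i\<in>indices. line_order (shear c (curve i)) z - 1) + (if shear_map c z \<in> common_zeros f then s else 0))"
    unfolding s_def by (intro sum_mono arrangement_order[OF c])
  also have "\<dots> = (\<Sum>i\<in>indices. \<Sum>z\<in>Z. line_order (shear c (curve i)) z - 1)
      + (\<Sum>z\<in>Z. if shear_map c z \<in> common_zeros f then s else 0)"
    unfolding sum.distrib by (subst sum.swap) simp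
  also have "(\<Sum>i\<in>indices. \<Sum>z\<in>Z. line_order (shear c (curve i)) z - 1)
      \<le> tdeg (f $ 2) * (tdeg (f $ 2) - 1) + s * (tdeg (f $ 1) * (tdeg (f $ 1) - 1) - 1)"
  proof -
    have "(\<Sum>z\<in>Z. line_order (shear c (curve None)) z - 1) \<le> tdeg (f $ 2) * (tdeg (f $ 2) - 1)"
      using curve_tangents[OF c, of None Z "{}"] Z by (simp add: indices_def)
    moreover have "(\<Sum>r\<in>sing_set f. \<Sum>z\<in>Z. line_order (shear c (curve (Some r))) z - 1)
        \<le> s * (tdeg (f $ 1) * (tdeg (f $ 1) - 1) - 1)"
      unfolding s_def using newton_tangents[OF c _ Z]
      by (intro sum_bounded_above[where 'a = nat, simplified]) (fastforce simp: le_diff_conv2)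
    ultimately show ?thesis unfolding sum_indices by (rule add_mono)
  qed
  also have "(\<Sum>z\<in>Z. if shear_map c z \<in> common_zeros f then s else 0) \<le> s * (tdeg (f $ 1) * tdeg (f $ 2))"
  proof -
    define Z' where "Z' = {z \<in> Z. shear_map c z \<in> common_zeros f}"
    have "inj_on (shear_map c) Z'" by (metis inj_onI shear_map_inverse(1))
    moreover have "shear_map c ` Z' \<subseteq> common_zeros f" by (auto simp: Z'_def)
    ultimately have "card Z' \<le> card (common_zeros f)" by (rule card_inj_on_le[OF _ _ finite_common_zeros])
    then have "card Z' \<le> tdeg (f $ 1) * tdeg (f $ 2)" using card_common_zeros by simp
    moreover have "(\<Sum>z\<in>Z. if shear_map c z \<in> common_zeros f then s else 0) = card Z' * s"
      using Z by (simp add: sum.If_cases Z'_def Int_def)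
    ultimately show ?thesis by (simp add: mult.commute)
  qed
  finally show ?thesis by (simp add: s_def)
qed

text \<open>The first summand counts the regions on a low line; the second sums the contacts of the
  singular curves, those of f_2, and the roots of the system.\<close>

abbreviation "region_bound \<equiv> Suc (card (sing_set f) * tdeg (f $ 1) + tdeg (f $ 2))
    + (card (sing_set f) * (tdeg (f $ 1) * (tdeg (f $ 1) - 1) - 1) + tdeg (f $ 2) * (tdeg (f $ 2) - 1)
      + card (sing_set f) * (tdeg (f $ 1) * tdeg (f $ 2)))"

lemma card_regions:
  assumes c: "good_direction c" and R: "finite R" "R \<subseteq> components {x. eval2 (\<Prod>i\<in>indices. shear c (curve i)) x \<noteq> 0}"
  shows "card R \<le> region_bound"
proof -
  define P where "P = (\<Prod>i\<in>indices. shear c (curve i))"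
  have prod: "regular_x1 (\<Prod>i\<in>I. shear c (curve i)) \<and> tdeg (\<Prod>i\<in>I. shear c (curve i)) = (\<Sum>i\<in>I. tdeg (curve i))"
    if "finite I" "I \<subseteq> indices" for I
    using that
  proof (induction I rule: finite_induct)
    case empty
    have "tdeg 1 = 0" using tdeg_const2[of "1::real"] by (simp add: one_pCons)
    then show ?case by (simp add: regular_x1_def)
  next
    case (insert i I)
    then have reg: "regular_x1 (shear c (curve i))" "regular_x1 (\<Prod>i\<in>I. shear c (curve i))"
      using regular_curve[OF c, of i] by auto
    show ?case
      using insert reg tdeg_mult[OF reg[THEN regular_x1_nonzero]] by (simp add: regular_x1_mult tdeg_shear)
  qed
  have "card R \<le> Suc (tdeg P) + (card (sing_set f) * (tdeg (f $ 1) * (tdeg (f $ 1) - 1) - 1)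
      + tdeg (f $ 2) * (tdeg (f $ 2) - 1) + card (sing_set f) * (tdeg (f $ 1) * tdeg (f $ 2)))"
    using prod[OF finite_indices] R arrangement_order_sum[OF c] unfolding P_def
    by (intro card_regions_le) auto
  moreover have "tdeg P = card (sing_set f) * tdeg (f $ 1) + tdeg (f $ 2)"
    using prod[OF finite_indices] tdeg_curve by (simp add: P_def sum_indices)
  ultimately show ?thesis by simp
qed

section \<open>From the arrangement to the cells\<close>

lemma leading_form_transversal:
  assumes u: "u \<noteq> 0" "eval2 (leading_form (f $ 1)) u = 0"
  shows "gradient2 (leading_form (f $ 1)) u \<noteq> 0"
proof -
  have "cvec u \<noteq> 0" using u(1) by (simp add: vec_eq_iff)
  moreover have "eval2 (complexify (leading_form (f $ 1))) (cvec u) = 0" using u(2) by (simp add: eval2_complexify)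
  ultimately have "gradient2 (complexify (leading_form (f $ 1))) (cvec u) \<noteq> 0"
    using gen by (simp add: generic_def generic2_def Let_def)
  then show ?thesis by (auto simp: gradient2_complexify vec_eq_iff)
qed

lemma start_component_eq:
  assumes "r \<notin> common_zeros f"
  shows "start_component f r = connected_component_set {x. eval2 (newton_poly f r) x = 0} r"
  by (simp add: start_component_def newton_curve_eq_zeros[OF assms] zeros_def)

lemma cell_boundary_subset:
  assumes b: "b \<in> cell_boundary f"
  shows "eval2 (\<Prod>i\<in>indices. curve i) b = 0"
proof (rule ccontr)
  assume "eval2 (\<Prod>i\<in>indices. curve i) b \<noteq> 0"
  then have nz: "eval2 (curve i) b \<noteq> 0" if "i \<in> indices" for i
    using that finite_indices by (simp add: eval2_prod)
  have f2b: "eval2 (f $ 2) b \<noteq> 0" using nz[of None] by (simp add: indices_def)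
  have bV: "b \<notin> common_zeros f" using f2b by (simp add: common_zeros_iff)
  \<comment> \<open>A singular point \<open>x\<close> of C_b would be singular on C_x too, since the
    two polynomials are proportional. So \<open>x\<close> is in S and \<open>b\<close> lies on its
    curve.\<close>
  have smooth: "gradient2 (newton_poly f b) x \<noteq> 0" if x: "eval2 (newton_poly f b) x = 0" for x
  proof
    assume "gradient2 (newton_poly f b) x = 0"
    then have g: "eval2 (pd 1 (newton_poly f b)) x = 0" "eval2 (pd 2 (newton_poly f b)) x = 0"
      by (auto simp: gradient2_def vec_eq_iff)
    have xV: "x \<notin> common_zeros f" using newton_gradient_at_base[of x b] g f2b by auto
    have on: "eval2 (f $ 1) x * eval2 (f $ 2) b = eval2 (f $ 2) x * eval2 (f $ 1) b"
      using x by (simp add: eval2_newton)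
    have scaled: "eval2 (f $ 2) b * eval2 (pd j (newton_poly f x)) x
        = eval2 (f $ 2) x * eval2 (pd j (newton_poly f b)) x" for j
      unfolding eval2_pd_newton right_diff_distrib using on by (simp add: algebra_simps)
    have "eval2 (pd j (newton_poly f x)) x = 0" if "eval2 (pd j (newton_poly f b)) x = 0" for j
      using scaled[of j] f2b that by simp
    then have "x \<in> sing_set f"
      using g xV by (simp add: sing_set_iff singular_points_iff eval2_newton)
    then have "eval2 (newton_poly f x) b \<noteq> 0" using nz[of "Some x"] by (simp add: indices_def)
    then show False using on by (simp add: eval2_newton mult.commute)
  qed
  have "\<exists>\<delta>>0. \<forall>r. dist r b < \<delta> \<longrightarrow>
      common_zeros f \<inter> connected_component_set {x. eval2 (newton_poly f r) x = 0} r
    = common_zeros f \<inter> connected_component_set {x. eval2 (newton_poly f b) x = 0} b"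
    unfolding newton_poly_def
  proof (rule component_zeros_locally_constant[OF deg(1) leading_form_transversal f2b])
    show "gradient2 (f $ 1 * const2 (eval2 (f $ 2) b) - f $ 2 * const2 (eval2 (f $ 1) b)) x \<noteq> 0"
      if "eval2 (f $ 1 * const2 (eval2 (f $ 2) b) - f $ 2 * const2 (eval2 (f $ 1) b)) x = 0" for x
      using smooth that unfolding newton_poly_def by blast
    show "v \<in> {x. eval2 (f $ 1 * const2 (eval2 (f $ 2) r) - f $ 2 * const2 (eval2 (f $ 1) r)) x = 0}"
      if "v \<in> common_zeros f" for v r
      using that eval2_newton[of f r v] by (simp add: common_zeros_iff newton_poly_def)
  qed (use finite_common_zeros in auto)
  then obtain \<delta>1 where \<delta>1: "\<delta>1 > 0" "\<And>r. dist r b < \<delta>1 \<Longrightarrow>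
      common_zeros f \<inter> connected_component_set {x. eval2 (newton_poly f r) x = 0} r
    = common_zeros f \<inter> connected_component_set {x. eval2 (newton_poly f b) x = 0} b" by blast
  have "open (- common_zeros f)" using finite_common_zeros by (simp add: finite_imp_closed open_Compl)
  then obtain \<delta>2 where \<delta>2: "\<delta>2 > 0" "ball b \<delta>2 \<subseteq> - common_zeros f" using openE bV by blast
  define W where "W = ball b (min \<delta>1 \<delta>2)"
  have W: "open W" "b \<in> W" using \<delta>1(1) \<delta>2(1) by (auto simp: W_def)
  \<comment> \<open>Membership in a class is constant on the neighborhood \<open>W\<close>, so
    \<open>b\<close> can be a frontier point of none.\<close>
  have const: "r \<in> root_class f U \<longleftrightarrow> b \<in> root_class f U" if "r \<in> W" for r U
  proof -
    have "r \<notin> common_zeros f" "dist r b < \<delta>1" using that \<delta>2(2) by (auto simp: W_def dist_commute)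
    then show ?thesis using \<delta>1(2) bV by (simp add: root_class_def start_component_eq)
  qed
  from b obtain U where U: "b \<in> frontier (root_class f U)" by (auto simp: cell_boundary_def)
  show False
  proof (cases "b \<in> root_class f U")
    case True
    then have "W \<subseteq> root_class f U" using const by blast
    then have "b \<in> interior (root_class f U)" using W interior_maximal by blast
    then show False using U by (simp add: frontier_def)
  next
    case False
    then have "W \<inter> root_class f U = {}" using const by blast
    then have "b \<notin> closure (root_class f U)" using W closure_iff_nhds_not_empty by blast
    then show False using U by (simp add: frontier_def)
  qed
qed

text \<open>A cell is open and so contains a point off the arrangement. The region of that point
  avoids the extended boundary and hence stays inside the cell, so different cells receive different
  regions.\<close>

lemma card_finite_cells:
  assumes C: "finite C" "C \<subseteq> cells f"
  shows "card C \<le> region_bound"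
proof -
  obtain c where c: "good_direction c" using good_direction_exists by blast
  define P where "P = (\<Prod>i\<in>indices. shear c (curve i))"
  define B where "B = zariski_closure (cell_boundary f)"
  have P: "eval2 P z = eval2 (\<Prod>i\<in>indices. curve i) (shear_map c z)" for z
    by (simp add: P_def eval2_prod eval2_shear)
  \<comment> \<open>The arrangement is itself algebraic, so it contains the Zariski closure of the
    boundary.\<close>
  have "algebraic_set {x. eval2 (\<Prod>i\<in>indices. curve i) x = 0}"
    unfolding algebraic_set_def by (intro exI[of _ "{\<Prod>i\<in>indices. curve i}"]) auto
  then have BP: "B \<subseteq> {x. eval2 (\<Prod>i\<in>indices. curve i) x = 0}"
    using cell_boundary_subset unfolding B_def zariski_closure_def by blast
  have "closed X" if "algebraic_set X" for X
  proof -
    from that obtain Q where "X = (\<Inter>p\<in>Q. {x. eval2 p x = 0})" by (auto simp: algebraic_set_def)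
    then show ?thesis by (auto intro!: closed_INT closed_Collect_eq continuous_intros)
  qed
  then have "closed B" unfolding B_def zariski_closure_def by (intro closed_Inter) auto
  then have openB: "open (UNIV - B)" by (simp add: open_Diff)
  have compC: "X \<in> components (UNIV - B)" if "X \<in> C" for X using that C by (auto simp: cells_def B_def)
  have "\<exists>z. shear_map c z \<in> X \<and> eval2 P z \<noteq> 0" if X: "X \<in> C" for X
  proof -
    have "open X" using open_components[OF openB compC[OF X]] .
    then have "open (shear_map c -` X)" by (rule open_vimage) (rule continuous_on_shear_map)
    moreover obtain x where "x \<in> X" using in_components_nonempty[OF compC[OF X]] by blast
    then have "shear_map (- c) x \<in> shear_map c -` X" by simp
    ultimately have op: "open (shear_map c -` X)" "shear_map (- c) x \<in> shear_map c -` X" .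
    define z where "z = shear_map (- c) x"
    have "open ((\<lambda>t. pt t (z $ 2)) -` (shear_map c -` X))"
      by (rule open_vimage[OF op(1)]) (intro continuous_intros)
    moreover have "z \<in> shear_map c -` X" using op(2) by (simp only: z_def)
    then have "z $ 1 \<in> (\<lambda>t. pt t (z $ 2)) -` (shear_map c -` X)" by simp
    ultimately have "infinite ((\<lambda>t. pt t (z $ 2)) -` (shear_map c -` X))"
      using finite_imp_not_open by blast
    moreover have "poly (shear c (curve i)) [:z $ 2:] \<noteq> 0" if "i \<in> indices" for i
      by (rule regular_x1_line(3)[OF regular_curve[OF c that]])
    then have "poly P [:z $ 2:] \<noteq> 0" using finite_indices by (simp add: P_def poly_prod)
    then have "finite {t. poly (poly P [:z $ 2:]) t = 0}" by (rule poly_roots_finite)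
    ultimately have "\<not> (\<lambda>t. pt t (z $ 2)) -` (shear_map c -` X) \<subseteq> {t. poly (poly P [:z $ 2:]) t = 0}"
      using finite_subset by blast
    then obtain t where "t \<in> (\<lambda>t. pt t (z $ 2)) -` (shear_map c -` X)" "poly (poly P [:z $ 2:]) t \<noteq> 0"
      by blast
    then show ?thesis by (intro exI[of _ "pt t (z $ 2)"]) (simp add: eval2_pt)
  qed
  then obtain z where z: "\<And>X. X \<in> C \<Longrightarrow> shear_map c (z X) \<in> X" "\<And>X. X \<in> C \<Longrightarrow> eval2 P (z X) \<noteq> 0" by metis
  define \<Omega> where "\<Omega> X = connected_component_set {x. eval2 P x \<noteq> 0} (z X)" for X
  have \<Omega>: "\<Omega> X \<in> components {x. eval2 P x \<noteq> 0}" if "X \<in> C" for X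
    using z(2)[OF that] by (auto simp: \<Omega>_def components_def)
  have sub: "shear_map c ` \<Omega> X \<subseteq> X" if X: "X \<in> C" for X
  proof (rule components_maximal[OF compC[OF X]])
    show "connected (shear_map c ` \<Omega> X)"
      by (intro connected_continuous_image continuous_intros) (simp add: \<Omega>_def)
    have "\<Omega> X \<subseteq> {x. eval2 P x \<noteq> 0}" unfolding \<Omega>_def by (rule connected_component_subset)
    then show "shear_map c ` \<Omega> X \<subseteq> UNIV - B" using BP by (auto simp: P)
    have "z X \<in> \<Omega> X" using z(2)[OF X] by (simp add: \<Omega>_def)
    then show "X \<inter> shear_map c ` \<Omega> X \<noteq> {}" using z(1)[OF X] by blast
  qed
  have inj: "inj_on \<Omega> C"
  proof (rule inj_onI)
    fix X Y assume XY: "X \<in> C" "Y \<in> C" "\<Omega> X = \<Omega> Y"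
    have "z X \<in> \<Omega> X" using z(2)[OF XY(1)] by (simp add: \<Omega>_def)
    then have "shear_map c (z X) \<in> X \<inter> Y" using sub XY by blast
    then show "X = Y" using components_nonoverlap[OF compC[OF XY(1)] compC[OF XY(2)]] by blast
  qed
  have "card (\<Omega> ` C) \<le> region_bound"
    using C \<Omega> by (intro card_regions[OF c]) (auto simp: P_def)
  then show ?thesis by (simp add: card_image[OF inj])
qed

lemma cells_bound:
  shows "finite (cells f)"
    and "card (cells f) \<le> region_bound"
proof -
  show fin: "finite (cells f)"
  proof (rule ccontr)
    assume "infinite (cells f)"
    then obtain C where "C \<subseteq> cells f" "finite C" "card C = Suc region_bound"
      using infinite_arbitrarily_large by metis
    then show False using card_finite_cells[of C] by simp
  qed
  show "card (cells f) \<le> region_bound" using card_finite_cells[OF fin] by simp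
qed

end

theorem theorem51:
  fixes f :: "real poly poly ^ 2" and d1 d2 s :: int
  assumes "d1 = int (tdeg (f $ 1))" and "d2 = int (tdeg (f $ 2))"
    and "s = int (card (sing_set f))"
    and "d1 > 0" and "d2 > 0" and "d1 \<ge> d2" and "d1 \<ge> 2"
    and "generic f"
    and "d1 > d2"
  shows "finite (sing_set f) \<and> finite (cells f)
    \<and> int (card (cells f)) \<le> s^2 * d1 * (d1 - d2) + s * (2 * d1 * d2 - 1) + d2^2 + 1
    \<and> (infinity_complete f \<longrightarrow>
         int (card (cells f)) \<le> s * (d1^2 + d1 * d2 - 1) + d2^2 + 1
         \<and> s * (d1^2 + d1 * d2 - 1) + d2^2 + 1
           \<le> (d1 + d2) * (d1^3 + d1^2 * d2 - 2 * d1^2 + d1 * d2^2 - 2 * d1 * d2 + 2))"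
proof -
  define a b k where "a = tdeg (f $ 1)" and "b = tdeg (f $ 2)" and "k = card (sing_set f)"
  have deg: "tdeg (f $ 2) < tdeg (f $ 1)" "0 < tdeg (f $ 2)" using assms by simp_all
  note gen = assms(8)
  have eq: "d1 = int a" "d2 = int b" "s = int k" using assms by (simp_all add: a_def b_def k_def)
  have ab: "b \<ge> 1" "b < a" using deg by (simp_all add: a_def b_def)
  have finS: "finite (sing_set f)" by (rule finite_sing_set[OF gen deg])
  have count: "int (card (cells f)) \<le> s * (d1^2 + d1 * d2 - 1) + d2^2 + 1"
  proof -
    have "card (cells f) \<le> Suc (k * a + b) + (k * (a * (a - 1) - 1) + b * (b - 1) + k * (a * b))"
      using cells_bound(2)[OF gen deg] by (simp add: a_def b_def k_def)
    then have "int (card (cells f)) \<le> int (Suc (k * a + b) + (k * (a * (a - 1) - 1) + b * (b - 1) + k * (a * b)))"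
      by (simp only: of_nat_le_iff)
    also have "\<dots> = 1 + s * d1 + d2 + (s * (d1 * (d1 - 1) - 1) + d2 * (d2 - 1) + s * (d1 * d2))"
    proof -
      \<comment> \<open>From 1 \<le> b < a follows a \<ge> 2, so the truncated subtractions are
        exact.\<close>
      have "int (a * (a - 1) - 1) = d1 * (d1 - 1) - 1"
      proof -
        have "1 \<le> a * (a - 1)" using ab by (cases a) auto
        then show ?thesis using ab by (simp add: eq of_nat_diff)
      qed
      moreover have "int (b * (b - 1)) = d2 * (d2 - 1)" using ab by (simp add: eq of_nat_diff)
      ultimately show ?thesis by (simp add: eq)
    qed
    also have "\<dots> = s * (d1^2 + d1 * d2 - 1) + d2^2 + 1"
      by (simp add: power2_eq_square algebra_simps)
    finally show ?thesis .
  qed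
  have first: "s * (d1^2 + d1 * d2 - 1) + d2^2 + 1 \<le> s^2 * d1 * (d1 - d2) + s * (2 * d1 * d2 - 1) + d2^2 + 1"
  proof -
    have "0 \<le> s * (s - 1)" by (cases "k = 0") (auto simp: eq)
    moreover have "0 \<le> d1 * (d1 - d2)" using assms by simp
    ultimately have "0 \<le> s * (s - 1) * (d1 * (d1 - d2))" by (rule mult_nonneg_nonneg)
    then show ?thesis by (simp add: power2_eq_square algebra_simps)
  qed
  have last: "s * (d1^2 + d1 * d2 - 1) + d2^2 + 1
      \<le> (d1 + d2) * (d1^3 + d1^2 * d2 - 2 * d1^2 + d1 * d2^2 - 2 * d1 * d2 + 2)"
  proof -
    have "k + a * b \<le> (a + b - 1) ^ 2"
      using sing_set_bound[OF gen deg finS order_refl] by (simp add: a_def b_def k_def)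
    then have "int (k + a * b) \<le> int ((a + b - 1) ^ 2)" by (simp only: of_nat_le_iff)
    then have s: "s \<le> (d1 + d2 - 1) ^ 2 - d1 * d2" using ab by (simp add: eq of_nat_diff)
    have "0 \<le> d1^2 + d1 * d2 - 1"
    proof -
      have "1 * 1 \<le> d1 * d2" using assms by (intro mult_mono) auto
      then show ?thesis using zero_le_power2[of d1] by linarith
    qed
    then have "s * (d1^2 + d1 * d2 - 1) \<le> ((d1 + d2 - 1) ^ 2 - d1 * d2) * (d1^2 + d1 * d2 - 1)"
      by (rule mult_right_mono[OF s])
    \<comment> \<open>With the largest admissible value of \<open>s\<close> the left-hand side
      becomes exactly the right-hand side.\<close>
    then show ?thesis by (simp add: power2_eq_square power3_eq_cube algebra_simps)
  qed
  show ?thesis using finS cells_bound(1)[OF gen deg] count first last by linarith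
qed

end
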